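(* Let $\boldsymbol p=(p,0)$ or $\boldsymbol p=(0,p)$ with $p\in\mathbb N=\{1,2,\dots\}$. For a symbol correspondence $W:\mathcal B(\mathcal H_{\boldsymbol p})\to C^\infty_{\mathbb C}(\mathbb CP^2)$ with operator kernel $K$ and characteristic numbers $(c_n)$, the integral trikernel $\mathbb L^W_{\boldsymbol p}$ is given by $$\mathbb L^W_{\boldsymbol p}(\mathrm x_1,\mathrm x_2,\mathrm x_3)=(\dim\boldsymbol p)^2\operatorname{tr}\big(\widetilde K(\mathrm x_1)\widetilde K(\mathrm x_2)K(\mathrm x_3)\big)$$ $$=(-1)^p\sqrt{\dim(\boldsymbol p)}\sum_{n_1,n_2,n_3=0}^p\ \sum_{\substack{\boldsymbol\nu_k,J_k\\ k=1,2,3}}\begin{bmatrix}n_1&n_2&n_3\\ \boldsymbol\nu_1,J_1&\boldsymbol\nu_2,J_2&\boldsymbol\nu_3,J_3\end{bmatrix}[\boldsymbol p]\;\frac{c_{n_3}}{c_{n_1}c_{n_2}}\,\overline{X^{n_1}_{\boldsymbol\nu_1,J_1}}(\mathrm x_1)\,\overline{X^{n_2}_{\boldsymbol\nu_2,J_2}}(\mathrm x_2)\,\overline{X^{n_3}_{\boldsymbol\nu_3,J_3}}(\mathrm x_3),$$ where $\widetilde K$ is the operator kernel dual to $K$, with characteristic numbers $\widetilde c_n=1/c_n$, so that the associated reproducing kernel is $$\mathcal R^W_{\boldsymbol p}(\mathrm x_1,\mathrm x_2)=\sum_{n=0}^p\sum_{\boldsymbol\nu,J}\overline{X^n_{\boldsymbol\nu,J}}(\mathrm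 x_1)\,X^n_{\boldsymbol\nu,J}(\mathrm x_2)=\mathcal R^W_{\boldsymbol p}(\mathrm x_2,\mathrm x_1).$$
   Context: Representations. In a representation of $SU(3)$ (extended to $\mathfrak{sl}(3,\mathbb C)$) let $T_+,T_-,T_3,U_+,U_-,U_3$ be the images of $E_{12},E_{21},\tfrac12(E_{11}-E_{22}),E_{23},E_{32},\tfrac12(E_{22}-E_{33})$. For $\boldsymbol p=(p,q)\in\mathbb N_0^2$, "the irrep $\boldsymbol p$" is the unitary irrep on $\mathcal H_{\boldsymbol p}$ whose highest weight vector has eigenvalue $p/2$ for $T_3$ and $q/2$ for $U_3$; $\dim(\boldsymbol p)=\frac{(p+1)(q+1)(p+q+2)}2$, $|\boldsymbol p|=p+q$, $\check{\boldsymbol p}=(q,p)$ (the dual irrep). Inner products are linear in the second entry. Gelfand-Tsetlin (GT) basis: an orthonormal basis $\{\boldsymbol e(\boldsymbol p;\boldsymbol\nu,J)\}$ indexed by $\boldsymbol\nu=(\nu_1,\nu_2,\nu_3)$ and $J$ where, for integers $0\le r_-\le q\le r_+\le p+q$ and $r_-\le\nu_3\le r_+$: $\nu_1=p+2q-(r_++r_-)$, $\nu_2=r_++r_--\nu_3$, $J=\frac12(r_+-r_-)$. Put $t_{\boldsymbol\nu}=\frac{\nu_1-\nu_2}2$, $u_{\boldsymbol\nu}=\frac{\nu_2-\nu_3}2$ (the eigenvalues of $T_3,U_3$). The basis is determined by a unit highest weight vector $\boldsymbol e(\boldsymbol p;(p+q,q,0),q/2)$ via, with $u=u_{\boldsymbol\nu}$,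 $U_-\boldsymbol e(\boldsymbol p;\boldsymbol\nu,J)=\sqrt{(J+u)(J-u+1)}\,\boldsymbol e(\boldsymbol p;(\nu_1,\nu_2-1,\nu_3+1),J)$ and $T_-\boldsymbol e(\boldsymbol p;\boldsymbol\nu,J)=\sqrt{\tfrac{(J-u)(p+q+J-u-\nu_3+1)(q+J-u-\nu_3)(u-J+\nu_3+1)}{2J(2J+1)}}\,\boldsymbol e(\boldsymbol p;(\nu_1-1,\nu_2+1,\nu_3),J-\tfrac12)+\sqrt{\tfrac{(J+u+1)(p+q-J-u-\nu_3)(J+u+1+\nu_3-q)(J+u+2+\nu_3)}{2(J+1)(2J+1)}}\,\boldsymbol e(\boldsymbol p;(\nu_1-1,\nu_2+1,\nu_3),J+\tfrac12)$ (terms with zero numerator are $0$). For $\boldsymbol p=(p,0)$ or $(0,p)$, $J$ is determined by $\boldsymbol\nu$ and is omitted. For a GT label $\boldsymbol\nu$ of an irrep $\boldsymbol a$ put $\check{\boldsymbol\nu}=(|\boldsymbol a|,|\boldsymbol a|,|\boldsymbol a|)-\boldsymbol\nu$ (so $(2n,2n,2n)-\boldsymbol\nu$ for $\boldsymbol a=(n,n)$). The induced GT basis of $\mathcal H_{\check{\boldsymbol p}}=\mathcal H_{\boldsymbol p}^*$ is $\check{\boldsymbol e}(\check{\boldsymbol p};\check{\boldsymbol\nu},J)=(-1)^{2(t_{\boldsymbol\nu}+u_{\boldsymbol\nu})}\boldsymbol e^*(\boldsymbol p;\boldsymbol\nu,J)$. Wigner functions: $D^{\boldsymbol a}_{\boldsymbol\nu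 J,\boldsymbol\mu L}(g)=\langle\boldsymbol e(\boldsymbol a;\boldsymbol\nu,J)|\rho(g)\boldsymbol e(\boldsymbol a;\boldsymbol\mu,L)\rangle$. Coupled basis. For $\boldsymbol p=(p,0)$ or $(0,p)$, $\mathcal B(\mathcal H_{\boldsymbol p})\simeq\mathcal H_{\boldsymbol p}\otimes\mathcal H_{\boldsymbol p}^*=\bigoplus_{n=0}^p(n,n)$ under $A^g=\rho(g)A\rho(g)^{-1}$, with inner product $\operatorname{tr}(A^\dagger B)$; $\{\boldsymbol e(n;\boldsymbol\nu,J)\}$ is the union of GT bases of the summands $(n,n)$, with phases such that all Clebsch-Gordan coefficients $C^{\boldsymbol p,\check{\boldsymbol p},n}_{\boldsymbol\nu_1,\boldsymbol\nu_2,\boldsymbol\nu J}=\langle\boldsymbol e(n;\boldsymbol\nu,J)|\boldsymbol e(\boldsymbol p;\boldsymbol\nu_1)\otimes\check{\boldsymbol e}(\check{\boldsymbol p};\boldsymbol\nu_2)\rangle$ are real and $\boldsymbol e(0;(0,0,0),0)=\mathds 1/\sqrt{\dim\boldsymbol p}$. Wigner product symbol: $$\begin{bmatrix}n_1&n_2&n\\ \boldsymbol\nu_1,J_1&\boldsymbol\nu_2,J_2&\boldsymbol\nu,J\end{bmatrix}[\boldsymbol p]=\sum_{\boldsymbol\mu_1,\boldsymbol\mu_2,\boldsymbol\mu_3}(-1)^{|\boldsymbol p|+2(t_{\boldsymbol\nu}+t_{\boldsymbol\mu_2}+u_{\boldsymbol\nu}+u_{\boldsymbol\mu_2})}C^{\boldsymbol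 p,\check{\boldsymbol p},n_1}_{\boldsymbol\mu_1,\boldsymbol\mu_2,\boldsymbol\nu_1J_1}C^{\boldsymbol p,\check{\boldsymbol p},n_2}_{\check{\boldsymbol\mu}_2,\boldsymbol\mu_3,\boldsymbol\nu_2J_2}C^{\boldsymbol p,\check{\boldsymbol p},n}_{\boldsymbol\mu_1,\boldsymbol\mu_3,\check{\boldsymbol\nu}J},$$ the sum being over GT labels $\boldsymbol\mu_1$ of $\boldsymbol p$ and $\boldsymbol\mu_2,\boldsymbol\mu_3$ of $\check{\boldsymbol p}$. Symbol correspondences. $\mathbb CP^2\simeq SU(3)/H$, $H=\{\mathrm{diag}(\det(U)^{-1},U):U\in U(2)\}$ the isotropy group of $\mathrm x_0=[1:0:0]$, with the invariant integral of total mass $1$ and $\langle f_1|f_2\rangle=\int\overline{f_1}f_2\,d\mathrm x$. Harmonics: $X^n_{\boldsymbol\nu,J}(g\mathrm x_0)=(n+1)^{3/2}\,\overline{D^{(n,n)}_{\boldsymbol\nu J,(n,n,n)0}(g)}$. A symbol correspondence $W:\mathcal B(\mathcal H_{\boldsymbol p})\to C^\infty_{\mathbb C}(\mathbb CP^2)$ is an injective linear map with: (1) $W_{A^g}=(W_A)^g$, where $f^g(\mathrm x)=f(g^{-1}\mathrm x)$; (2) $W_{A^\dagger}=\overline{W_A}$; (3) $\int W_A\,d\mathrm x=\operatorname{tr}(A)/\dim(\boldsymbol p)$. Each has a unique operator kernel $K$, fixed by $H$, with $W_A(\mathrm x)=\operatorname{tr}(AK(\mathrm x))$, where $K(g\mathrm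 x_0)=K^g$; and $K=\sum_{n=0}^pc_n\sqrt{(n+1)^3/\dim(\boldsymbol p)}\,\boldsymbol e(n;(n,n,n),0)$ with $c_0=1$, $c_n\in\mathbb R^\times$, the characteristic numbers. The dual correspondence $\widetilde W$ of $W$ is the unique symbol correspondence with $\langle\widetilde W_{A_1}|W_{A_2}\rangle=\frac1{\dim\boldsymbol p}\operatorname{tr}(A_1^\dagger A_2)$ for all $A_1,A_2$, and $\widetilde K$ is its operator kernel. The twisted product induced by $W$ is the product on the image $\mathcal S$ of $W$ given by $W_{A_1}\star W_{A_2}=W_{A_1A_2}$. The integral trikernel is the function $\mathbb L^W_{\boldsymbol p}(\mathrm x_1,\mathrm x_2,\mathrm x)=(\dim\boldsymbol p)^2\operatorname{tr}(\widetilde K(\mathrm x_1)\widetilde K(\mathrm x_2)K(\mathrm x))$, for which $(f_1\star f_2)(\mathrm x)=\int f_1(\mathrm x_1)f_2(\mathrm x_2)\mathbb L^W_{\boldsymbol p}(\mathrm x_1,\mathrm x_2,\mathrm x)\,d\mathrm x_1d\mathrm x_2$ for $f_1,f_2\in\mathcal S$. The associated reproducing kernel for $\mathcal S$ is $\mathcal R^W_{\boldsymbol p}(\mathrm x_1,\mathrm x_2)=\int\mathbb L^W_{\boldsymbol p}(\mathrm x,\mathrm x_1,\mathrm x_2)\,d\mathrm x=\int\mathbb L^W_{\boldsymbol p}(\mathrm x_1,\mathrm x,\mathrm x_2)\,d\mathrm x$. *)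

theory Defs
  imports "HOL-Analysis.Analysis" "HOL-Probability.Probability_Measure"
begin

section \<open>Complex inner product spaces\<close>

text \<open>The inner product is linear in the second entry. For \<open>complex^'d\<close> the instances below give the
  standard Hermitian inner product, and for \<open>complex^'d^'d\<close> the product \<open>tr (A\<^sup>* B)\<close> (lemma
  \<open>cinner_matrix\<close>).\<close>

class complex_inner_space = real_normed_vector +
  fixes cscale :: "complex \<Rightarrow> 'a \<Rightarrow> 'a" (infixr "*\<^sub>C" 75)
    and cinner :: "'a \<Rightarrow> 'a \<Rightarrow> complex"
  assumes cscale_add_right: "a *\<^sub>C (x + y) = a *\<^sub>C x + a *\<^sub>C y"
    and cscale_add_left: "(a + b) *\<^sub>C x = a *\<^sub>C x + b *\<^sub>C x"
    and cscale_cscale: "a *\<^sub>C (b *\<^sub>C x) = (a * b) *\<^sub>C x"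
    and cscale_of_real: "complex_of_real r *\<^sub>C x = r *\<^sub>R x"
    and cinner_add_right: "cinner x (y + z) = cinner x y + cinner x z"
    and cinner_cscale_right: "cinner x (a *\<^sub>C y) = a * cinner x y"
    and cinner_commute: "cinner x y = cnj (cinner y x)"
    and cinner_self: "cinner x x = complex_of_real ((norm x)\<^sup>2)"

instantiation complex :: complex_inner_space
begin
definition cscale_complex_def: "a *\<^sub>C (x::complex) = a * x"
definition cinner_complex_def: "cinner (x::complex) y = cnj x * y"
instance
  by standard
    (simp_all add: cscale_complex_def cinner_complex_def algebra_simps scaleR_conv_of_real
      complex_norm_square[symmetric] del: of_real_power)
end

instantiation vec :: (complex_inner_space, finite) complex_inner_space
begin
definition cscale_vec_def: "a *\<^sub>C (x::'a^'b) = (\<chi> i. a *\<^sub>C (x $ i))"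
definition cinner_vec_def: "cinner (x::'a^'b) y = (\<Sum>i\<in>UNIV. cinner (x $ i) (y $ i))"
instance
proof
  fix x y z :: "'a^'b" and a b :: complex and r :: real
  show "a *\<^sub>C (x + y) = a *\<^sub>C x + a *\<^sub>C y"
    by (simp add: cscale_vec_def vec_eq_iff cscale_add_right)
  show "(a + b) *\<^sub>C x = a *\<^sub>C x + b *\<^sub>C x"
    by (simp add: cscale_vec_def vec_eq_iff cscale_add_left)
  show "a *\<^sub>C (b *\<^sub>C x) = (a * b) *\<^sub>C x"
    by (simp add: cscale_vec_def vec_eq_iff cscale_cscale)
  show "complex_of_real r *\<^sub>C x = r *\<^sub>R x"
    by (simp add: cscale_vec_def vec_eq_iff cscale_of_real)
  show "cinner x (y + z) = cinner x y + cinner x z"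
    by (simp add: cinner_vec_def cinner_add_right sum.distrib)
  show "cinner x (a *\<^sub>C y) = a * cinner x y"
    by (simp add: cinner_vec_def cscale_vec_def cinner_cscale_right sum_distrib_left)
  show "cinner x y = cnj (cinner y x)"
    unfolding cinner_vec_def cnj_sum by (intro sum.cong refl) (rule cinner_commute)
  show "cinner x x = complex_of_real ((norm x)\<^sup>2)"
    by (simp add: cinner_vec_def cinner_self norm_vec_def L2_set_def sum_nonneg)
qed
end

definition mat_adj :: "complex^'n^'m \<Rightarrow> complex^'m^'n" where
  "mat_adj A = (\<chi> i j. cnj (A $ j $ i))"

lemma cinner_matrix: "cinner A B = trace (mat_adj A ** B)" for A B :: "complex^'d^'d"
  unfolding cinner_vec_def cinner_complex_def trace_def mat_adj_def matrix_matrix_mult_def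
  by (subst sum.swap) simp

definition csubspace :: "'v::complex_inner_space set \<Rightarrow> bool" where
  "csubspace V \<longleftrightarrow> 0 \<in> V \<and> (\<forall>x\<in>V. \<forall>y\<in>V. x + y \<in> V) \<and> (\<forall>a. \<forall>x\<in>V. a *\<^sub>C x \<in> V)"

section \<open>Representations of SU(3)\<close>

definition SU3 :: "(complex^3^3) set" where
  "SU3 = {g. mat_adj g ** g = mat 1 \<and> det g = 1}"

text \<open>A representation space is a complex subspace of an ambient inner product space. The map \<open>R\<close>
  matters only on \<^const>\<open>SU3\<close>.\<close>

definition unitary_rep ::
    "'v::complex_inner_space set \<Rightarrow> (complex^3^3 \<Rightarrow> 'v \<Rightarrow> 'v) \<Rightarrow> bool" where
  "unitary_rep V R \<longleftrightarrow> csubspace V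
     \<and> (\<forall>g\<in>SU3. \<forall>x\<in>V. R g x \<in> V)
     \<and> (\<forall>g\<in>SU3. \<forall>x\<in>V. \<forall>y\<in>V. R g (x + y) = R g x + R g y)
     \<and> (\<forall>g\<in>SU3. \<forall>a. \<forall>x\<in>V. R g (a *\<^sub>C x) = a *\<^sub>C R g x)
     \<and> (\<forall>g\<in>SU3. \<forall>x\<in>V. \<forall>y\<in>V. cinner (R g x) (R g y) = cinner x y)
     \<and> (\<forall>x\<in>V. R (mat 1) x = x)
     \<and> (\<forall>g\<in>SU3. \<forall>h\<in>SU3. \<forall>x\<in>V. R (g ** h) x = R g (R h x))
     \<and> (\<forall>x\<in>V. continuous_on SU3 (\<lambda>g. R g x))"

definition irreducible_rep ::
    "'v::complex_inner_space set \<Rightarrow> (complex^3^3 \<Rightarrow> 'v \<Rightarrow> 'v) \<Rightarrow> bool" where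
  "irreducible_rep V R \<longleftrightarrow> V \<noteq> {0} \<and>
     (\<forall>S. csubspace S \<and> S \<subseteq> V \<and> (\<forall>g\<in>SU3. R g ` S \<subseteq> S) \<longrightarrow> S = {0} \<or> S = V)"

definition mat_exp :: "complex^3^3 \<Rightarrow> complex^3^3" where
  "mat_exp X = (\<Sum>k. (1 / fact k) *\<^sub>R (((\<lambda>B. X ** B) ^^ k) (mat 1)))"

definition su3_deriv ::
    "(complex^3^3 \<Rightarrow> 'v \<Rightarrow> 'v) \<Rightarrow> complex^3^3 \<Rightarrow> 'v::complex_inner_space \<Rightarrow> 'v" where
  "su3_deriv R X v = vector_derivative (\<lambda>t::real. R (mat_exp (t *\<^sub>R X)) v) (at 0)"

text \<open>The complex-linear extension to traceless matrices, via \<open>Z = X + \<i> Y\<close> with \<open>X\<close>, \<open>Y\<close>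
  anti-Hermitian.\<close>

definition sl3_deriv ::
    "(complex^3^3 \<Rightarrow> 'v \<Rightarrow> 'v) \<Rightarrow> complex^3^3 \<Rightarrow> 'v::complex_inner_space \<Rightarrow> 'v" where
  "sl3_deriv R Z v =
     su3_deriv R ((1/2) *\<^sub>C (Z - mat_adj Z)) v
     + \<i> *\<^sub>C su3_deriv R ((1 / (2 * \<i>)) *\<^sub>C (Z + mat_adj Z)) v"

definition mat_unit :: "3 \<Rightarrow> 3 \<Rightarrow> complex^3^3" where
  "mat_unit i j = (\<chi> k l. if k = i \<and> l = j then 1 else 0)"

definition T_plus where "T_plus R = sl3_deriv R (mat_unit 1 2)"
definition T_minus where "T_minus R = sl3_deriv R (mat_unit 2 1)"
definition T_three where "T_three R = sl3_deriv R ((1/2) *\<^sub>C (mat_unit 1 1 - mat_unit 2 2))"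
definition U_plus where "U_plus R = sl3_deriv R (mat_unit 2 3)"
definition U_minus where "U_minus R = sl3_deriv R (mat_unit 3 2)"
definition U_three where "U_three R = sl3_deriv R ((1/2) *\<^sub>C (mat_unit 2 2 - mat_unit 3 3))"

fun highest_weight_vector ::
    "nat \<times> nat \<Rightarrow> (complex^3^3 \<Rightarrow> 'v \<Rightarrow> 'v) \<Rightarrow> 'v::complex_inner_space \<Rightarrow> bool" where
  "highest_weight_vector (p, q) R v \<longleftrightarrow> v \<noteq> 0
     \<and> T_plus R v = 0 \<and> U_plus R v = 0
     \<and> T_three R v = (of_nat p / 2) *\<^sub>C v \<and> U_three R v = (of_nat q / 2) *\<^sub>C v"

definition irrep ::
    "nat \<times> nat \<Rightarrow> 'v::complex_inner_space set \<Rightarrow> (complex^3^3 \<Rightarrow> 'v \<Rightarrow> 'v) \<Rightarrow> bool" where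
  "irrep a V R \<longleftrightarrow> unitary_rep V R \<and> irreducible_rep V R \<and> (\<exists>v\<in>V. highest_weight_vector a R v)"

fun irrep_dim :: "nat \<times> nat \<Rightarrow> nat" where
  "irrep_dim (p, q) = (p + 1) * (q + 1) * (p + q + 2) div 2"

fun abs_label :: "nat \<times> nat \<Rightarrow> nat" where
  "abs_label (p, q) = p + q"

section \<open>Gelfand-Tsetlin bases\<close>

type_synonym weight = "int \<times> int \<times> int"
type_synonym gt_label = "weight \<times> real"  \<comment> \<open>pairs \<open>(\<nu>, J)\<close>\<close>

fun gt_labels :: "nat \<times> nat \<Rightarrow> gt_label set" where
  "gt_labels (p, q) =
     {((int p + 2 * int q - (rp + rm), rp + rm - n3, n3), real_of_int (rp - rm) / 2) | rm rp n3.
        0 \<le> rm \<and> rm \<le> int q \<and> int q \<le> rp \<and> rp \<le> int p + int q \<and> rm \<le> n3 \<and> n3 \<le> rp}"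

text \<open>Twice \<open>t\<^sub>\<nu>\<close> and twice \<open>u\<^sub>\<nu>\<close>, which are integers.\<close>

fun two_t :: "weight \<Rightarrow> int" where "two_t (n1, n2, n3) = n1 - n2"
fun two_u :: "weight \<Rightarrow> int" where "two_u (n1, n2, n3) = n2 - n3"

definition u_minus_coeff :: "weight \<Rightarrow> real \<Rightarrow> real" where
  "u_minus_coeff \<nu> J = (let u = real_of_int (two_u \<nu>) / 2 in sqrt ((J + u) * (J - u + 1)))"

text \<open>In the next two definitions a term with zero numerator has value 0 also when its denominator
  vanishes, since \<open>x / 0 = 0\<close>.\<close>

fun t_minus_coeff_down :: "nat \<times> nat \<Rightarrow> weight \<Rightarrow> real \<Rightarrow> real" where
  "t_minus_coeff_down (p, q) (n1, n2, n3) J =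
     (let u = real_of_int (two_u (n1, n2, n3)) / 2; \<nu>3 = real_of_int n3 in
      sqrt ((J - u) * (real p + real q + J - u - \<nu>3 + 1) * (real q + J - u - \<nu>3) * (u - J + \<nu>3 + 1)
            / (2 * J * (2 * J + 1))))"

fun t_minus_coeff_up :: "nat \<times> nat \<Rightarrow> weight \<Rightarrow> real \<Rightarrow> real" where
  "t_minus_coeff_up (p, q) (n1, n2, n3) J =
     (let u = real_of_int (two_u (n1, n2, n3)) / 2; \<nu>3 = real_of_int n3 in
      sqrt ((J + u + 1) * (real p + real q - J - u - \<nu>3) * (J + u + 1 + \<nu>3 - real q) * (J + u + 2 + \<nu>3)
            / (2 * (J + 1) * (2 * J + 1))))"

text \<open>Whenever a label on the right of the \<open>U\<^sub>-\<close> and \<open>T\<^sub>-\<close> equations is not in \<^const>\<open>gt_labels\<close>, its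
  coefficient is 0, so the values of \<open>e\<close> outside \<^const>\<open>gt_labels\<close> are irrelevant.\<close>

fun gt_basis ::
    "nat \<times> nat \<Rightarrow> 'v::complex_inner_space set \<Rightarrow> (complex^3^3 \<Rightarrow> 'v \<Rightarrow> 'v) \<Rightarrow> (gt_label \<Rightarrow> 'v) \<Rightarrow> bool"
  where
  "gt_basis (p, q) V R e \<longleftrightarrow>
     (\<forall>l\<in>gt_labels (p, q). e l \<in> V)
   \<and> (\<forall>l\<in>gt_labels (p, q). \<forall>l'\<in>gt_labels (p, q). cinner (e l) (e l') = (if l = l' then 1 else 0))
   \<and> (\<forall>v\<in>V. v = (\<Sum>l\<in>gt_labels (p, q). cinner (e l) v *\<^sub>C e l))
   \<and> highest_weight_vector (p, q) R (e ((int p + int q, int q, 0), real q / 2))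
   \<and> (\<forall>\<nu> J. (\<nu>, J) \<in> gt_labels (p, q) \<longrightarrow>
        T_three R (e (\<nu>, J)) = (of_int (two_t \<nu>) / 2) *\<^sub>C e (\<nu>, J)
      \<and> U_three R (e (\<nu>, J)) = (of_int (two_u \<nu>) / 2) *\<^sub>C e (\<nu>, J))
   \<and> (\<forall>n1 n2 n3 J. ((n1, n2, n3), J) \<in> gt_labels (p, q) \<longrightarrow>
        U_minus R (e ((n1, n2, n3), J)) =
          complex_of_real (u_minus_coeff (n1, n2, n3) J) *\<^sub>C e ((n1, n2 - 1, n3 + 1), J)
      \<and> T_minus R (e ((n1, n2, n3), J)) =
          complex_of_real (t_minus_coeff_down (p, q) (n1, n2, n3) J)
            *\<^sub>C e ((n1 - 1, n2 + 1, n3), J - 1/2)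
        + complex_of_real (t_minus_coeff_up (p, q) (n1, n2, n3) J)
            *\<^sub>C e ((n1 - 1, n2 + 1, n3), J + 1/2))"

text \<open>\<open>check_label a\<close> sends labels of \<open>a\<close> to labels of its dual, and, as \<open>|a|\<close> is the same for both,
  also back.\<close>

fun dual_label :: "nat \<times> nat \<Rightarrow> nat \<times> nat" where
  "dual_label (p, q) = (q, p)"

fun check_label :: "nat \<times> nat \<Rightarrow> gt_label \<Rightarrow> gt_label" where
  "check_label a ((n1, n2, n3), J) =
     (let m = int (abs_label a) in ((m - n1, m - n2, m - n3), J))"

text \<open>The induced basis of the dual space, as linear functionals, indexed by labels of the dual
  irrep.\<close>

definition dual_gt_basis ::
    "nat \<times> nat \<Rightarrow> (gt_label \<Rightarrow> 'v) \<Rightarrow> gt_label \<Rightarrow> 'v::complex_inner_space \<Rightarrow> complex" where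
  "dual_gt_basis a e l x =
     (let l' = check_label a l
      in (- 1) powi (two_t (fst l') + two_u (fst l')) * cinner (e l') x)"

definition wigner_D ::
    "(complex^3^3 \<Rightarrow> 'v \<Rightarrow> 'v) \<Rightarrow> (gt_label \<Rightarrow> 'v::complex_inner_space)
      \<Rightarrow> gt_label \<Rightarrow> gt_label \<Rightarrow> complex^3^3 \<Rightarrow> complex" where
  "wigner_D R e l l' g = cinner (e l) (R g (e l'))"

section \<open>Operators and the coupled basis\<close>

text \<open>The irrep space is \<open>complex^'d\<close> and its operators are the matrices \<open>complex^'d^'d\<close>.\<close>

definition vec_rep :: "(complex^3^3 \<Rightarrow> complex^'d^'d) \<Rightarrow> complex^3^3 \<Rightarrow> complex^'d \<Rightarrow> complex^'d" where
  "vec_rep \<rho> g v = \<rho> g *v v"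

definition op_rep ::
    "(complex^3^3 \<Rightarrow> complex^'d^'d) \<Rightarrow> complex^3^3 \<Rightarrow> complex^'d^'d \<Rightarrow> complex^'d^'d" where
  "op_rep \<rho> g A = \<rho> g ** A ** matrix_inv (\<rho> g)"

definition tensor_op :: "complex^'d \<Rightarrow> (complex^'d \<Rightarrow> complex) \<Rightarrow> complex^'d^'d" where
  "tensor_op v \<phi> = matrix (\<lambda>x. \<phi> x *\<^sub>C v)"

text \<open>\<open>clebsch_gordan a e E l\<^sub>1 l\<^sub>2 n l\<close> takes a label \<open>l\<^sub>1\<close> of \<open>a\<close>, a label \<open>l\<^sub>2\<close> of the dual of \<open>a\<close> and
  a label \<open>l\<close> of \<open>(n, n)\<close>.\<close>

definition clebsch_gordan ::
    "nat \<times> nat \<Rightarrow> (gt_label \<Rightarrow> complex^'d) \<Rightarrow> (nat \<Rightarrow> gt_label \<Rightarrow> complex^'d^'d)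
      \<Rightarrow> gt_label \<Rightarrow> gt_label \<Rightarrow> nat \<Rightarrow> gt_label \<Rightarrow> complex" where
  "clebsch_gordan a e E l1 l2 n l = cinner (E n l) (tensor_op (e l1) (dual_gt_basis a e l2))"

definition coupled_basis ::
    "nat \<times> nat \<Rightarrow> (complex^3^3 \<Rightarrow> complex^'d^'d) \<Rightarrow> (gt_label \<Rightarrow> complex^'d)
      \<Rightarrow> (nat \<Rightarrow> gt_label \<Rightarrow> complex^'d^'d) \<Rightarrow> bool" where
  "coupled_basis a \<rho> e E \<longleftrightarrow>
     (\<exists>V :: nat \<Rightarrow> (complex^'d^'d) set.
        (\<forall>n\<le>abs_label a. irrep (n, n) (V n) (op_rep \<rho>) \<and> gt_basis (n, n) (V n) (op_rep \<rho>) (E n))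
      \<and> (\<forall>m\<le>abs_label a. \<forall>n\<le>abs_label a. m \<noteq> n \<longrightarrow> (\<forall>A\<in>V m. \<forall>B\<in>V n. cinner A B = 0))
      \<and> (\<forall>A. \<exists>B. (\<forall>n\<le>abs_label a. B n \<in> V n) \<and> A = (\<Sum>n\<le>abs_label a. B n)))
   \<and> (\<forall>n\<le>abs_label a. \<forall>l1\<in>gt_labels a. \<forall>l2\<in>gt_labels (dual_label a). \<forall>l\<in>gt_labels (n, n).
        clebsch_gordan a e E l1 l2 n l \<in> \<real>)
   \<and> E 0 ((0, 0, 0), 0) = complex_of_real (1 / sqrt (real (irrep_dim a))) *\<^sub>C mat 1"

definition wigner_product_symbol ::
    "nat \<times> nat \<Rightarrow> (gt_label \<Rightarrow> complex^'d) \<Rightarrow> (nat \<Rightarrow> gt_label \<Rightarrow> complex^'d^'d)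
      \<Rightarrow> nat \<Rightarrow> gt_label \<Rightarrow> nat \<Rightarrow> gt_label \<Rightarrow> nat \<Rightarrow> gt_label \<Rightarrow> complex" where
  "wigner_product_symbol a e E n1 l1 n2 l2 n l =
     (\<Sum>m1\<in>gt_labels a. \<Sum>m2\<in>gt_labels (dual_label a). \<Sum>m3\<in>gt_labels (dual_label a).
        (- 1) powi (int (abs_label a) + (two_t (fst l) + two_t (fst m2) + two_u (fst l) + two_u (fst m2)))
        * clebsch_gordan a e E m1 m2 n1 l1
        * clebsch_gordan a e E (check_label (dual_label a) m2) m3 n2 l2
        * clebsch_gordan a e E m1 m3 n (check_label (n, n) l))"

section \<open>The complex projective plane\<close>

typedef cp2 = "{range (\<lambda>c::complex. c *\<^sub>C v) | v :: complex^3. v \<noteq> 0}"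
proof -
  have "(1 :: complex^3) \<noteq> 0" by (simp add: vec_eq_iff)
  then show ?thesis by blast
qed

definition proj_line :: "complex^3 \<Rightarrow> cp2" where
  "proj_line v = Abs_cp2 (range (\<lambda>c. c *\<^sub>C v))"

text \<open>The quotient topology from \<open>\<complex>\<^sup>3 - {0}\<close>.\<close>

instantiation cp2 :: topological_space
begin
definition open_cp2_def: "open (S :: cp2 set) \<longleftrightarrow> open {v. v \<noteq> 0 \<and> proj_line v \<in> S}"
instance
proof
  have "{v :: complex^3. v \<noteq> 0 \<and> proj_line v \<in> UNIV} = - {0}" by auto
  then show "open (UNIV :: cp2 set)" by (simp add: open_cp2_def open_Compl)
next
  fix S T :: "cp2 set" assume "open S" "open T"
  then have "open ({v. v \<noteq> 0 \<and> proj_line v \<in> S} \<inter> {v. v \<noteq> 0 \<and> proj_line v \<in> T})"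
    unfolding open_cp2_def by (rule open_Int)
  also have "{v. v \<noteq> 0 \<and> proj_line v \<in> S} \<inter> {v. v \<noteq> 0 \<and> proj_line v \<in> T}
      = {v. v \<noteq> 0 \<and> proj_line v \<in> S \<inter> T}" by blast
  finally show "open (S \<inter> T)" unfolding open_cp2_def .
next
  fix K :: "cp2 set set" assume "\<forall>S\<in>K. open S"
  then have "open (\<Union>S\<in>K. {v. v \<noteq> 0 \<and> proj_line v \<in> S})"
    unfolding open_cp2_def by (rule open_UN)
  also have "(\<Union>S\<in>K. {v. v \<noteq> 0 \<and> proj_line v \<in> S}) = {v. v \<noteq> 0 \<and> proj_line v \<in> \<Union>K}" by blast
  finally show "open (\<Union>K)" unfolding open_cp2_def .
qed
end

definition cp2_act :: "complex^3^3 \<Rightarrow> cp2 \<Rightarrow> cp2" where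
  "cp2_act g x = Abs_cp2 ((\<lambda>v. g *v v) ` Rep_cp2 x)"

definition cp2_base :: cp2 where
  "cp2_base = proj_line (axis 1 1)"

definition isotropy :: "(complex^3^3) set" where
  "isotropy = {h \<in> SU3. cp2_act h cp2_base = cp2_base}"

definition coset_rep :: "cp2 \<Rightarrow> complex^3^3" where
  "coset_rep x = (SOME g. g \<in> SU3 \<and> cp2_act g cp2_base = x)"

definition invariant_prob :: "cp2 measure \<Rightarrow> bool" where
  "invariant_prob M \<longleftrightarrow> sets M = sets borel \<and> prob_space M \<and> (\<forall>g\<in>SU3. distr M M (cp2_act g) = M)"

primrec C_times :: "nat \<Rightarrow> ('a::real_normed_vector \<Rightarrow> 'b::real_normed_vector) \<Rightarrow> bool" where
  "C_times 0 f \<longleftrightarrow> continuous_on UNIV f"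
| "C_times (Suc k) f \<longleftrightarrow>
     (\<forall>x. f differentiable (at x)) \<and> (\<forall>h. C_times k (\<lambda>x. frechet_derivative f (at x) h))"

text \<open>Smoothness in the real sense, in the three standard affine charts, each of which is all of
  \<open>\<complex>\<^sup>2\<close>.\<close>

definition cp2_smooth :: "(cp2 \<Rightarrow> complex) \<Rightarrow> bool" where
  "cp2_smooth f \<longleftrightarrow>
     (\<forall>k. C_times k (\<lambda>(z::complex, w::complex). f (proj_line (vector [1, z, w])))
        \<and> C_times k (\<lambda>(z::complex, w::complex). f (proj_line (vector [z, 1, w])))
        \<and> C_times k (\<lambda>(z::complex, w::complex). f (proj_line (vector [z, w, 1]))))"

text \<open>The Wigner function is taken in the copy of \<open>(n, n)\<close> spanned by \<open>E n\<close>; it does not depend on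
  the copy. The choice in \<^const>\<open>coset_rep\<close> is immaterial because \<open>E n ((n, n, n), 0)\<close> is fixed by
  \<^const>\<open>isotropy\<close>.\<close>

definition harmonic ::
    "(complex^3^3 \<Rightarrow> complex^'d^'d) \<Rightarrow> (nat \<Rightarrow> gt_label \<Rightarrow> complex^'d^'d)
      \<Rightarrow> nat \<Rightarrow> gt_label \<Rightarrow> cp2 \<Rightarrow> complex" where
  "harmonic \<rho> E n l x =
     complex_of_real (real (n + 1) powr (3/2))
     * cnj (wigner_D (op_rep \<rho>) (E n) l ((int n, int n, int n), 0) (coset_rep x))"

section \<open>Symbol correspondences\<close>

definition symbol_correspondence ::
    "nat \<times> nat \<Rightarrow> (complex^3^3 \<Rightarrow> complex^'d^'d) \<Rightarrow> cp2 measure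
      \<Rightarrow> (complex^'d^'d \<Rightarrow> cp2 \<Rightarrow> complex) \<Rightarrow> bool" where
  "symbol_correspondence a \<rho> M W \<longleftrightarrow>
     (\<forall>A. cp2_smooth (W A))
   \<and> (\<forall>A B x. W (A + B) x = W A x + W B x)
   \<and> (\<forall>c A x. W (c *\<^sub>C A) x = c * W A x)
   \<and> inj W
   \<and> (\<forall>g\<in>SU3. \<forall>A x. W (op_rep \<rho> g A) x = W A (cp2_act (matrix_inv g) x))
   \<and> (\<forall>A x. W (mat_adj A) x = cnj (W A x))
   \<and> (\<forall>A. (LINT x|M. W A x) = trace A / of_nat (irrep_dim a))"

definition kernel_at :: "(complex^3^3 \<Rightarrow> complex^'d^'d) \<Rightarrow> complex^'d^'d \<Rightarrow> cp2 \<Rightarrow> complex^'d^'d" where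
  "kernel_at \<rho> K x = op_rep \<rho> (coset_rep x) K"

definition is_operator_kernel ::
    "(complex^3^3 \<Rightarrow> complex^'d^'d) \<Rightarrow> (complex^'d^'d \<Rightarrow> cp2 \<Rightarrow> complex) \<Rightarrow> complex^'d^'d \<Rightarrow> bool" where
  "is_operator_kernel \<rho> W K \<longleftrightarrow>
     (\<forall>h\<in>isotropy. op_rep \<rho> h K = K) \<and> (\<forall>A x. W A x = trace (A ** kernel_at \<rho> K x))"

definition operator_kernel ::
    "(complex^3^3 \<Rightarrow> complex^'d^'d) \<Rightarrow> (complex^'d^'d \<Rightarrow> cp2 \<Rightarrow> complex) \<Rightarrow> complex^'d^'d" where
  "operator_kernel \<rho> W = (THE K. is_operator_kernel \<rho> W K)"

definition characteristic_numbers ::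
    "nat \<times> nat \<Rightarrow> (nat \<Rightarrow> gt_label \<Rightarrow> complex^'d^'d) \<Rightarrow> complex^'d^'d \<Rightarrow> (nat \<Rightarrow> real) \<Rightarrow> bool" where
  "characteristic_numbers a E K c \<longleftrightarrow>
     c 0 = 1 \<and> (\<forall>n\<le>abs_label a. c n \<noteq> 0)
   \<and> K = (\<Sum>n\<le>abs_label a.
            complex_of_real (c n * sqrt ((real n + 1) ^ 3 / real (irrep_dim a)))
              *\<^sub>C E n ((int n, int n, int n), 0))"

definition is_dual_correspondence ::
    "nat \<times> nat \<Rightarrow> (complex^3^3 \<Rightarrow> complex^'d^'d) \<Rightarrow> cp2 measure
      \<Rightarrow> (complex^'d^'d \<Rightarrow> cp2 \<Rightarrow> complex) \<Rightarrow> (complex^'d^'d \<Rightarrow> cp2 \<Rightarrow> complex) \<Rightarrow> bool" where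
  "is_dual_correspondence a \<rho> M W W' \<longleftrightarrow>
     symbol_correspondence a \<rho> M W'
   \<and> (\<forall>A1 A2. (LINT x|M. cnj (W' A1 x) * W A2 x)
        = 1 / of_nat (irrep_dim a) * trace (mat_adj A1 ** A2))"

definition dual_correspondence ::
    "nat \<times> nat \<Rightarrow> (complex^3^3 \<Rightarrow> complex^'d^'d) \<Rightarrow> cp2 measure
      \<Rightarrow> (complex^'d^'d \<Rightarrow> cp2 \<Rightarrow> complex) \<Rightarrow> complex^'d^'d \<Rightarrow> cp2 \<Rightarrow> complex" where
  "dual_correspondence a \<rho> M W = (THE W'. is_dual_correspondence a \<rho> M W W')"

definition dual_kernel ::
    "nat \<times> nat \<Rightarrow> (complex^3^3 \<Rightarrow> complex^'d^'d) \<Rightarrow> cp2 measure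
      \<Rightarrow> (complex^'d^'d \<Rightarrow> cp2 \<Rightarrow> complex) \<Rightarrow> complex^'d^'d" where
  "dual_kernel a \<rho> M W = operator_kernel \<rho> (dual_correspondence a \<rho> M W)"

definition integral_trikernel ::
    "nat \<times> nat \<Rightarrow> (complex^3^3 \<Rightarrow> complex^'d^'d) \<Rightarrow> cp2 measure
      \<Rightarrow> (complex^'d^'d \<Rightarrow> cp2 \<Rightarrow> complex) \<Rightarrow> cp2 \<Rightarrow> cp2 \<Rightarrow> cp2 \<Rightarrow> complex" where
  "integral_trikernel a \<rho> M W x1 x2 x3 =
     (of_nat (irrep_dim a))\<^sup>2
     * trace (kernel_at \<rho> (dual_kernel a \<rho> M W) x1 ** kernel_at \<rho> (dual_kernel a \<rho> M W) x2
              ** kernel_at \<rho> (operator_kernel \<rho> W) x3)"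

text \<open>Integrating out the second argument of the trikernel instead of the first gives the same
  function.\<close>

definition reproducing_kernel ::
    "nat \<times> nat \<Rightarrow> (complex^3^3 \<Rightarrow> complex^'d^'d) \<Rightarrow> cp2 measure
      \<Rightarrow> (complex^'d^'d \<Rightarrow> cp2 \<Rightarrow> complex) \<Rightarrow> cp2 \<Rightarrow> cp2 \<Rightarrow> complex" where
  "reproducing_kernel a \<rho> M W x1 x2 = (LINT x|M. integral_trikernel a \<rho> M W x x1 x2)"

end

theory Submission
  imports Defs
begin

text \<open>The operator \<open>T = \<Sum>\<^sub>n c\<^sub>n\<^sup>-\<^sup>2 P\<^sub>n\<close>, with \<open>P\<^sub>n\<close> the orthogonal projection onto the summand \<open>(n, n)\<close>, commutes
  with the action, so \<open>A \<mapsto> W (T A)\<close> is again a symbol correspondence, with kernel \<open>T K\<close>. Schur's lemma for the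
  invariant form \<open>\<integral> cnj (W (T A)) W B\<close> shows that it is dual to \<open>W\<close>; the constant on each summand is read off by
  summing the form over an orthonormal basis. A vector of \<open>(n, n)\<close> fixed by the isotropy group is killed by
  \<open>U\<^sub>+\<close> and \<open>U\<^sub>-\<close>, hence a multiple of \<open>e(n; (n,n,n), 0)\<close>, and the same sums then determine the kernel of any
  dual correspondence. Expanding the kernels in the coupled basis writes them through harmonics and reduces the
  trikernel to \<open>tr (E\<^sub>1 E\<^sub>2 E\<^sub>3)\<close>. This trace is a Wigner product symbol because
  \<open>e(n; \<nu>, J)\<^sup>*\<close> is \<open>(-1)\<^bsup>2(t+u)\<^esup>\<close> times the basis vector with the dual label: both families satisfy the same
  lowering relations, so they agree up to one phase, which is 1 as \<open>K\<close> is Hermitian. The phase and the multiplicity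
  arguments only use the weight operator \<open>T\<^sub>3 + U\<^sub>3\<close>, whose largest eigenvalue on \<open>(n, n)\<close> is simple and equal to
  \<open>n\<close>.\<close>

section \<open>Inner products and matrices\<close>

text \<open>The representation is only assumed continuous, while the Gelfand-Tsetlin relations speak
  of derivatives; differentiability along one-parameter subgroups therefore comes before any weight.
  Once the generators are matrices, the derived action on operators is by commutators, and matrix
  adjoints supply the raising operators. The invariant integral is not evaluated function by
  function. Summed over an orthonormal basis of one summand, a product of two symbols is constant in
  x, so total mass 1 gives the integral. This is where \<open>(n + 1) ^ 3\<close>, the dimension of
  \<open>(n, n)\<close>, meets the same factor in the normalisation of the kernel. Kernels and dual
  correspondences are definite descriptions, so uniqueness has to hold among all symbol
  correspondences, whatever the shape of their kernels. In the Wigner product symbol the third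
  Clebsch-Gordan coefficient has its indices in the wrong order for a trace. Transposing it is what
  requires the adjoints of the coupled basis; reality of the coefficients removes the conjugations,
  and of all signs only \<open>(- 1) ^ p\<close> survives.\<close>

lemma cscale_zero_left [simp]: "0 *\<^sub>C x = 0" for x :: "'v::complex_inner_space"
  using cscale_of_real[of 0 x] by simp

lemma cscale_one [simp]: "1 *\<^sub>C x = x" for x :: "'v::complex_inner_space"
  using cscale_of_real[of 1 x] by simp

lemma cscale_zero_right [simp]: "a *\<^sub>C (0 :: 'v::complex_inner_space) = 0"
  using cscale_add_right[of a "0 :: 'v" 0] by simp

lemma cscale_minus_left: "(- a) *\<^sub>C x = - (a *\<^sub>C x)" for x :: "'v::complex_inner_space"
  using cscale_add_left[of a "- a" x] by (simp add: eq_neg_iff_add_eq_0 add.commute)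

lemma cscale_minus_right: "a *\<^sub>C (- x) = - (a *\<^sub>C x)" for x :: "'v::complex_inner_space"
  using cscale_add_right[of a x "- x"] by (simp add: eq_neg_iff_add_eq_0 add.commute)

lemma cscale_diff_right: "a *\<^sub>C (x - y) = a *\<^sub>C x - a *\<^sub>C y" for x :: "'v::complex_inner_space"
  using cscale_add_right[of a x "- y"] by (simp add: cscale_minus_right)

lemma cscale_sum_right: "a *\<^sub>C (\<Sum>i\<in>I. f i) = (\<Sum>i\<in>I. a *\<^sub>C f i)"
  for f :: "'i \<Rightarrow> 'v::complex_inner_space"
  by (induction I rule: infinite_finite_induct) (auto simp: cscale_add_right)

lemma cscale_eq_0_iff: "a *\<^sub>C x = 0 \<longleftrightarrow> a = 0 \<or> x = 0" for x :: "'v::complex_inner_space"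
proof
  assume *: "a *\<^sub>C x = 0"
  { assume "a \<noteq> 0"
    then have "x = (inverse a) *\<^sub>C (a *\<^sub>C x)" by (simp add: cscale_cscale)
    then have "x = 0" using * by simp }
  then show "a = 0 \<or> x = 0" by blast
qed auto

lemma cinner_zero_right [simp]: "cinner x 0 = 0"
  using cinner_add_right[of x 0 0] by simp

lemma cinner_zero_left [simp]: "cinner 0 x = 0"
  using cinner_commute[of 0 x] by simp

lemma cinner_add_left: "cinner (x + y) z = cinner x z + cinner y z"
  using cinner_commute[of "x + y" z] cinner_commute[of x z] cinner_commute[of y z]
  by (simp add: cinner_add_right)

lemma cinner_cscale_left: "cinner (a *\<^sub>C x) y = cnj a * cinner x y"
  using cinner_commute[of "a *\<^sub>C x" y] cinner_commute[of x y] by (simp add: cinner_cscale_right)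

lemma cinner_minus_right: "cinner x (- y) = - cinner x y"
  using cinner_add_right[of x y "- y"] by (simp add: eq_neg_iff_add_eq_0 add.commute)

lemma cinner_minus_left: "cinner (- x) y = - cinner x y"
  using cinner_add_left[of x "- x" y] by (simp add: eq_neg_iff_add_eq_0 add.commute)

lemma cinner_diff_right: "cinner x (y - z) = cinner x y - cinner x z"
  using cinner_add_right[of x y "- z"] by (simp add: cinner_minus_right)

lemma cinner_diff_left: "cinner (x - y) z = cinner x z - cinner y z"
  using cinner_add_left[of x "- y" z] by (simp add: cinner_minus_left)

lemma cinner_sum_right: "cinner x (\<Sum>i\<in>I. f i) = (\<Sum>i\<in>I. cinner x (f i))"
  by (induction I rule: infinite_finite_induct) (auto simp: cinner_add_right)

lemma cinner_sum_left: "cinner (\<Sum>i\<in>I. f i) x = (\<Sum>i\<in>I. cinner (f i) x)"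
  by (induction I rule: infinite_finite_induct) (auto simp: cinner_add_left)

lemma cinner_eq_0_iff: "cinner x x = 0 \<longleftrightarrow> x = 0"
  by (simp add: cinner_self)

lemma cinner_ext: "x = y" if "\<And>z. cinner z x = cinner z y"
proof -
  have "cinner (x - y) (x - y) = 0" using that[of "x - y"] by (simp add: cinner_diff_right)
  then show ?thesis by (simp add: cinner_eq_0_iff)
qed

lemma mat_adj_nth [simp]: "mat_adj A $ i $ j = cnj (A $ j $ i)"
  by (simp add: mat_adj_def)

lemma cscale_mat_nth [simp]: "(a *\<^sub>C A) $ i $ j = a * A $ i $ j"
  for A :: "complex^'n^'m"
  by (simp add: cscale_vec_def cscale_complex_def)

lemma cscale_vec_nth [simp]: "(a *\<^sub>C v) $ i = a * v $ i" for v :: "complex^'n"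
  by (simp add: cscale_vec_def cscale_complex_def)

lemma mat_adj_adj [simp]: "mat_adj (mat_adj A) = A"
  by (simp add: vec_eq_iff)

lemma mat_adj_add: "mat_adj (A + B) = mat_adj A + mat_adj B"
  by (simp add: vec_eq_iff)

lemma mat_adj_diff: "mat_adj (A - B) = mat_adj A - mat_adj B"
  by (simp add: vec_eq_iff)

lemma mat_adj_zero [simp]: "mat_adj 0 = 0"
  by (simp add: vec_eq_iff)

lemma mat_adj_cscale: "mat_adj (a *\<^sub>C A) = cnj a *\<^sub>C mat_adj A"
  by (simp add: vec_eq_iff)

lemma mat_adj_sum: "mat_adj (\<Sum>i\<in>I. f i) = (\<Sum>i\<in>I. mat_adj (f i))"
  by (induction I rule: infinite_finite_induct) (auto simp: mat_adj_add)

lemma mat_adj_mat_1 [simp]: "mat_adj (mat 1) = mat 1"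
  by (auto simp: vec_eq_iff mat_def)

lemma mat_adj_mult: "mat_adj (A ** B) = mat_adj B ** mat_adj A"
  for A :: "complex^'n^'m" and B :: "complex^'k^'n"
  by (simp add: vec_eq_iff matrix_matrix_mult_def mult.commute)

lemma matrix_mult_cscale_left: "(a *\<^sub>C A) ** B = a *\<^sub>C (A ** B)"
  for A :: "complex^'n^'m" and B :: "complex^'k^'n"
  by (simp add: vec_eq_iff matrix_matrix_mult_def sum_distrib_left mult.assoc)

lemma matrix_mult_cscale_right: "A ** (a *\<^sub>C B) = a *\<^sub>C (A ** B)"
  for A :: "complex^'n^'m" and B :: "complex^'k^'n"
  by (simp add: vec_eq_iff matrix_matrix_mult_def sum_distrib_left algebra_simps)

lemma matrix_mult_minus_left: "(- A) ** B = - (A ** B)"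
  for A :: "complex^'n^'m" and B :: "complex^'k^'n"
  by (simp add: vec_eq_iff matrix_matrix_mult_def sum_negf)

lemma matrix_mult_minus_right: "A ** (- B) = - (A ** B)"
  for A :: "complex^'n^'m" and B :: "complex^'k^'n"
  by (simp add: vec_eq_iff matrix_matrix_mult_def sum_negf)

lemma matrix_mult_add_left: "(A + B) ** C = A ** C + B ** C"
  for A :: "complex^'n^'m" and C :: "complex^'k^'n"
  by (simp add: vec_eq_iff matrix_matrix_mult_def sum.distrib algebra_simps)

lemma matrix_mult_diff_left: "(A - B) ** C = A ** C - B ** C"
  for A :: "complex^'n^'m" and C :: "complex^'k^'n"
  by (simp add: vec_eq_iff matrix_matrix_mult_def sum_subtractf algebra_simps)

lemma matrix_mult_diff_right: "A ** (B - C) = A ** B - A ** C"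
  for A :: "complex^'n^'m" and B :: "complex^'k^'n"
  by (simp add: vec_eq_iff matrix_matrix_mult_def sum_subtractf algebra_simps)

lemma matrix_mult_sum_left: "(\<Sum>i\<in>I. f i) ** B = (\<Sum>i\<in>I. f i ** B)"
  for f :: "'i \<Rightarrow> complex^'n^'m" and B :: "complex^'k^'n"
  by (induction I rule: infinite_finite_induct) (auto simp: matrix_mult_add_left)

lemma matrix_mult_sum_right: "B ** (\<Sum>i\<in>I. f i) = (\<Sum>i\<in>I. B ** f i)"
  for f :: "'i \<Rightarrow> complex^'n^'m" and B :: "complex^'m^'k"
  by (induction I rule: infinite_finite_induct) (auto simp: matrix_add_ldistrib)

lemma trace_cscale: "trace (a *\<^sub>C A) = a * trace A" for A :: "complex^'n^'n"
  by (simp add: trace_def sum_distrib_left)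

lemma trace_sum: "trace (\<Sum>i\<in>I. f i) = (\<Sum>i\<in>I. trace (f i))"
  for f :: "'i \<Rightarrow> complex^'n^'n"
  unfolding trace_def sum_component by (rule sum.swap)

lemma trace_mat_adj: "trace (mat_adj A) = cnj (trace A)"
  by (simp add: trace_def)

lemma cinner_mat_adj: "cinner (mat_adj A) (mat_adj B) = cinner B A" for A :: "complex^'d^'d"
  unfolding cinner_matrix mat_adj_adj by (rule trace_mul_sym)

lemma trace_mult_ext: "B = C" if "\<And>A. trace (A ** B) = trace (A ** C)"
  for B C :: "complex^'d^'d"
proof (rule cinner_ext)
  fix A show "cinner A B = cinner A C" using that[of "mat_adj A"] by (simp add: cinner_matrix)
qed

lemma bounded_linear_mat_adj: "bounded_linear (mat_adj :: complex^'n^'m \<Rightarrow> _)"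
  by (rule linear_conv_bounded_linear[THEN iffD1]) (auto intro!: linearI simp: vec_eq_iff)

lemma bounded_bilinear_matrix_mult:
  "bounded_bilinear ((**) :: complex^'n^'m \<Rightarrow> complex^'k^'n \<Rightarrow> complex^'k^'m)"
  by (rule bilinear_conv_bounded_bilinear[THEN iffD1])
     (auto intro!: linearI simp: bilinear_def matrix_add_ldistrib matrix_mult_add_left
       vec_eq_iff matrix_matrix_mult_def scaleR_sum_right algebra_simps sum.distrib)

lemmas has_vector_derivative_matrix_mult =
  bounded_bilinear.has_vector_derivative[OF bounded_bilinear_matrix_mult]

lemma inverse_unique_matrix:
  fixes A B :: "complex^'d^'d"
  assumes "A ** B = mat 1" shows "matrix_inv A = B" and "B ** A = mat 1"
proof -
  show BA: "B ** A = mat 1" using assms by (simp add: matrix_left_right_inverse)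
  have "A ** matrix_inv A = mat 1"
    unfolding matrix_inv_def using someI_ex[of "\<lambda>C. A ** C = mat 1 \<and> C ** A = mat 1"] assms BA by blast
  then have "B ** (A ** matrix_inv A) = B" by simp
  then show "matrix_inv A = B" using BA by (simp add: matrix_mul_assoc)
qed

lemma csubspaceD:
  assumes "csubspace S"
  shows "0 \<in> S" and "\<And>x y. x \<in> S \<Longrightarrow> y \<in> S \<Longrightarrow> x + y \<in> S"
    and "\<And>a x. x \<in> S \<Longrightarrow> a *\<^sub>C x \<in> S"
    and "\<And>f I. (\<And>i. i \<in> I \<Longrightarrow> f i \<in> S) \<Longrightarrow> (\<Sum>i\<in>I. f i) \<in> S"
proof -
  show z: "0 \<in> S" and a: "\<And>x y. x \<in> S \<Longrightarrow> y \<in> S \<Longrightarrow> x + y \<in> S"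
    and "\<And>a x. x \<in> S \<Longrightarrow> a *\<^sub>C x \<in> S"
    using assms by (auto simp: csubspace_def)
  show "(\<Sum>i\<in>I. f i) \<in> S" if "\<And>i. i \<in> I \<Longrightarrow> f i \<in> S" for f :: "'b \<Rightarrow> 'a" and I
    using that by (induction I rule: infinite_finite_induct) (auto intro: z a)
qed

section \<open>The projective plane as a homogeneous space\<close>

lemma SU3_D:
  assumes "g \<in> SU3"
  shows "mat_adj g ** g = mat 1" "g ** mat_adj g = mat 1" "matrix_inv g = mat_adj g" "det g = 1"
proof -
  show 1: "mat_adj g ** g = mat 1" "det g = 1" using assms by (auto simp: SU3_def)
  then show 2: "g ** mat_adj g = mat 1" using inverse_unique_matrix by blast
  then show "matrix_inv g = mat_adj g" using inverse_unique_matrix by blast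
qed

lemma det_mat_adj: "det (mat_adj A) = cnj (det A)" for A :: "complex^3^3"
  by (simp add: det_3)

lemma SU3_mat_adj: "mat_adj g \<in> SU3" if "g \<in> SU3"
  using SU3_D[OF that] that by (simp add: SU3_def det_mat_adj)

lemma Rep_proj_line: "v \<noteq> 0 \<Longrightarrow> Rep_cp2 (proj_line v) = range (\<lambda>c. c *\<^sub>C v)"
  unfolding proj_line_def by (rule Abs_cp2_inverse) auto

lemma proj_line_cases: obtains v where "v \<noteq> 0" "x = proj_line v"
proof -
  obtain v where "v \<noteq> 0" "Rep_cp2 x = range (\<lambda>c. c *\<^sub>C v)" using Rep_cp2[of x] by auto
  then show ?thesis using that unfolding proj_line_def by (metis Rep_cp2_inverse)
qed

lemma proj_line_cscale: "a \<noteq> 0 \<Longrightarrow> proj_line (a *\<^sub>C v) = proj_line v"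
proof -
  assume a: "a \<noteq> 0"
  have "range (\<lambda>c. c *\<^sub>C (a *\<^sub>C v)) = range (\<lambda>c. c *\<^sub>C v)"
  proof (intro equalityI subsetI)
    fix w assume "w \<in> range (\<lambda>c. c *\<^sub>C v)"
    then obtain c where "w = c *\<^sub>C v" by auto
    then have "w = (c / a) *\<^sub>C (a *\<^sub>C v)" using a by (simp add: cscale_cscale)
    then show "w \<in> range (\<lambda>c. c *\<^sub>C (a *\<^sub>C v))" by blast
  qed (auto simp: cscale_cscale)
  then show ?thesis by (simp add: proj_line_def)
qed

lemma matrix_vector_mult_cscale: "A *v (c *\<^sub>C v) = c *\<^sub>C (A *v v)" for A :: "complex^'n^'m"
  by (simp add: vec_eq_iff matrix_vector_mult_def sum_distrib_left algebra_simps)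

lemma cp2_act_proj_line: "v \<noteq> 0 \<Longrightarrow> cp2_act g (proj_line v) = proj_line (g *v v)"
  unfolding cp2_act_def
  by (simp add: Rep_proj_line image_image matrix_vector_mult_cscale proj_line_def[of "g *v v"])

lemma SU3_vec_nonzero: "g *v v \<noteq> 0" if "g \<in> SU3" "v \<noteq> 0"
proof
  assume "g *v v = 0"
  then have "mat_adj g *v (g *v v) = 0" by simp
  then show False using that SU3_D(1)[OF that(1)] by (simp add: matrix_vector_mul_assoc)
qed

lemma continuous_on_cp2_act:
  assumes "g \<in> SU3" shows "continuous_on UNIV (cp2_act g)"
proof -
  have "open (cp2_act g -` S)" if "open S" for S
  proof -
    \<comment> \<open>Since \<open>g\<close> has trivial kernel, the condition
      \<open>v \<noteq> 0\<close> can be moved to \<open>g *v v\<close>, which leaves a plain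
      preimage.\<close>
    have "{v. v \<noteq> 0 \<and> proj_line v \<in> cp2_act g -` S} = {v. g *v v \<in> {v. v \<noteq> 0 \<and> proj_line v \<in> S}}"
    proof (rule Collect_cong)
      fix v show "v \<noteq> 0 \<and> proj_line v \<in> cp2_act g -` S
          \<longleftrightarrow> g *v v \<in> {v. v \<noteq> 0 \<and> proj_line v \<in> S}"
        using SU3_vec_nonzero[OF assms, of v] by (cases "v = 0") (simp_all add: cp2_act_proj_line)
    qed
    also have "\<dots> = (\<lambda>v. g *v v) -` {v. v \<noteq> 0 \<and> proj_line v \<in> S}" by auto
    also have "open \<dots>"
    proof (rule open_vimage)
      show "open {v. v \<noteq> 0 \<and> proj_line v \<in> S}" using that by (simp add: open_cp2_def)
      have "linear (\<lambda>v. g *v v)"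
        by (auto intro!: linearI simp: vec_eq_iff matrix_vector_mult_def algebra_simps
            sum.distrib scaleR_sum_right)
      then show "continuous_on UNIV (\<lambda>v. g *v v)"
        by (simp add: linear_conv_bounded_linear linear_continuous_on)
    qed
    finally show ?thesis by (simp add: open_cp2_def)
  qed
  then show ?thesis by (simp add: continuous_on_open_vimage)
qed

lemma measurable_cp2_act:
  assumes "sets M = sets borel" "g \<in> SU3" shows "cp2_act g \<in> measurable M M"
proof -
  have "cp2_act g \<in> measurable borel borel"
    by (rule borel_measurable_continuous_onI[OF continuous_on_cp2_act[OF assms(2)]])
  then show ?thesis using assms(1) by (simp cong: measurable_cong_sets)
qed

text \<open>The third column is the conjugated cross product of the first two.\<close>

lemma SU3_columns:
  fixes v w :: "complex^3"
  assumes v: "cinner v v = 1" and w: "cinner w w = 1" and vw: "cinner v w = 0"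
  shows "\<exists>g\<in>SU3. g *v axis 1 1 = v"
proof -
  define u :: "complex^3" where "u = vector [cnj (v$2 * w$3 - v$3 * w$2),
     cnj (v$3 * w$1 - v$1 * w$3), cnj (v$1 * w$2 - v$2 * w$1)]"
  define g :: "complex^3^3" where "g = (\<chi> i j. if j = 1 then v$i else if j = 2 then w$i else u$i)"
  have v': "cnj (v$1) * v$1 + cnj (v$2) * v$2 + cnj (v$3) * v$3 = 1"
    and w': "cnj (w$1) * w$1 + cnj (w$2) * w$2 + cnj (w$3) * w$3 = 1"
    and vw': "cnj (v$1) * w$1 + cnj (v$2) * w$2 + cnj (v$3) * w$3 = 0"
    using v w vw by (simp_all add: cinner_vec_def cinner_complex_def sum_3)
  have wv': "v$1 * cnj (w$1) + v$2 * cnj (w$2) + v$3 * cnj (w$3) = 0"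
    using arg_cong[OF vw', of cnj] by simp
  have uu: "cnj (u$1) * u$1 + cnj (u$2) * u$2 + cnj (u$3) * u$3 = 1"
  proof -
    \<comment> \<open>Lagrange's identity for the cross product: |u|^2 = |v|^2 |w|^2 -
      |<v,w>|^2.\<close>
    have "cnj (u$1) * u$1 + cnj (u$2) * u$2 + cnj (u$3) * u$3 =
      (cnj (v$1) * v$1 + cnj (v$2) * v$2 + cnj (v$3) * v$3)
        * (cnj (w$1) * w$1 + cnj (w$2) * w$2 + cnj (w$3) * w$3)
      - (cnj (v$1) * w$1 + cnj (v$2) * w$2 + cnj (v$3) * w$3)
        * (v$1 * cnj (w$1) + v$2 * cnj (w$2) + v$3 * cnj (w$3))"
      unfolding u_def vector_3 complex_cnj_diff complex_cnj_mult complex_cnj_cnj by algebra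
    then show ?thesis using v' w' vw' by simp
  qed
  have vu: "cnj (v$1) * u$1 + cnj (v$2) * u$2 + cnj (v$3) * u$3 = 0"
    "cnj (w$1) * u$1 + cnj (w$2) * u$2 + cnj (w$3) * u$3 = 0"
    unfolding u_def vector_3 complex_cnj_diff complex_cnj_mult by algebra+
  have uv: "cnj (u$1) * v$1 + cnj (u$2) * v$2 + cnj (u$3) * v$3 = 0"
    "cnj (u$1) * w$1 + cnj (u$2) * w$2 + cnj (u$3) * w$3 = 0"
    using vu[THEN arg_cong[of _ _ cnj]] by (simp_all add: mult.commute)
  have "mat_adj g ** g = mat 1"
    using v' w' vw' wv' uu vu uv
    by (simp add: vec_eq_iff forall_3 matrix_matrix_mult_def mat_def sum_3 g_def mult.commute)
  moreover have "det g = 1"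
  proof -
    \<comment> \<open>Expansion along the third column: its cofactors are the entries of the
      unconjugated cross product, that is \<open>cnj (u$i)\<close>.\<close>
    have "det g = cnj (u$1) * u$1 + cnj (u$2) * u$2 + cnj (u$3) * u$3"
      unfolding det_3 g_def u_def vector_3 by (simp add: algebra_simps)
    then show ?thesis using uu by simp
  qed
  moreover have "g *v axis 1 1 = v"
    by (simp add: vec_eq_iff matrix_vector_mult_def g_def axis_def sum_3)
  ultimately show ?thesis unfolding SU3_def by blast
qed

lemma exists_unit_orthogonal:
  fixes v :: "complex^3"
  shows "\<exists>w. cinner w w = 1 \<and> cinner v w = 0"
proof -
  define w :: "complex^3" where
    "w = (if v$1 = 0 \<and> v$2 = 0 then vector [1, 0, 0] else vector [- cnj (v$2), cnj (v$1), 0])"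
  have nz: "w \<noteq> 0"
    by (auto simp: w_def vec_eq_iff forall_3 vector_3)
  have orth: "cinner v w = 0"
    by (simp add: w_def cinner_vec_def cinner_complex_def sum_3 vector_3)
  define w' where "w' = complex_of_real (inverse (norm w)) *\<^sub>C w"
  have "cinner w' w' = 1"
    using nz unfolding w'_def cscale_of_real cinner_self by simp
  moreover have "cinner v w' = 0" by (simp add: w'_def cinner_cscale_right orth)
  ultimately show ?thesis by blast
qed

lemma SU3_transitive: "\<exists>g\<in>SU3. cp2_act g cp2_base = x"
proof -
  obtain v where v: "v \<noteq> 0" "x = proj_line v" by (rule proj_line_cases)
  define v' where "v' = complex_of_real (inverse (norm v)) *\<^sub>C v"
  have unit: "cinner v' v' = 1"
    using v unfolding v'_def cscale_of_real cinner_self by simp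
  obtain w where "cinner w w = 1" "cinner v' w = 0" using exists_unit_orthogonal by blast
  then obtain g where g: "g \<in> SU3" "g *v axis 1 1 = v'" using SU3_columns unit by blast
  have "(axis 1 1 :: complex^3) \<noteq> 0" by (simp add: axis_eq_0_iff)
  then have "cp2_act g cp2_base = proj_line v'" using g by (simp add: cp2_base_def cp2_act_proj_line)
  also have "\<dots> = x" using v by (simp add: v'_def proj_line_cscale)
  finally show ?thesis using g by blast
qed

lemma coset_rep: "coset_rep x \<in> SU3" "cp2_act (coset_rep x) cp2_base = x"
  using someI_ex[of "\<lambda>g. g \<in> SU3 \<and> cp2_act g cp2_base = x"] SU3_transitive[of x]
  unfolding coset_rep_def by blast+

text \<open>Serves to make symbols Borel measurable. Order 0 of smoothness gives continuity in each
  chart, hence on each open set \<open>v $ i \<noteq> 0\<close>; these three sets cover the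
  complement of 0, of which \<open>cp2\<close> carries the quotient topology.\<close>

lemma cp2_smooth_imp_continuous:
  assumes "cp2_smooth f" shows "continuous_on UNIV f"
proof -
  have ch: "continuous_on UNIV (\<lambda>(z::complex, w::complex). f (proj_line (vector [1, z, w])))"
    "continuous_on UNIV (\<lambda>(z::complex, w::complex). f (proj_line (vector [z, 1, w])))"
    "continuous_on UNIV (\<lambda>(z::complex, w::complex). f (proj_line (vector [z, w, 1])))"
    using assms unfolding cp2_smooth_def by (metis C_times.simps(1))+
  have c1: "continuous_on {v :: complex^3. v $ 1 \<noteq> 0} (\<lambda>v. f (proj_line v))"
  proof -
    have "continuous_on {v :: complex^3. v $ 1 \<noteq> 0}
        ((\<lambda>(z, w). f (proj_line (vector [1, z, w]))) \<circ> (\<lambda>v. (v$2 / v$1, v$3 / v$1)))"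
      by (rule continuous_on_compose)
         (auto intro!: continuous_intros continuous_on_subset[OF ch(1)])
    moreover have "proj_line (vector [1, v$2 / v$1, v$3 / v$1]) = proj_line v" if "v $ 1 \<noteq> 0" for v :: "complex^3"
    proof -
      have "vector [1, v$2 / v$1, v$3 / v$1] = inverse (v$1) *\<^sub>C v"
        using that by (simp add: vec_eq_iff forall_3 vector_3 field_simps)
      then show ?thesis using that by (simp add: proj_line_cscale)
    qed
    ultimately show ?thesis
      unfolding o_def by (elim continuous_on_eq) auto
  qed
  have c2: "continuous_on {v :: complex^3. v $ 2 \<noteq> 0} (\<lambda>v. f (proj_line v))"
  proof -
    have "continuous_on {v :: complex^3. v $ 2 \<noteq> 0}
        ((\<lambda>(z, w). f (proj_line (vector [z, 1, w]))) \<circ> (\<lambda>v. (v$1 / v$2, v$3 / v$2)))"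
      by (rule continuous_on_compose)
         (auto intro!: continuous_intros continuous_on_subset[OF ch(2)])
    moreover have "proj_line (vector [v$1 / v$2, 1, v$3 / v$2]) = proj_line v" if "v $ 2 \<noteq> 0" for v :: "complex^3"
    proof -
      have "vector [v$1 / v$2, 1, v$3 / v$2] = inverse (v$2) *\<^sub>C v"
        using that by (simp add: vec_eq_iff forall_3 vector_3 field_simps)
      then show ?thesis using that by (simp add: proj_line_cscale)
    qed
    ultimately show ?thesis
      unfolding o_def by (elim continuous_on_eq) auto
  qed
  have c3: "continuous_on {v :: complex^3. v $ 3 \<noteq> 0} (\<lambda>v. f (proj_line v))"
  proof -
    have "continuous_on {v :: complex^3. v $ 3 \<noteq> 0}
        ((\<lambda>(z, w). f (proj_line (vector [z, w, 1]))) \<circ> (\<lambda>v. (v$1 / v$3, v$2 / v$3)))"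
      by (rule continuous_on_compose)
         (auto intro!: continuous_intros continuous_on_subset[OF ch(3)])
    moreover have "proj_line (vector [v$1 / v$3, v$2 / v$3, 1]) = proj_line v" if "v $ 3 \<noteq> 0" for v :: "complex^3"
    proof -
      have "vector [v$1 / v$3, v$2 / v$3, 1] = inverse (v$3) *\<^sub>C v"
        using that by (simp add: vec_eq_iff forall_3 vector_3 field_simps)
      then show ?thesis using that by (simp add: proj_line_cscale)
    qed
    ultimately show ?thesis
      unfolding o_def by (elim continuous_on_eq) auto
  qed
  have op: "open {v :: complex^3. v $ i \<noteq> 0}" for i
  proof -
    have "{v :: complex^3. v $ i \<noteq> 0} = (\<lambda>v. v $ i) -` (- {0})" by auto
    then show ?thesis by (auto intro!: open_vimage continuous_intros simp: open_Compl)
  qed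
  have "continuous_on ({v :: complex^3. v $ 1 \<noteq> 0} \<union> {v. v $ 2 \<noteq> 0} \<union> {v. v $ 3 \<noteq> 0})
      (\<lambda>v. f (proj_line v))"
    by (intro continuous_on_open_Un c1 c2 c3 op open_Un)
  moreover have "({v :: complex^3. v $ 1 \<noteq> 0} \<union> {v. v $ 2 \<noteq> 0} \<union> {v. v $ 3 \<noteq> 0}) = - {0}"
    by (auto simp: vec_eq_iff forall_3)
  ultimately have cont: "continuous_on (- {0}) (\<lambda>v :: complex^3. f (proj_line v))" by simp
  have "open (f -` S)" if "open S" for S
  proof -
    have "open ((\<lambda>v :: complex^3. f (proj_line v)) -` S \<inter> - {0})"
      using cont that by (simp add: continuous_on_open_vimage open_Compl)
    moreover have "(\<lambda>v :: complex^3. f (proj_line v)) -` S \<inter> - {0} = {v. v \<noteq> 0 \<and> proj_line v \<in> f -` S}"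
      by auto
    ultimately show ?thesis by (simp add: open_cp2_def)
  qed
  then show ?thesis by (simp add: continuous_on_open_vimage)
qed

section \<open>One-parameter groups of matrices\<close>

lemma tendsto_det:
  fixes f :: "'b \<Rightarrow> complex^'d^'d"
  assumes "(f \<longlongrightarrow> A) F" shows "((\<lambda>x. det (f x)) \<longlongrightarrow> det A) F"
  unfolding det_def using assms by (intro tendsto_intros)

text \<open>Integration improves regularity: integrating the homomorphism law over a short interval
  writes \<open>\<phi> t\<close> as a difference of antiderivatives times a fixed invertible
  matrix.\<close>

lemma one_parameter_group_differentiable:
  fixes \<phi> :: "real \<Rightarrow> complex^'d^'d"
  assumes cont: "continuous_on UNIV \<phi>" and hom: "\<And>s t. \<phi> (s + t) = \<phi> s ** \<phi> t" and one: "\<phi> 0 = mat 1"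
  shows "\<exists>B. (\<phi> has_vector_derivative B) (at 0)"
proof -
  \<comment> \<open>The lower limit -1 keeps 0 in the interior and allows \<open>t\<close> on both
    sides of 0; the bound 2 in \<open>G'\<close> leaves room for \<open>h < 1\<close>.\<close>
  define G where "G u = integral {-1..u} \<phi>" for u
  have int: "\<phi> integrable_on {a..b}" for a b
    by (rule integrable_continuous_real) (rule continuous_on_subset[OF cont], simp)
  have G': "(G has_vector_derivative \<phi> u) (at u)" if "u \<in> {-1<..<2}" for u
  proof -
    have "(G has_vector_derivative \<phi> u) (at u within {-1..2})"
      unfolding G_def
      by (rule integral_has_vector_derivative) (use that in \<open>auto intro: continuous_on_subset[OF cont]\<close>)
    then show ?thesis using that by (simp add: at_within_Icc_at)
  qed
  \<comment> \<open>The mean of \<open>\<phi>\<close> over a short interval tends to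
    \<open>\<phi> 0 = mat 1\<close>. Since the determinant is continuous, that mean is invertible
    for some small \<open>h\<close>.\<close>
  have "((\<lambda>h. (1/h) *\<^sub>R (G h - G 0)) \<longlongrightarrow> mat 1) (at 0)"
  proof -
    have "((\<lambda>h. norm (G (0 + h) - G 0 - h *\<^sub>R \<phi> 0) / norm h) \<longlongrightarrow> 0) (at 0)"
      using G'[of 0] by (simp add: has_vector_derivative_def has_derivative_at)
    moreover have "norm (G (0 + h) - G 0 - h *\<^sub>R \<phi> 0) / norm h
        = norm ((1/h) *\<^sub>R (G h - G 0) - mat 1)" if "h \<noteq> 0" for h
    proof -
      have "(1/h) *\<^sub>R (G h - G 0) - mat 1 = (1/h) *\<^sub>R (G h - G 0 - h *\<^sub>R mat 1)"
        using that by (simp add: scaleR_diff_right)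
      then show ?thesis by (simp add: one)
    qed
    then have "eventually (\<lambda>h. norm (G (0 + h) - G 0 - h *\<^sub>R \<phi> 0) / norm h
        = norm ((1/h) *\<^sub>R (G h - G 0) - mat 1)) (at 0)"
      unfolding eventually_at_filter by (intro always_eventually) blast
    ultimately have "((\<lambda>h. norm ((1/h) *\<^sub>R (G h - G 0) - mat 1)) \<longlongrightarrow> 0) (at 0)"
      by (rule Lim_transform_eventually)
    then show ?thesis by (rule LIM_zero_cancel[OF tendsto_norm_zero_cancel])
  qed
  then have "((\<lambda>h. det ((1/h) *\<^sub>R (G h - G 0))) \<longlongrightarrow> det (mat 1 :: complex^'d^'d)) (at 0)"
    by (rule tendsto_det)
  then have "eventually (\<lambda>h. det ((1/h) *\<^sub>R (G h - G 0)) \<noteq> 0) (at 0)"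
    by (rule tendsto_imp_eventually_ne) simp
  then have "eventually (\<lambda>h. det ((1/h) *\<^sub>R (G h - G 0)) \<noteq> 0) (at_right 0)"
    by (simp add: eventually_at_split)
  moreover have "eventually (\<lambda>h::real. h \<in> {0<..<1}) (at_right 0)"
    by (rule eventually_at_right_real) simp
  ultimately have "eventually (\<lambda>h. det ((1/h) *\<^sub>R (G h - G 0)) \<noteq> 0 \<and> h \<in> {0<..<1}) (at_right 0)"
    by (rule eventually_conj)
  then have "\<exists>h. det ((1/h) *\<^sub>R (G h - G 0)) \<noteq> 0 \<and> h \<in> {0<..<1}"
    by (rule eventually_happens'[rotated]) (simp add: trivial_limit_at_right_real)
  then obtain h where h: "0 < h" "h < 1" and det: "det ((1/h) *\<^sub>R (G h - G 0)) \<noteq> 0"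
    by (metis greaterThanLessThan_iff)
  then obtain Q where Q: "((1/h) *\<^sub>R (G h - G 0)) ** Q = mat 1"
    using det[folded invertible_det_nz] unfolding invertible_def by blast
  have diff: "G b - G a = integral {a..b} \<phi>" if "-1 \<le> a" "a \<le> b" for a b
    unfolding G_def using Henstock_Kurzweil_Integration.integral_combine[of "-1" a b \<phi>] that int
    by (metis add_diff_cancel_left')
  \<comment> \<open>The law \<open>\<phi> (t + s) = \<phi> t ** \<phi> s\<close>, integrated over s
    from 0 to h and solved for \<open>\<phi> t\<close> by the inverse \<open>Q\<close>.\<close>
  have key: "\<phi> t = (G (t + h) - G t) ** ((1/h) *\<^sub>R Q)" if "t \<in> {-1<..<1}" for t
  proof -
    have "G (t + h) - G t = integral {t..t+h} \<phi>" using that h by (intro diff) auto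
    also have "\<dots> = integral {0..h} (\<phi> \<circ> ((+) t))"
      using integral_shift_Icc_real[of 0 h \<phi> t] by (simp add: add.commute)
    also have "\<phi> \<circ> ((+) t) = (\<lambda>A. \<phi> t ** A) \<circ> \<phi>" by (auto simp: hom)
    also have "integral {0..h} \<dots> = \<phi> t ** integral {0..h} \<phi>"
      by (rule integral_linear[OF int bounded_bilinear.bounded_linear_right[OF bounded_bilinear_matrix_mult]])
    also have "integral {0..h} \<phi> = G h - G 0" using h by (intro diff[symmetric]) auto
    finally have "(G (t + h) - G t) ** ((1/h) *\<^sub>R Q) = \<phi> t ** (((1/h) *\<^sub>R (G h - G 0)) ** Q)"
      by (simp add: bounded_bilinear.scaleR_right[OF bounded_bilinear_matrix_mult]
          bounded_bilinear.scaleR_left[OF bounded_bilinear_matrix_mult] matrix_mul_assoc)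
    then show ?thesis using Q by simp
  qed
  have "((\<lambda>t. G (t + h) - G t) has_vector_derivative (1 *\<^sub>R \<phi> h - \<phi> 0)) (at 0)"
  proof (rule has_vector_derivative_diff)
    have "(G \<circ> (\<lambda>t. t + h) has_vector_derivative (1 *\<^sub>R \<phi> h)) (at 0)"
      by (rule vector_diff_chain_at) (use h in \<open>auto intro!: derivative_eq_intros G'\<close>)
    then show "((\<lambda>t. G (t + h)) has_vector_derivative (1 *\<^sub>R \<phi> h)) (at 0)" by (simp add: o_def)
  qed (use G'[of 0] in simp)
  then have "((\<lambda>t. (G (t + h) - G t) ** ((1/h) *\<^sub>R Q)) has_vector_derivative
      (1 *\<^sub>R \<phi> h - \<phi> 0) ** ((1/h) *\<^sub>R Q)) (at 0)"
    by (rule bounded_linear.has_vector_derivative[OF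
          bounded_bilinear.bounded_linear_left[OF bounded_bilinear_matrix_mult]])
  then have "(\<phi> has_vector_derivative (1 *\<^sub>R \<phi> h - \<phi> 0) ** ((1/h) *\<^sub>R Q)) (at 0)"
    by (rule has_vector_derivative_transform_within_open[of _ _ _ "{-1<..<1}"]) (auto simp: key)
  then show ?thesis ..
qed

section \<open>The exponential map of SU(3)\<close>

definition mat_pow :: "complex^3^3 \<Rightarrow> nat \<Rightarrow> complex^3^3" where
  "mat_pow X k = ((\<lambda>B. X ** B) ^^ k) (mat 1)"

lemma mat_pow_0 [simp]: "mat_pow X 0 = mat 1"
  and mat_pow_Suc: "mat_pow X (Suc k) = X ** mat_pow X k"
  by (simp_all add: mat_pow_def)

lemma mat_pow_Suc_right: "mat_pow X (Suc k) = mat_pow X k ** X"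
proof (induction k)
  case (Suc k)
  have "mat_pow X (Suc (Suc k)) = X ** (mat_pow X k ** X)" by (metis Suc mat_pow_Suc)
  then show ?case by (simp add: mat_pow_Suc matrix_mul_assoc)
qed (simp add: mat_pow_Suc)

lemma mat_pow_scaleR: "mat_pow (t *\<^sub>R X) k = (t ^ k) *\<^sub>R mat_pow X k"
  by (induction k)
     (simp_all add: mat_pow_Suc bounded_bilinear.scaleR_right[OF bounded_bilinear_matrix_mult]
       bounded_bilinear.scaleR_left[OF bounded_bilinear_matrix_mult])

lemma mat_pow_bound: "\<exists>C\<ge>0. \<forall>k. norm (mat_pow X k) \<le> C ^ k * norm (mat 1 :: complex^3^3)"
proof -
  obtain C where C: "C \<ge> 0" "\<And>B :: complex^3^3. norm (X ** B) \<le> norm B * C"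
    using bounded_linear.nonneg_bounded[OF
        bounded_bilinear.bounded_linear_right[OF bounded_bilinear_matrix_mult]] by metis
  have "norm (mat_pow X k) \<le> C ^ k * norm (mat 1 :: complex^3^3)" for k
  proof (induction k)
    case (Suc k)
    have "norm (mat_pow X (Suc k)) \<le> norm (mat_pow X k) * C" by (simp add: mat_pow_Suc C)
    also have "\<dots> \<le> (C ^ k * norm (mat 1 :: complex^3^3)) * C" by (rule mult_right_mono[OF Suc C(1)])
    finally show ?case by (simp add: mult_ac)
  qed simp
  then show ?thesis using C(1) by blast
qed

text \<open>Entrywise the exponential is a complex power series in t, majorised by an ordinary
  exponential series. Convergence for every complex z is what licenses termwise differentiation
  later.\<close>

lemma mat_exp_entry:
  "summable (\<lambda>k. (mat_pow X k $ i $ j / fact k) * z ^ k)"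
  "mat_exp (t *\<^sub>R X) $ i $ j = (\<Sum>k. (mat_pow X k $ i $ j / fact k) * complex_of_real t ^ k)"
proof -
  obtain C where C: "C \<ge> 0" "\<And>k. norm (mat_pow X k) \<le> C ^ k * norm (mat 1 :: complex^3^3)"
    using mat_pow_bound by blast
  define N where "N = norm (mat 1 :: complex^3^3)"
  have sm: "summable (\<lambda>k. (inverse (fact k) * (C * r) ^ k) * N)" for r
    by (rule summable_mult2[OF summable_exp])
  have entry: "norm (A $ i $ j) \<le> norm A" for A :: "complex^3^3"
    by (rule order_trans[OF Finite_Cartesian_Product.norm_nth_le Finite_Cartesian_Product.norm_nth_le])
  show "summable (\<lambda>k. (mat_pow X k $ i $ j / fact k) * z ^ k)"
  proof (rule summable_comparison_test'[OF sm])
    fix k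
    have "norm ((mat_pow X k $ i $ j / fact k) * z ^ k)
        = norm (mat_pow X k $ i $ j) * (inverse (fact k) * norm z ^ k)"
      by (simp add: norm_mult norm_divide norm_power divide_inverse norm_inverse)
    also have "\<dots> \<le> (C ^ k * N) * (inverse (fact k) * norm z ^ k)"
      by (rule mult_right_mono) (auto intro: order_trans[OF entry C(2)] simp: N_def)
    finally show "norm ((mat_pow X k $ i $ j / fact k) * z ^ k)
        \<le> (inverse (fact k) * (C * norm z) ^ k) * N"
      by (simp add: power_mult_distrib mult_ac)
  qed
  have "summable (\<lambda>k. (1 / fact k) *\<^sub>R mat_pow (t *\<^sub>R X) k)"
  proof (rule summable_comparison_test'[OF sm])
    fix k
    have "norm ((1 / fact k) *\<^sub>R mat_pow (t *\<^sub>R X) k)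
        = norm (mat_pow X k) * (inverse (fact k) * \<bar>t\<bar> ^ k)"
      by (simp add: mat_pow_scaleR divide_inverse power_abs abs_mult)
    also have "\<dots> \<le> (C ^ k * N) * (inverse (fact k) * \<bar>t\<bar> ^ k)"
      by (rule mult_right_mono) (auto intro: C(2) simp: N_def)
    finally show "norm ((1 / fact k) *\<^sub>R mat_pow (t *\<^sub>R X) k)
        \<le> (inverse (fact k) * (C * \<bar>t\<bar>) ^ k) * N"
      by (simp add: power_mult_distrib mult_ac)
  qed
  then have "mat_exp (t *\<^sub>R X) $ i $ j = (\<Sum>k. ((1 / fact k) *\<^sub>R mat_pow (t *\<^sub>R X) k) $ i $ j)"
    unfolding mat_exp_def mat_pow_def[symmetric]
    using bounded_linear.suminf[OF bounded_linear_compose[OF bounded_linear_vec_nth bounded_linear_vec_nth]]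
    by blast
  then show "mat_exp (t *\<^sub>R X) $ i $ j = (\<Sum>k. (mat_pow X k $ i $ j / fact k) * complex_of_real t ^ k)"
    unfolding mat_pow_scaleR vector_scaleR_component
    by (simp add: scaleR_conv_of_real[where 'a = complex] field_simps)
qed

lemma mat_exp_0: "mat_exp (0 *\<^sub>R X) = mat 1"
  unfolding vec_eq_iff mat_exp_entry(2) of_real_0 powser_zero by simp

lemma has_vector_derivative_matrixI:
  fixes f :: "real \<Rightarrow> complex^3^3"
  assumes "\<And>i j. ((\<lambda>t. f t $ i $ j) has_vector_derivative f' $ i $ j) (at t)"
  shows "(f has_vector_derivative f') (at t)"
proof -
  have decomp: "A = (\<Sum>i\<in>UNIV. \<Sum>j\<in>UNIV. (A $ i $ j) *\<^sub>C mat_unit i j)" for A :: "complex^3^3"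
    by (simp add: vec_eq_iff mat_unit_def if_distrib[of "\<lambda>x. _ * x"] forall_3 sum_3)
  have bl: "bounded_linear (\<lambda>z. z *\<^sub>C mat_unit i j)" for i j
    by (rule linear_conv_bounded_linear[THEN iffD1]) (auto intro!: linearI simp: vec_eq_iff algebra_simps)
  have "((\<lambda>t. \<Sum>i\<in>UNIV. \<Sum>j\<in>UNIV. (f t $ i $ j) *\<^sub>C mat_unit i j) has_vector_derivative
      (\<Sum>i\<in>UNIV. \<Sum>j\<in>UNIV. (f' $ i $ j) *\<^sub>C mat_unit i j)) (at t)"
    by (intro has_vector_derivative_sum bounded_linear.has_vector_derivative[OF bl] assms)
  then show ?thesis using decomp by simp
qed

text \<open>The two forms come from splitting a factor X off the powers on the left or on the right.
  The product rule computations below need X on whichever side makes terms cancel.\<close>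

lemma mat_exp_has_vector_derivative:
  "((\<lambda>t. mat_exp (t *\<^sub>R X)) has_vector_derivative (X ** mat_exp (t *\<^sub>R X))) (at t)"
  "((\<lambda>t. mat_exp (t *\<^sub>R X)) has_vector_derivative (mat_exp (t *\<^sub>R X) ** X)) (at t)"
proof -
  define a where "a i j k = mat_pow X k $ i $ j / fact k" for i j k
  have sm: "summable (\<lambda>k. a i j k * z ^ k)" for i j z unfolding a_def by (rule mat_exp_entry(1))
  have ent: "mat_exp (t *\<^sub>R X) $ i $ j = (\<Sum>k. a i j k * complex_of_real t ^ k)" for i j t
    unfolding a_def by (rule mat_exp_entry(2))
  have D: "((\<lambda>t. mat_exp (t *\<^sub>R X) $ i $ j) has_vector_derivative
      (\<Sum>k. diffs (a i j) k * complex_of_real t ^ k)) (at t)" for i j t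
    unfolding ent
    by (rule has_vector_derivative_real_field) (rule termdiffs_strong_converges_everywhere, rule sm)
  have da: "diffs (a i j) k = mat_pow X (Suc k) $ i $ j / fact k" for i j k
    by (simp add: diffs_def a_def fact_Suc del: of_nat_Suc)
  have "(\<Sum>k. diffs (a i j) k * z ^ k) = (\<Sum>l\<in>UNIV. X $ i $ l * (\<Sum>k. a l j k * z ^ k))" for i j z
  proof -
    have "(\<Sum>l\<in>UNIV. X $ i $ l * (\<Sum>k. a l j k * z ^ k)) = (\<Sum>l\<in>UNIV. (\<Sum>k. X $ i $ l * (a l j k * z ^ k)))"
      by (simp add: suminf_mult sm)
    also have "\<dots> = (\<Sum>k. \<Sum>l\<in>UNIV. X $ i $ l * (a l j k * z ^ k))"
      by (rule suminf_sum[symmetric]) (rule summable_mult[OF sm])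
    finally show ?thesis
      by (simp add: da mat_pow_Suc matrix_matrix_mult_def a_def sum_distrib_right sum_divide_distrib mult.assoc)
  qed
  then show "((\<lambda>t. mat_exp (t *\<^sub>R X)) has_vector_derivative (X ** mat_exp (t *\<^sub>R X))) (at t)"
    by (intro has_vector_derivative_matrixI) (use D in \<open>simp add: matrix_matrix_mult_def ent\<close>)
  have "(\<Sum>k. diffs (a i j) k * z ^ k) = (\<Sum>l\<in>UNIV. (\<Sum>k. a i l k * z ^ k) * X $ l $ j)" for i j z
  proof -
    have "(\<Sum>l\<in>UNIV. (\<Sum>k. a i l k * z ^ k) * X $ l $ j) = (\<Sum>l\<in>UNIV. (\<Sum>k. a i l k * z ^ k * X $ l $ j))"
      by (simp add: suminf_mult2 sm)
    also have "\<dots> = (\<Sum>k. \<Sum>l\<in>UNIV. a i l k * z ^ k * X $ l $ j)"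
      by (rule suminf_sum[symmetric]) (rule summable_mult2[OF sm])
    finally show ?thesis
      by (simp add: da mat_pow_Suc_right matrix_matrix_mult_def a_def sum_distrib_left
          sum_divide_distrib mult_ac)
  qed
  then show "((\<lambda>t. mat_exp (t *\<^sub>R X)) has_vector_derivative (mat_exp (t *\<^sub>R X) ** X)) (at t)"
    by (intro has_vector_derivative_matrixI) (use D in \<open>simp add: matrix_matrix_mult_def ent\<close>)
qed

lemma constant_if_derivative_0:
  fixes f :: "real \<Rightarrow> 'b::banach"
  assumes "\<And>t. (f has_vector_derivative 0) (at t)" shows "f s = f t"
  using has_vector_derivative_zero_constant[of UNIV f] assms by (metis UNIV_I convex_UNIV)

text \<open>The product of the exponentials of \<open>(s + t - r) X\<close> and \<open>r X\<close>
  has zero derivative in r; its values at \<open>r = 0\<close> and \<open>r = t\<close> are the two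
  sides.\<close>

lemma mat_exp_add: "mat_exp ((s + t) *\<^sub>R X) = mat_exp (s *\<^sub>R X) ** mat_exp (t *\<^sub>R X)"
proof -
  have "((\<lambda>r. mat_exp ((s + t - r) *\<^sub>R X) ** mat_exp (r *\<^sub>R X)) has_vector_derivative 0) (at r)" for r
  proof -
    have "((\<lambda>r. mat_exp (r *\<^sub>R X)) \<circ> (\<lambda>r. s + t - r) has_vector_derivative
        ((-1) *\<^sub>R (mat_exp ((s + t - r) *\<^sub>R X) ** X))) (at r)"
      by (rule vector_diff_chain_at)
         (auto intro!: derivative_eq_intros mat_exp_has_vector_derivative(2))
    from has_vector_derivative_matrix_mult[OF this mat_exp_has_vector_derivative(1)[of X r]]
    show ?thesis by (simp add: o_def matrix_mult_minus_left matrix_mul_assoc)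
  qed
  from constant_if_derivative_0[OF this, of 0 t] show ?thesis
    using mat_exp_0[of X] by simp
qed

text \<open>For anti-Hermitian X the product of the adjoint with the exponential has zero
  derivative. The determinant has derivative \<open>trace X\<close> at 0, and multiplicativity
  carries this vanishing derivative to every t.\<close>

lemma mat_exp_SU3:
  assumes skew: "mat_adj X = - X" and tr: "trace X = 0"
  shows "mat_exp (t *\<^sub>R X) \<in> SU3"
proof -
  let ?g = "\<lambda>t. mat_exp (t *\<^sub>R X)"
  have "((\<lambda>t. mat_adj (?g t) ** ?g t) has_vector_derivative 0) (at t)" for t
  proof -
    have "((\<lambda>t. mat_adj (?g t)) has_vector_derivative mat_adj (X ** ?g t)) (at t)"
      by (rule bounded_linear.has_vector_derivative[OF bounded_linear_mat_adj
            mat_exp_has_vector_derivative(1)])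
    from has_vector_derivative_matrix_mult[OF this mat_exp_has_vector_derivative(1)[of X t]]
    show ?thesis
      by (simp add: mat_adj_mult skew matrix_mult_minus_left matrix_mult_minus_right matrix_mul_assoc)
  qed
  from constant_if_derivative_0[OF this, of t 0] have "mat_adj (?g t) ** ?g t = mat 1"
    using mat_exp_0[of X] by simp
  moreover have "det (?g t) = 1"
  proof -
    have ent: "((\<lambda>h. ?g h $ i $ j) has_vector_derivative X $ i $ j) (at 0)" for i j
      using bounded_linear.has_vector_derivative[OF
          bounded_linear_compose[OF bounded_linear_vec_nth bounded_linear_vec_nth]
          mat_exp_has_vector_derivative(1)[of X 0], of i j] mat_exp_0[of X] by simp
    have D0: "((\<lambda>h. det (?g h)) has_vector_derivative trace X) (at 0)"
      unfolding det_3 trace_def sum_3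
      by (rule has_vector_derivative_eq_rhs,
          (rule has_vector_derivative_add has_vector_derivative_diff has_vector_derivative_mult ent)+)
         (simp add: mat_exp_0[of X, simplified] mat_def)
    have "((\<lambda>h. det (?g h)) has_vector_derivative 0) (at t)" for t
    proof -
      have "((\<lambda>h. det (?g h)) \<circ> (\<lambda>h. h - t) has_vector_derivative (1 *\<^sub>R 0)) (at t)"
        by (rule vector_diff_chain_at) (use D0 tr in \<open>auto intro!: derivative_eq_intros\<close>)
      from has_vector_derivative_mult_right[OF this, of "det (?g t)"]
      have "((\<lambda>h. det (?g t) * det (?g (h - t))) has_vector_derivative 0) (at t)" by (simp add: o_def)
      moreover have "det (?g t) * det (?g (h - t)) = det (?g h)" for h
        using mat_exp_add[of t "h - t" X] by (simp add: det_mul)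
      ultimately show ?thesis by simp
    qed
    from constant_if_derivative_0[OF this, of t 0] show ?thesis using mat_exp_0[of X] by simp
  qed
  ultimately show ?thesis by (simp add: SU3_def)
qed

lemma mat_exp_fixes:
  assumes "X *v v = 0" shows "mat_exp (t *\<^sub>R X) *v v = v"
proof -
  have bl: "bounded_linear (\<lambda>A :: complex^3^3. A *v v)"
    by (rule linear_conv_bounded_linear[THEN iffD1])
       (auto intro!: linearI simp: vec_eq_iff matrix_vector_mult_def algebra_simps sum.distrib
         scaleR_sum_right)
  have "((\<lambda>t. mat_exp (t *\<^sub>R X) *v v) has_vector_derivative 0) (at t)" for t
    using bounded_linear.has_vector_derivative[OF bl mat_exp_has_vector_derivative(2)[of X t]] assms
    by (simp add: matrix_vector_mul_assoc[symmetric])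
  from constant_if_derivative_0[OF this, of t 0] show ?thesis using mat_exp_0[of X] by simp
qed

lemma mat_exp_isotropy:
  assumes "mat_adj X = - X" "trace X = 0" "X *v axis 1 1 = 0"
  shows "mat_exp (t *\<^sub>R X) \<in> isotropy"
proof -
  have "(axis 1 1 :: complex^3) \<noteq> 0" by (simp add: axis_eq_0_iff)
  then show ?thesis
    using assms by (simp add: isotropy_def mat_exp_SU3 cp2_base_def cp2_act_proj_line mat_exp_fixes)
qed

section \<open>The adjoint action on operators and its derivative\<close>

definition comm :: "complex^'d^'d \<Rightarrow> complex^'d^'d \<Rightarrow> complex^'d^'d" where
  "comm C A = C ** A - A ** C"

lemma comm_add_left: "comm (C + D) A = comm C A + comm D A"
  by (simp add: comm_def matrix_mult_add_left matrix_add_ldistrib)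

lemma comm_diff_right: "comm C (A - B) = comm C A - comm C B"
  by (simp add: comm_def matrix_mult_diff_left matrix_mult_diff_right)

lemma comm_cscale_left: "comm (a *\<^sub>C C) A = a *\<^sub>C comm C A"
  by (simp add: comm_def matrix_mult_cscale_left matrix_mult_cscale_right cscale_diff_right)

lemma comm_cscale_right: "comm C (a *\<^sub>C A) = a *\<^sub>C comm C A"
  by (simp add: comm_def matrix_mult_cscale_left matrix_mult_cscale_right cscale_diff_right)

lemma comm_zero_right [simp]: "comm C 0 = 0"
  using comm_cscale_right[of C 0 0] by simp

lemma mat_adj_comm: "mat_adj (comm C A) = - comm (mat_adj C) (mat_adj A)"
  by (simp add: comm_def mat_adj_diff mat_adj_mult)

text \<open>Cyclicity of the trace. Away from the highest weight vector, \<open>gt_basis\<close>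
  describes only lowering and weight operators; this identity makes the raising operators computable
  from the lowering ones.\<close>

lemma cinner_comm_left: "cinner (comm C A) B = cinner A (comm (mat_adj C) B)"
proof -
  have "trace (mat_adj A ** mat_adj C ** B) = trace (mat_adj A ** (mat_adj C ** B))"
    by (simp add: matrix_mul_assoc)
  moreover have "trace (mat_adj C ** mat_adj A ** B) = trace (mat_adj A ** (B ** mat_adj C))"
    by (metis matrix_mul_assoc trace_mul_sym)
  ultimately have "trace (mat_adj (C ** A) ** B) - trace (mat_adj (A ** C) ** B)
      = trace (mat_adj A ** (mat_adj C ** B)) - trace (mat_adj A ** (B ** mat_adj C))"
    by (simp add: mat_adj_mult)
  then show ?thesis
    unfolding comm_def cinner_diff_left cinner_diff_right by (simp add: cinner_matrix)
qed

locale unitary_matrix_rep =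
  fixes \<rho> :: "complex^3^3 \<Rightarrow> complex^'d^'d"
  assumes unitary: "unitary_rep UNIV (vec_rep \<rho>)"
begin

lemma rho_mult: "\<rho> (g ** h) = \<rho> g ** \<rho> h" if "g \<in> SU3" "h \<in> SU3"
proof -
  have "\<rho> (g ** h) *v x = (\<rho> g ** \<rho> h) *v x" for x
    using unitary that by (simp add: unitary_rep_def vec_rep_def matrix_vector_mul_assoc)
  then show ?thesis by (simp add: matrix_eq)
qed

lemma rho_mat_1: "\<rho> (mat 1) = mat 1"
proof -
  have "\<rho> (mat 1) *v x = mat 1 *v x" for x
    using unitary by (simp add: unitary_rep_def vec_rep_def)
  then show ?thesis by (simp add: matrix_eq)
qed

lemma rho_unitary:
  assumes "g \<in> SU3"
  shows "mat_adj (\<rho> g) ** \<rho> g = mat 1" "\<rho> g ** mat_adj (\<rho> g) = mat 1"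
    "matrix_inv (\<rho> g) = mat_adj (\<rho> g)"
proof -
  have adj: "cinner x (mat_adj A *v y) = cinner (A *v x) y" for A :: "complex^'d^'d" and x y
    unfolding cinner_vec_def cinner_complex_def matrix_vector_mult_def
    by (simp add: sum_distrib_left sum_distrib_right mult_ac) (rule sum.swap)
  have "(mat_adj (\<rho> g) ** \<rho> g) *v y = mat 1 *v y" for y
  proof (rule cinner_ext)
    fix x show "cinner x ((mat_adj (\<rho> g) ** \<rho> g) *v y) = cinner x (mat 1 *v y)"
      using unitary assms
      by (simp add: matrix_vector_mul_assoc[symmetric] adj unitary_rep_def vec_rep_def)
  qed
  then show 1: "mat_adj (\<rho> g) ** \<rho> g = mat 1" by (simp add: matrix_eq)
  then show 2: "\<rho> g ** mat_adj (\<rho> g) = mat 1" using inverse_unique_matrix by blast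
  then show "matrix_inv (\<rho> g) = mat_adj (\<rho> g)" using inverse_unique_matrix by blast
qed

lemma continuous_on_rho: "continuous_on SU3 \<rho>"
proof -
  have "continuous_on SU3 (\<lambda>g. (\<rho> g *v axis j 1) $ i)" for i j
    using unitary by (intro continuous_intros) (simp add: unitary_rep_def vec_rep_def)
  moreover have "(\<rho> g *v axis j 1) $ i = \<rho> g $ i $ j" for g i j
    by (simp add: matrix_vector_mult_def axis_def if_distrib[of "\<lambda>x. _ * x"] cong: if_cong)
  ultimately have "continuous_on SU3 (\<lambda>g. \<rho> g $ i $ j)" for i j by simp
  then have "continuous_on SU3 (\<lambda>g. \<chi> i j. \<rho> g $ i $ j)"
    by (intro continuous_on_vec_lambda)
  then show ?thesis by simp
qed

lemma op_rep_eq: "op_rep \<rho> g A = \<rho> g ** A ** mat_adj (\<rho> g)" if "g \<in> SU3"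
  using rho_unitary[OF that] by (simp add: op_rep_def)

lemma op_rep_add: "op_rep \<rho> g (A + B) = op_rep \<rho> g A + op_rep \<rho> g B"
  by (simp add: op_rep_def matrix_mult_add_left matrix_add_ldistrib)

lemma op_rep_cscale: "op_rep \<rho> g (a *\<^sub>C A) = a *\<^sub>C op_rep \<rho> g A"
  by (simp add: op_rep_def matrix_mult_cscale_left matrix_mult_cscale_right)

lemma op_rep_zero [simp]: "op_rep \<rho> g 0 = 0"
  using op_rep_cscale[of g 0 0] by simp

lemma op_rep_sum: "op_rep \<rho> g (\<Sum>i\<in>I. f i) = (\<Sum>i\<in>I. op_rep \<rho> g (f i))"
  by (induction I rule: infinite_finite_induct) (auto simp: op_rep_add)

lemma op_rep_mat_adj: "op_rep \<rho> g (mat_adj A) = mat_adj (op_rep \<rho> g A)" if "g \<in> SU3"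
  using that by (simp add: op_rep_eq mat_adj_mult matrix_mul_assoc)

lemma op_rep_inverse:
  assumes "g \<in> SU3"
  shows "op_rep \<rho> (mat_adj g) (op_rep \<rho> g A) = A" "op_rep \<rho> g (op_rep \<rho> (mat_adj g) A) = A"
proof -
  have "\<rho> (mat_adj g) ** \<rho> g = mat 1"
    using rho_mult[OF SU3_mat_adj[OF assms] assms] SU3_D[OF assms] by (simp add: rho_mat_1)
  then have inv: "\<rho> (mat_adj g) = mat_adj (\<rho> g)"
    using inverse_unique_matrix(1) rho_unitary(1)[OF assms] inverse_unique_matrix(2) by metis
  have 1: "op_rep \<rho> (mat_adj g) (op_rep \<rho> g A)
      = (mat_adj (\<rho> g) ** \<rho> g) ** A ** (mat_adj (\<rho> g) ** \<rho> g)"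
    unfolding op_rep_eq[OF assms] op_rep_eq[OF SU3_mat_adj[OF assms]] inv by (simp add: matrix_mul_assoc)
  have 2: "op_rep \<rho> g (op_rep \<rho> (mat_adj g) A)
      = (\<rho> g ** mat_adj (\<rho> g)) ** A ** (\<rho> g ** mat_adj (\<rho> g))"
    unfolding op_rep_eq[OF assms] op_rep_eq[OF SU3_mat_adj[OF assms]] inv by (simp add: matrix_mul_assoc)
  show "op_rep \<rho> (mat_adj g) (op_rep \<rho> g A) = A" "op_rep \<rho> g (op_rep \<rho> (mat_adj g) A) = A"
    using 1 2 rho_unitary[OF assms] by simp_all
qed

lemma trace_mult_op_rep: "trace (A ** op_rep \<rho> g B) = trace (op_rep \<rho> (mat_adj g) A ** B)"
  if "g \<in> SU3"
proof -
  have inv: "\<rho> (mat_adj g) = mat_adj (\<rho> g)"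
    using rho_mult[OF SU3_mat_adj[OF that] that] SU3_D[OF that] rho_mat_1
      inverse_unique_matrix rho_unitary(1)[OF that] by metis
  have "trace (A ** op_rep \<rho> g B) = trace ((A ** \<rho> g ** B) ** mat_adj (\<rho> g))"
    by (simp add: op_rep_eq[OF that] matrix_mul_assoc)
  also have "\<dots> = trace (mat_adj (\<rho> g) ** (A ** \<rho> g ** B))" by (rule trace_mul_sym)
  also have "\<dots> = trace (op_rep \<rho> (mat_adj g) A ** B)"
    unfolding op_rep_eq[OF SU3_mat_adj[OF that]] inv by (simp add: matrix_mul_assoc)
  finally show ?thesis .
qed

lemma cinner_op_rep: "cinner A (op_rep \<rho> g B) = cinner (op_rep \<rho> (mat_adj g) A) B" if "g \<in> SU3"
  using that trace_mult_op_rep[OF that, of "mat_adj A" B]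
  by (simp add: cinner_matrix op_rep_mat_adj SU3_mat_adj)

lemma cinner_op_rep_op_rep: "cinner (op_rep \<rho> g A) (op_rep \<rho> g B) = cinner A B" if "g \<in> SU3"
  using that by (simp add: cinner_op_rep op_rep_inverse)

text \<open>The differential of \<rho> at the identity. It is taken on matrices rather than on the
  action on operators, so that the latter differentiates to a commutator.\<close>

definition gen :: "complex^3^3 \<Rightarrow> complex^'d^'d" where
  "gen X = vector_derivative (\<lambda>t. \<rho> (mat_exp (t *\<^sub>R X))) (at 0)"

context
  fixes X :: "complex^3^3"
  assumes skew: "mat_adj X = - X" and traceless: "trace X = 0"
begin

lemma gen_has_vector_derivative:
  "((\<lambda>t. \<rho> (mat_exp (t *\<^sub>R X))) has_vector_derivative gen X) (at 0)"
proof -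
  have "continuous_on UNIV (\<lambda>t. mat_exp (t *\<^sub>R X))"
    by (intro continuous_at_imp_continuous_on ballI)
       (rule has_vector_derivative_continuous[OF mat_exp_has_vector_derivative(1)])
  then have "continuous_on UNIV (\<lambda>t. \<rho> (mat_exp (t *\<^sub>R X)))"
    by (rule continuous_on_compose2[OF continuous_on_rho]) (auto intro: mat_exp_SU3 skew traceless)
  then have "\<exists>B. ((\<lambda>t. \<rho> (mat_exp (t *\<^sub>R X))) has_vector_derivative B) (at 0)"
    by (rule one_parameter_group_differentiable)
       (simp_all add: mat_exp_add rho_mult mat_exp_SU3 skew traceless rho_mat_1
         mat_exp_0[of X, simplified])
  then show ?thesis unfolding gen_def by (metis vector_derivative_at)
qed

lemma gen_uminus: "gen (- X) = - gen X"
proof -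
  have "((\<lambda>t. \<rho> (mat_exp (t *\<^sub>R X))) \<circ> (\<lambda>t. - t) has_vector_derivative (- 1) *\<^sub>R gen X) (at 0)"
    by (rule vector_diff_chain_at)
       (use gen_has_vector_derivative in \<open>auto intro!: derivative_eq_intros\<close>)
  then have "((\<lambda>t. \<rho> (mat_exp (t *\<^sub>R (- X)))) has_vector_derivative - gen X) (at 0)"
    by (simp add: o_def)
  then show ?thesis unfolding gen_def[of "- X"] by (rule vector_derivative_at)
qed

lemma mat_adj_gen: "mat_adj (gen X) = - gen X"
proof -
  have "((\<lambda>t. mat_adj (\<rho> (mat_exp (t *\<^sub>R X)))) has_vector_derivative mat_adj (gen X)) (at 0)"
    by (rule bounded_linear.has_vector_derivative[OF bounded_linear_mat_adj gen_has_vector_derivative])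
  from has_vector_derivative_matrix_mult[OF this gen_has_vector_derivative]
  have "((\<lambda>t. mat 1 :: complex^'d^'d) has_vector_derivative gen X + mat_adj (gen X)) (at 0)"
    by (simp add: rho_unitary mat_exp_SU3 skew traceless mat_exp_0[of X, simplified] rho_mat_1)
  from vector_derivative_unique_at[OF this has_vector_derivative_const] show ?thesis
    by (simp add: eq_neg_iff_add_eq_0 add.commute)
qed

text \<open>Product rule for \<rho> A times the adjoint of \<rho>; the second term gets its minus
  sign because \<open>gen X\<close> is anti-Hermitian.\<close>

lemma op_rep_has_vector_derivative:
  "((\<lambda>t. op_rep \<rho> (mat_exp (t *\<^sub>R X)) A) has_vector_derivative comm (gen X) A) (at 0)"
proof -
  have adj: "((\<lambda>t. mat_adj (\<rho> (mat_exp (t *\<^sub>R X)))) has_vector_derivative mat_adj (gen X)) (at 0)"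
    by (rule bounded_linear.has_vector_derivative[OF bounded_linear_mat_adj gen_has_vector_derivative])
  have "((\<lambda>t. \<rho> (mat_exp (t *\<^sub>R X)) ** A) has_vector_derivative (gen X ** A)) (at 0)"
    by (rule bounded_linear.has_vector_derivative[OF
          bounded_bilinear.bounded_linear_left[OF bounded_bilinear_matrix_mult] gen_has_vector_derivative])
  from has_vector_derivative_matrix_mult[OF this adj] show ?thesis
    by (simp add: op_rep_eq mat_exp_SU3 skew traceless mat_exp_0[of X, simplified] rho_mat_1
        comm_def mat_adj_gen matrix_mult_minus_right)
qed

lemma su3_deriv_op_rep: "su3_deriv (op_rep \<rho>) X A = comm (gen X) A"
  unfolding su3_deriv_def by (rule vector_derivative_at[OF op_rep_has_vector_derivative])

text \<open>Both sides are the derivative at 0 of one and the same curve,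
  \<open>op_rep \<rho> (mat_exp (t *\<^sub>R X)) (S A)\<close>.\<close>

lemma intertwiner_comm_gen:
  assumes "linear S" "\<And>g A. g \<in> SU3 \<Longrightarrow> S (op_rep \<rho> g A) = op_rep \<rho> g (S A)"
  shows "S (comm (gen X) A) = comm (gen X) (S A)"
proof -
  have "bounded_linear S" using assms(1) by (simp add: linear_conv_bounded_linear)
  from bounded_linear.has_vector_derivative[OF this op_rep_has_vector_derivative[of A]]
  have "((\<lambda>t. op_rep \<rho> (mat_exp (t *\<^sub>R X)) (S A)) has_vector_derivative S (comm (gen X) A)) (at 0)"
    by (simp add: assms(2) mat_exp_SU3 skew traceless)
  then show ?thesis using op_rep_has_vector_derivative by (rule vector_derivative_unique_at)
qed

end

text \<open>The two anti-Hermitian parts of a matrix, as in \<^const>\<open>sl3_deriv\<close>.\<close>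

definition skew_re :: "complex^3^3 \<Rightarrow> complex^3^3" where
  "skew_re Z = (1/2) *\<^sub>C (Z - mat_adj Z)"

definition skew_im :: "complex^3^3 \<Rightarrow> complex^3^3" where
  "skew_im Z = (1 / (2 * \<i>)) *\<^sub>C (Z + mat_adj Z)"

text \<open>The complexified differential, on the decomposition
  \<open>Z = skew_re Z + \<i> *\<^sub>C skew_im Z\<close>.\<close>

definition genC :: "complex^3^3 \<Rightarrow> complex^'d^'d" where
  "genC Z = gen (skew_re Z) + \<i> *\<^sub>C gen (skew_im Z)"

lemma skew_parts:
  assumes "trace Z = 0"
  shows "mat_adj (skew_re Z) = - skew_re Z" "trace (skew_re Z) = 0"
    "mat_adj (skew_im Z) = - skew_im Z" "trace (skew_im Z) = 0"
proof -
  show "trace (skew_re Z) = 0" "trace (skew_im Z) = 0"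
    unfolding skew_re_def skew_im_def trace_cscale trace_sub trace_add trace_mat_adj assms by simp_all
  show "mat_adj (skew_re Z) = - skew_re Z"
    by (simp add: skew_re_def vec_eq_iff field_simps)
  show "mat_adj (skew_im Z) = - skew_im Z"
    by (simp add: skew_im_def vec_eq_iff algebra_simps)
qed

lemma skew_parts_mat_adj: "skew_re (mat_adj Z) = - skew_re Z" "skew_im (mat_adj Z) = skew_im Z"
  by (simp_all add: skew_re_def skew_im_def add.commute cscale_diff_right)

lemma sl3_deriv_op_rep: "sl3_deriv (op_rep \<rho>) Z A = comm (genC Z) A" if "trace Z = 0"
  unfolding sl3_deriv_def genC_def skew_re_def[symmetric] skew_im_def[symmetric]
  by (simp add: su3_deriv_op_rep skew_parts[OF that] comm_add_left comm_cscale_left)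

text \<open>Passing to \<open>mat_adj Z\<close> flips the sign of \<open>skew_re\<close> and keeps
  \<open>skew_im\<close>, while \<open>gen\<close> is anti-Hermitian on both. Hence the raising
  operators are the adjoints of \<open>lowU\<close> and \<open>lowT\<close>.\<close>

lemma genC_mat_adj: "genC (mat_adj Z) = mat_adj (genC Z)" if "trace Z = 0"
  using mat_adj_gen[OF skew_parts(1,2)[OF that]] mat_adj_gen[OF skew_parts(3,4)[OF that]]
    gen_uminus[OF skew_parts(1,2)[OF that]]
  by (simp add: genC_def skew_parts_mat_adj mat_adj_add mat_adj_cscale
      cscale_minus_left cscale_minus_right)

lemma intertwiner_comm_genC:
  assumes add: "\<And>A B. S (A + B) = S A + S B" and scale: "\<And>a A. S (a *\<^sub>C A) = a *\<^sub>C S A"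
    and S: "\<And>g A. g \<in> SU3 \<Longrightarrow> S (op_rep \<rho> g A) = op_rep \<rho> g (S A)" and "trace Z = 0"
  shows "S (comm (genC Z) A) = comm (genC Z) (S A)"
proof -
  have lin: "linear S"
    by (rule linearI) (simp_all add: add scale cscale_of_real[symmetric])
  show ?thesis
    unfolding genC_def
    by (simp add: comm_add_left comm_cscale_left add scale
        intertwiner_comm_gen[OF skew_parts(1,2)[OF assms(4)] lin S]
        intertwiner_comm_gen[OF skew_parts(3,4)[OF assms(4)] lin S])
qed

text \<open>When Z and its adjoint both annihilate the vector of the base point, so do both
  anti-Hermitian parts; their one-parameter groups then lie in the isotropy group, and
  differentiating the constant orbit of K gives 0.\<close>

lemma isotropy_fixed_comm:
  assumes K: "\<And>h. h \<in> isotropy \<Longrightarrow> op_rep \<rho> h K = K" and tr: "trace Z = 0"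
    and Z: "Z *v axis 1 1 = 0" "mat_adj Z *v axis 1 1 = 0"
  shows "comm (genC Z) K = 0"
proof -
  have gen0: "comm (gen X) K = 0"
    if X: "mat_adj X = - X" "trace X = 0" "X *v axis 1 1 = 0" for X
  proof -
    have "((\<lambda>t. K) has_vector_derivative comm (gen X) K) (at 0)"
      using op_rep_has_vector_derivative[OF X(1,2), of K] by (simp add: K mat_exp_isotropy[OF X])
    then show ?thesis using has_vector_derivative_const by (rule vector_derivative_unique_at)
  qed
  have scale: "(c *\<^sub>C A) *v v = c *\<^sub>C (A *v v)" for c and A :: "complex^3^3" and v
    by (simp add: vec_eq_iff matrix_vector_mult_def sum_distrib_left mult.assoc)
  have e: "skew_re Z *v axis 1 1 = 0" "skew_im Z *v axis 1 1 = 0"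
    unfolding skew_re_def skew_im_def scale matrix_vector_mult_diff_rdistrib
      matrix_vector_mult_add_rdistrib Z by simp_all
  show ?thesis
    by (simp add: genC_def comm_add_left comm_cscale_left gen0 skew_parts[OF tr] e)
qed

definition "lowU = genC (mat_unit 3 2)"
definition "lowT = genC (mat_unit 2 1)"
text \<open>The sum is kept in two pieces because \<open>gt_basis\<close> states the eigenvalues of
  the two weight operators separately.\<close>

definition "weightH = genC ((1/2) *\<^sub>C (mat_unit 1 1 - mat_unit 2 2))
  + genC ((1/2) *\<^sub>C (mat_unit 2 2 - mat_unit 3 3))"

lemma mat_adj_mat_unit: "mat_adj (mat_unit i j) = mat_unit j i"
  by (simp add: vec_eq_iff mat_unit_def conj_commute)

lemma trace_mat_unit: "trace (mat_unit i j) = (if i = j then 1 else 0)"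
  using exhaust_3[of i] exhaust_3[of j] by (auto simp: trace_def mat_unit_def sum_3)

lemma U_minus_eq: "U_minus (op_rep \<rho>) A = comm lowU A"
  by (simp add: U_minus_def lowU_def sl3_deriv_op_rep trace_mat_unit)

lemma T_minus_eq: "T_minus (op_rep \<rho>) A = comm lowT A"
  by (simp add: T_minus_def lowT_def sl3_deriv_op_rep trace_mat_unit)

lemma T_U_three_eq: "T_three (op_rep \<rho>) A + U_three (op_rep \<rho>) A = comm weightH A"
  by (simp add: T_three_def U_three_def weightH_def sl3_deriv_op_rep trace_mat_unit trace_cscale
      trace_sub comm_add_left)

lemma mat_adj_weightH: "mat_adj weightH = weightH"
  by (simp add: weightH_def mat_adj_add genC_mat_adj[symmetric] trace_mat_unit trace_cscale trace_sub
      mat_adj_cscale mat_adj_diff mat_adj_mat_unit)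

lemma intertwiner_comm_weightH:
  assumes add: "\<And>A B. S (A + B) = S A + S B" and scale: "\<And>a A. S (a *\<^sub>C A) = a *\<^sub>C S A"
    and S: "\<And>g A. g \<in> SU3 \<Longrightarrow> S (op_rep \<rho> g A) = op_rep \<rho> g (S A)"
  shows "S (comm weightH A) = comm weightH (S A)"
  by (simp add: weightH_def comm_add_left add intertwiner_comm_genC[OF add scale S]
      trace_mat_unit trace_cscale trace_sub)

lemma isotropy_fixed_lowU:
  assumes "\<And>h. h \<in> isotropy \<Longrightarrow> op_rep \<rho> h K = K"
  shows "comm lowU K = 0" "comm (mat_adj lowU) K = 0"
proof -
  have e: "mat_unit 3 2 *v axis 1 1 = 0" "mat_unit 2 3 *v axis 1 1 = 0"
    by (simp_all add: vec_eq_iff forall_3 matrix_vector_mult_def mat_unit_def axis_def sum_3)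
  show "comm lowU K = 0"
    unfolding lowU_def
    by (rule isotropy_fixed_comm[OF assms]) (simp_all add: trace_mat_unit mat_adj_mat_unit e)
  show "comm (mat_adj lowU) K = 0"
    unfolding lowU_def genC_mat_adj[of "mat_unit 3 2", symmetric, simplified trace_mat_unit, simplified]
    by (rule isotropy_fixed_comm[OF assms]) (simp_all add: trace_mat_unit mat_adj_mat_unit e)
qed

end

section \<open>Gelfand-Tsetlin labels\<close>

declare gt_labels.simps [simp del] check_label.simps [simp del]

lemma finite_gt_labels: "finite (gt_labels a)"
proof (cases a)
  case (Pair p q)
  let ?f = "\<lambda>(rm, rp, n3). ((int p + 2 * int q - (rp + rm), rp + rm - n3, n3), real_of_int (rp - rm) / 2)"
  have "gt_labels (p, q) \<subseteq> ?f ` ({0..int q} \<times> {0..int p + int q} \<times> {0..int p + int q})"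
    by (force simp: gt_labels.simps)
  moreover have "finite (?f ` ({0..int q} \<times> {0..int p + int q} \<times> {0..int p + int q}))" by simp
  ultimately show ?thesis unfolding Pair by (rule finite_subset)
qed

text \<open>Labels of \<open>(n, n)\<close> in terms of \<open>a = r\<^sub>-\<close>, \<open>b = r\<^sub>+\<close> and \<open>c = \<nu>\<^sub>3\<close>.\<close>

definition gt_valid :: "nat \<Rightarrow> int \<Rightarrow> int \<Rightarrow> int \<Rightarrow> bool" where
  "gt_valid n a b c \<longleftrightarrow> 0 \<le> a \<and> a \<le> int n \<and> int n \<le> b \<and> b \<le> 2 * int n \<and> a \<le> c \<and> c \<le> b"

definition gt_lab :: "nat \<Rightarrow> int \<Rightarrow> int \<Rightarrow> int \<Rightarrow> gt_label" where
  "gt_lab n a b c = ((3 * int n - (b + a), b + a - c, c), real_of_int (b - a) / 2)"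

lemma gt_labels_eq: "gt_labels (n, n) = {gt_lab n a b c | a b c. gt_valid n a b c}"
  by (auto simp: gt_labels.simps gt_lab_def gt_valid_def)

lemma gt_labels_cases:
  assumes "l \<in> gt_labels (n, n)"
  obtains a b c where "l = gt_lab n a b c" "gt_valid n a b c"
  using assms unfolding gt_labels_eq by blast

lemma gt_lab_in: "gt_valid n a b c \<Longrightarrow> gt_lab n a b c \<in> gt_labels (n, n)"
  unfolding gt_labels_eq by blast

lemma gt_lab_eq_iff: "gt_lab n a b c = gt_lab n a' b' c' \<longleftrightarrow> a = a' \<and> b = b' \<and> c = c'"
  by (auto simp: gt_lab_def)

lemma gt_lab_middle: "((int n, int n, int n), 0) = gt_lab n (int n) (int n) (int n)"
  by (simp add: gt_lab_def)

lemma gt_valid_check: "gt_valid n (2 * int n - b) (2 * int n - a) (2 * int n - c) \<longleftrightarrow> gt_valid n a b c"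
  by (auto simp: gt_valid_def)

lemma check_label_gt_lab:
  "check_label (n, n) (gt_lab n a b c) = gt_lab n (2 * int n - b) (2 * int n - a) (2 * int n - c)"
  by (simp add: check_label.simps gt_lab_def Let_def)

lemma weight_gt_lab:
  "two_t (fst (gt_lab n a b c)) + two_u (fst (gt_lab n a b c)) = 3 * int n - (a + b) - c"
  by (simp add: gt_lab_def)

text \<open>With \<open>i = n - a\<close>, \<open>j = b - n\<close>, \<open>k = c - a\<close> the
  constraints become \<open>i, j \<le> n\<close> and \<open>k \<le> i + j\<close>. The count is the
  dimension of \<open>(n, n)\<close>, by which traces over a summand are divided.\<close>

lemma card_gt_labels: "card (gt_labels (n, n)) = (n + 1) ^ 3"
proof -
  let ?S = "SIGMA i : {..n}. SIGMA j : {..n}. {..i + j}"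
  let ?f = "\<lambda>(i, j, k). gt_lab n (int n - int i) (int n + int j) (int n - int i + int k)"
  have "inj_on ?f ?S" by (auto simp: inj_on_def gt_lab_eq_iff)
  then have "card (?f ` ?S) = card ?S" by (rule card_image)
  moreover have "?f ` ?S = gt_labels (n, n)"
  proof (intro equalityI subsetI)
    fix l assume "l \<in> gt_labels (n, n)"
    then obtain a b c where l: "l = gt_lab n a b c" "gt_valid n a b c" by (rule gt_labels_cases)
    then have "l = ?f (nat (int n - a), nat (b - int n), nat (c - a))" by (auto simp: gt_valid_def)
    moreover have "(nat (int n - a), nat (b - int n), nat (c - a)) \<in> ?S"
      using l(2) by (auto simp: gt_valid_def)
    ultimately show "l \<in> ?f ` ?S" by blast
  next
    fix l assume "l \<in> ?f ` ?S"
    then show "l \<in> gt_labels (n, n)" by (auto intro!: gt_lab_in simp: gt_valid_def)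
  qed
  moreover have "card ?S = (\<Sum>i\<le>n. \<Sum>j\<le>n. i + j + 1)"
    by (simp add: card_SigmaI)
  moreover have "(\<Sum>i\<le>n. \<Sum>j\<le>n. i + j + 1) = (n + 1) ^ 3"
  proof -
    \<comment> \<open>Doubling keeps both sums free of division in the naturals.\<close>
    have inner: "2 * (\<Sum>j\<le>m. i + j + 1) = (m + 1) * (2 * i + m + 2)" for i m :: nat
      by (induction m) (auto simp: algebra_simps)
    have outer: "(\<Sum>i\<le>k. 2 * i + m + 2) = (k + 1) * (k + m + 2)" for k m :: nat
      by (induction k) (auto simp: algebra_simps)
    have "2 * (\<Sum>i\<le>n. \<Sum>j\<le>n. i + j + 1) = (n + 1) * (\<Sum>i\<le>n. 2 * i + n + 2)"
      unfolding sum_distrib_left[of 2 _ "{..n}"] sum_distrib_left[of "n + 1"] inner ..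
    also have "\<dots> = 2 * (n + 1) ^ 3"
      unfolding outer by (simp add: power3_eq_cube algebra_simps)
    finally have "2 * (\<Sum>i\<le>n. \<Sum>j\<le>n. i + j + 1) = 2 * (n + 1) ^ 3" .
    then show ?thesis by simp
  qed
  ultimately show ?thesis by simp
qed

text \<open>This and the next two definitions are the matrix elements of the lowering operators on
  \<open>(n, n)\<close>, rewritten with \<open>J + u = b - c\<close>, \<open>J - u = c - a\<close>
  and \<open>2 J = b - a\<close>, so that their zeros are visible in integers.\<close>

definition coeff_u :: "int \<Rightarrow> int \<Rightarrow> int \<Rightarrow> real" where
  "coeff_u a b c = sqrt (real_of_int (b - c) * real_of_int (c - a + 1))"

definition coeff_down :: "nat \<Rightarrow> int \<Rightarrow> int \<Rightarrow> int \<Rightarrow> real" where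
  "coeff_down n a b c = sqrt (real_of_int (c - a) * real_of_int (2 * int n - a + 1)
     * real_of_int (int n - a) * real_of_int (a + 1) / (real_of_int (b - a) * real_of_int (b - a + 1)))"

definition coeff_up :: "nat \<Rightarrow> int \<Rightarrow> int \<Rightarrow> int \<Rightarrow> real" where
  "coeff_up n a b c = sqrt (real_of_int (b - c + 1) * real_of_int (2 * int n - b)
     * real_of_int (b + 1 - int n) * real_of_int (b + 2)
       / (real_of_int (b - a + 2) * real_of_int (b - a + 1)))"

lemma u_minus_coeff_gt_lab:
  "u_minus_coeff (3 * int n - (b + a), b + a - c, c) (real_of_int (b - a) / 2) = coeff_u a b c"
  unfolding u_minus_coeff_def coeff_u_def Let_def by (simp add: field_simps)

lemma t_minus_coeff_down_gt_lab:
  "t_minus_coeff_down (n, n) (3 * int n - (b + a), b + a - c, c) (real_of_int (b - a) / 2)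
    = coeff_down n a b c"
proof -
  let ?u = "real_of_int (two_u (3 * int n - (b + a), b + a - c, c)) / 2" and ?J = "real_of_int (b - a) / 2"
  have u: "?J - ?u = real_of_int (c - a)" by (simp add: field_simps)
  have e: "real n + real n + ?J - ?u - real_of_int c + 1 = real_of_int (2 * int n - a + 1)"
    "real n + ?J - ?u - real_of_int c = real_of_int (int n - a)"
    "?u - ?J + real_of_int c + 1 = real_of_int (a + 1)"
    "2 * ?J * (2 * ?J + 1) = real_of_int (b - a) * real_of_int (b - a + 1)"
    by (simp_all add: field_simps)
  show ?thesis unfolding t_minus_coeff_down.simps Let_def coeff_down_def e u by simp
qed

lemma t_minus_coeff_up_gt_lab:
  "t_minus_coeff_up (n, n) (3 * int n - (b + a), b + a - c, c) (real_of_int (b - a) / 2)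
    = coeff_up n a b c"
proof -
  let ?u = "real_of_int (two_u (3 * int n - (b + a), b + a - c, c)) / 2" and ?J = "real_of_int (b - a) / 2"
  have e: "?J + ?u + 1 = real_of_int (b - c + 1)"
    "real n + real n - ?J - ?u - real_of_int c = real_of_int (2 * int n - b)"
    "real_of_int (b - c + 1) + real_of_int c - real n = real_of_int (b + 1 - int n)"
    "?J + ?u + 2 + real_of_int c = real_of_int (b + 2)"
    "2 * (?J + 1) * (2 * ?J + 1) = real_of_int (b - a + 2) * real_of_int (b - a + 1)"
    by (simp_all add: field_simps)
  show ?thesis unfolding t_minus_coeff_up.simps Let_def coeff_up_def e by simp
qed

text \<open>Duality of labels reflects a to \<open>2 n - b\<close>, b to \<open>2 n - a\<close> and
  c to \<open>2 n - c\<close>, and exchanges the two kinds of \<open>lowT\<close> steps. The shift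
  by 1 appears because an adjoint operator carries the coefficient of the label at which it
  arrives.\<close>

lemma coeff_down_check:
  "coeff_down n (2 * int n - b - 1) (2 * int n - a) (2 * int n - c) = coeff_up n a b c"
proof -
  have e: "2 * int n - c - (2 * int n - b - 1) = b - c + 1"
    "2 * int n - (2 * int n - b - 1) + 1 = b + 2"
    "int n - (2 * int n - b - 1) = b + 1 - int n"
    "2 * int n - b - 1 + 1 = 2 * int n - b"
    "2 * int n - a - (2 * int n - b - 1) = b - a + 1" "b - a + 1 + 1 = b - a + 2" by simp_all
  show ?thesis unfolding coeff_down_def coeff_up_def e by (simp only: mult_ac)
qed

lemma coeff_up_check:
  "coeff_up n (2 * int n - b) (2 * int n - a - 1) (2 * int n - c) = coeff_down n a b c"
  using coeff_down_check[of n "2 * int n - a - 1" "2 * int n - b" "2 * int n - c"] by simp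

lemma coeff_u_check: "coeff_u (2 * int n - b) (2 * int n - a) (2 * int n - c - 1) = coeff_u a b c"
proof -
  have e: "2 * int n - a - (2 * int n - c - 1) = c - a + 1"
    "2 * int n - c - 1 - (2 * int n - b) + 1 = b - c" by simp_all
  show ?thesis unfolding coeff_u_def e by (simp only: mult_ac)
qed

section \<open>The coupled basis\<close>

context unitary_matrix_rep
begin

definition invariant_form :: "(complex^'d^'d \<Rightarrow> complex^'d^'d \<Rightarrow> complex) \<Rightarrow> bool" where
  "invariant_form F \<longleftrightarrow>
     (\<forall>A A' B. F (A + A') B = F A B + F A' B) \<and> (\<forall>A B B'. F A (B + B') = F A B + F A B')
   \<and> (\<forall>a A B. F (a *\<^sub>C A) B = cnj a * F A B) \<and> (\<forall>a A B. F A (a *\<^sub>C B) = a * F A B)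
   \<and> (\<forall>g\<in>SU3. \<forall>A B. F (op_rep \<rho> g A) (op_rep \<rho> g B) = F A B)"

lemma invariant_form_swap: "invariant_form F \<Longrightarrow> invariant_form (\<lambda>A B. cnj (F B A))"
  by (simp add: invariant_form_def)

end

text \<open>The decomposition whose existence \<open>coupled_basis\<close> asserts, with the
  summands \<open>V n\<close> made explicit.\<close>

locale coupled = unitary_matrix_rep \<rho> for \<rho> :: "complex^3^3 \<Rightarrow> complex^'d^'d" +
  fixes p :: nat and E :: "nat \<Rightarrow> gt_label \<Rightarrow> complex^'d^'d" and V :: "nat \<Rightarrow> (complex^'d^'d) set"
  assumes irreducible: "n \<le> p \<Longrightarrow> irreducible_rep (V n) (op_rep \<rho>)"
    and unitary_V: "n \<le> p \<Longrightarrow> unitary_rep (V n) (op_rep \<rho>)"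
    and gt_basis_E: "n \<le> p \<Longrightarrow> gt_basis (n, n) (V n) (op_rep \<rho>) (E n)"
    and orthogonal: "\<lbrakk>m \<le> p; n \<le> p; m \<noteq> n; A \<in> V m; B \<in> V n\<rbrakk> \<Longrightarrow> cinner A B = 0"
    and total: "\<exists>B. (\<forall>n\<le>p. B n \<in> V n) \<and> A = (\<Sum>n\<le>p. B n)"
begin

definition proj :: "nat \<Rightarrow> complex^'d^'d \<Rightarrow> complex^'d^'d" where
  "proj n A = (\<Sum>l\<in>gt_labels (n, n). cinner (E n l) A *\<^sub>C E n l)"

lemma csubspace_V: "n \<le> p \<Longrightarrow> csubspace (V n)"
  using unitary_V by (auto simp: unitary_rep_def)

lemma op_rep_V: "n \<le> p \<Longrightarrow> g \<in> SU3 \<Longrightarrow> A \<in> V n \<Longrightarrow> op_rep \<rho> g A \<in> V n"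
  using unitary_V by (auto simp: unitary_rep_def)

lemma E_in_V: "n \<le> p \<Longrightarrow> l \<in> gt_labels (n, n) \<Longrightarrow> E n l \<in> V n"
  using gt_basis_E[of n] by (simp only: gt_basis.simps)

lemma cinner_E:
  assumes "m \<le> p" "n \<le> p" "l \<in> gt_labels (m, m)" "l' \<in> gt_labels (n, n)"
  shows "cinner (E m l) (E n l') = (if m = n \<and> l = l' then 1 else 0)"
proof (cases "m = n")
  case True
  then show ?thesis using assms gt_basis_E[of n] by (simp only: gt_basis.simps) auto
qed (use assms orthogonal E_in_V in auto)

lemma proj_id: "n \<le> p \<Longrightarrow> A \<in> V n \<Longrightarrow> proj n A = A"
  unfolding proj_def using gt_basis_E[of n] by (simp only: gt_basis.simps)

lemma proj_in_V: "n \<le> p \<Longrightarrow> proj n A \<in> V n"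
  unfolding proj_def by (intro csubspaceD[OF csubspace_V] E_in_V)

lemma proj_other: "m \<le> p \<Longrightarrow> n \<le> p \<Longrightarrow> m \<noteq> n \<Longrightarrow> A \<in> V m \<Longrightarrow> proj n A = 0"
  unfolding proj_def using orthogonal E_in_V by (intro sum.neutral) (metis cscale_zero_left)

lemma proj_add: "proj n (A + B) = proj n A + proj n B"
  by (simp add: proj_def cinner_add_right cscale_add_left sum.distrib)

lemma proj_cscale: "proj n (a *\<^sub>C A) = a *\<^sub>C proj n A"
  by (simp add: proj_def cinner_cscale_right cscale_sum_right cscale_cscale)

lemma proj_zero [simp]: "proj n 0 = 0"
  by (simp add: proj_def)

lemma proj_sum: "proj n (\<Sum>i\<in>I. f i) = (\<Sum>i\<in>I. proj n (f i))"
  by (induction I rule: infinite_finite_induct) (auto simp: proj_add)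

lemma proj_unique:
  assumes "\<And>n. n \<le> p \<Longrightarrow> B n \<in> V n" "A = (\<Sum>n\<le>p. B n)" "n \<le> p"
  shows "proj n A = B n"
proof -
  have "proj n A = (\<Sum>m\<le>p. if m = n then B n else 0)"
    unfolding assms(2) proj_sum using assms(1,3)
    by (intro sum.cong refl) (auto intro: proj_id proj_other)
  then show ?thesis using assms(3) by simp
qed

lemma sum_proj: "(\<Sum>n\<le>p. proj n A) = A"
proof -
  obtain B where B: "\<And>n. n \<le> p \<Longrightarrow> B n \<in> V n" "A = (\<Sum>n\<le>p. B n)" using total by blast
  then have "proj n A = B n" if "n \<le> p" for n using proj_unique that by blast
  then show ?thesis using B(2) by simp
qed

lemma expansion: "A = (\<Sum>n\<le>p. \<Sum>l\<in>gt_labels (n, n). cinner (E n l) A *\<^sub>C E n l)"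
  using sum_proj[of A] by (simp add: proj_def)

lemma ext_E:
  assumes "\<And>n l. n \<le> p \<Longrightarrow> l \<in> gt_labels (n, n) \<Longrightarrow> cinner (E n l) A = cinner (E n l) B"
  shows "A = B"
  using expansion[of A] expansion[of B] assms by simp

lemma proj_op_rep: "proj n (op_rep \<rho> g A) = op_rep \<rho> g (proj n A)" if "n \<le> p" "g \<in> SU3"
proof (rule proj_unique)
  show "op_rep \<rho> g A = (\<Sum>n\<le>p. op_rep \<rho> g (proj n A))" by (simp add: op_rep_sum[symmetric] sum_proj)
qed (use that in \<open>auto intro: op_rep_V proj_in_V\<close>)

lemma cinner_proj_right: "cinner A (proj n B) = cinner A B" if "n \<le> p" "A \<in> V n"
proof -
  have "cinner A B = (\<Sum>m\<le>p. cinner A (proj m B))"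
    by (simp add: cinner_sum_right[symmetric] sum_proj)
  also have "\<dots> = (\<Sum>m\<le>p. if m = n then cinner A (proj n B) else 0)"
    using that orthogonal proj_in_V by (intro sum.cong refl) auto
  finally show ?thesis using that by simp
qed

lemma cinner_proj_swap: "cinner (proj n A) B = cinner A (proj n B)" if "n \<le> p"
  using cinner_proj_right[OF that proj_in_V[OF that], of A B] that
    cinner_proj_right[OF that proj_in_V[OF that], of B A] cinner_commute
  by metis

lemma E_nonzero: "n \<le> p \<Longrightarrow> l \<in> gt_labels (n, n) \<Longrightarrow> E n l \<noteq> 0"
  using cinner_E[of n n l l] by auto

lemma highest_in: "gt_lab n 0 (int n) 0 \<in> gt_labels (n, n)"
  by (rule gt_lab_in) (simp add: gt_valid_def)

text \<open>Irreducibility as an induction principle: the vectors of \<open>V n\<close> with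
  property Q form an invariant subspace, and the highest weight vector shows that it is not
  zero.\<close>

lemma irreducible_induct:
  assumes n: "n \<le> p" and add: "\<And>A B. Q A \<Longrightarrow> Q B \<Longrightarrow> Q (A + B)" and scale: "\<And>a A. Q A \<Longrightarrow> Q (a *\<^sub>C A)"
    and inv: "\<And>g A. g \<in> SU3 \<Longrightarrow> A \<in> V n \<Longrightarrow> Q A \<Longrightarrow> Q (op_rep \<rho> g A)"
    and hw: "Q (E n (gt_lab n 0 (int n) 0))" and A: "A \<in> V n"
  shows "Q A"
proof -
  let ?S = "{A \<in> V n. Q A}"
  note sub = csubspaceD[OF csubspace_V[OF n]]
  have "Q 0" using scale[OF hw, of 0] by simp
  then have "csubspace ?S" using add scale sub by (auto simp: csubspace_def)
  moreover have "\<forall>g\<in>SU3. op_rep \<rho> g ` ?S \<subseteq> ?S" using inv op_rep_V[OF n] by auto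
  ultimately have "?S = {0} \<or> ?S = V n"
    using irreducible[OF n] unfolding irreducible_rep_def by blast
  moreover have "E n (gt_lab n 0 (int n) 0) \<in> ?S" using hw E_in_V[OF n highest_in] by simp
  moreover have "E n (gt_lab n 0 (int n) 0) \<noteq> 0" using E_nonzero[OF n highest_in] .
  ultimately have "?S = V n" by blast
  then show ?thesis using A by blast
qed

text \<open>Extension by zero to all integer triples lets the lowering and raising relations be
  written without boundary cases.\<close>

definition Ez :: "nat \<Rightarrow> int \<Rightarrow> int \<Rightarrow> int \<Rightarrow> complex^'d^'d" where
  "Ez n a b c = (if gt_valid n a b c then E n (gt_lab n a b c) else 0)"

lemma cinner_Ez:
  assumes "m \<le> p" "n \<le> p"
  shows "cinner (Ez m a b c) (Ez n a' b' c')
    = (if m = n \<and> a = a' \<and> b = b' \<and> c = c' \<and> gt_valid n a b c then 1 else 0)"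
  using assms by (auto simp: Ez_def cinner_E gt_lab_in gt_lab_eq_iff)

lemma ext_Ez:
  assumes "\<And>n a b c. n \<le> p \<Longrightarrow> gt_valid n a b c \<Longrightarrow> cinner (Ez n a b c) A = cinner (Ez n a b c) B"
  shows "A = B"
proof (rule ext_E)
  fix n l assume n: "n \<le> p" and l: "l \<in> gt_labels (n, n)"
  from l obtain a b c where "l = gt_lab n a b c" "gt_valid n a b c" by (rule gt_labels_cases)
  then show "cinner (E n l) A = cinner (E n l) B" using assms[OF n, of a b c] by (simp add: Ez_def)
qed

lemma Ez_in_V: "n \<le> p \<Longrightarrow> Ez n a b c \<in> V n"
  by (auto simp: Ez_def intro: E_in_V gt_lab_in csubspaceD[OF csubspace_V])

lemma lowU_Ez:
  assumes n: "n \<le> p" and v: "gt_valid n a b c"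
  shows "comm lowU (Ez n a b c) = complex_of_real (coeff_u a b c) *\<^sub>C Ez n a b (c + 1)"
proof -
  have "comm lowU (E n (gt_lab n a b c))
      = complex_of_real (coeff_u a b c) *\<^sub>C E n (gt_lab n a b (c + 1))"
  proof -
    have "\<forall>n1 n2 n3 J. ((n1, n2, n3), J) \<in> gt_labels (n, n) \<longrightarrow> U_minus (op_rep \<rho>) (E n ((n1, n2, n3), J)) =
          complex_of_real (u_minus_coeff (n1, n2, n3) J) *\<^sub>C E n ((n1, n2 - 1, n3 + 1), J)"
      using gt_basis_E[OF n] by (simp only: gt_basis.simps) blast
    from this[rule_format, OF gt_lab_in[OF v, unfolded gt_lab_def]] show ?thesis
      unfolding u_minus_coeff_gt_lab U_minus_eq by (simp add: gt_lab_def diff_diff_eq)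
  qed
  \<comment> \<open>The step leaves the range only at \<open>c = b\<close>, where the factor
    \<open>b - c\<close> vanishes.\<close>
  moreover have "coeff_u a b c = 0" if "\<not> gt_valid n a b (c + 1)"
    using that v by (auto simp: gt_valid_def coeff_u_def)
  ultimately show ?thesis using v by (auto simp: Ez_def)
qed

lemma lowT_Ez:
  assumes n: "n \<le> p" and v: "gt_valid n a b c"
  shows "comm lowT (Ez n a b c) = complex_of_real (coeff_down n a b c) *\<^sub>C Ez n (a + 1) b c
    + complex_of_real (coeff_up n a b c) *\<^sub>C Ez n a (b + 1) c"
proof -
  have "comm lowT (E n (gt_lab n a b c))
      = complex_of_real (coeff_down n a b c) *\<^sub>C E n (gt_lab n (a + 1) b c)
      + complex_of_real (coeff_up n a b c) *\<^sub>C E n (gt_lab n a (b + 1) c)"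
  proof -
    have "\<forall>n1 n2 n3 J. ((n1, n2, n3), J) \<in> gt_labels (n, n) \<longrightarrow> T_minus (op_rep \<rho>) (E n ((n1, n2, n3), J)) =
          complex_of_real (t_minus_coeff_down (n, n) (n1, n2, n3) J)
            *\<^sub>C E n ((n1 - 1, n2 + 1, n3), J - 1/2)
        + complex_of_real (t_minus_coeff_up (n, n) (n1, n2, n3) J)
            *\<^sub>C E n ((n1 - 1, n2 + 1, n3), J + 1/2)"
      using gt_basis_E[OF n] by (simp only: gt_basis.simps) blast
    from this[rule_format, OF gt_lab_in[OF v, unfolded gt_lab_def]] 
    have "comm lowT (E n (gt_lab n a b c))
      = complex_of_real (coeff_down n a b c)
          *\<^sub>C E n ((3 * int n - (b + a) - 1, b + a - c + 1, c), real_of_int (b - a) / 2 - 1/2)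
      + complex_of_real (coeff_up n a b c)
          *\<^sub>C E n ((3 * int n - (b + a) - 1, b + a - c + 1, c), real_of_int (b - a) / 2 + 1/2)"
      unfolding t_minus_coeff_down_gt_lab t_minus_coeff_up_gt_lab T_minus_eq gt_lab_def .
    moreover have "((3 * int n - (b + a) - 1, b + a - c + 1, c), real_of_int (b - a) / 2 - 1/2)
        = gt_lab n (a + 1) b c"
      "((3 * int n - (b + a) - 1, b + a - c + 1, c), real_of_int (b - a) / 2 + 1/2)
        = gt_lab n a (b + 1) c"
      by (simp_all add: gt_lab_def field_simps)
    ultimately show ?thesis by simp
  qed
  \<comment> \<open>The range is left only at \<open>c = a\<close> or \<open>a = n\<close>, each a
    zero of the numerator. For \<open>a = b = n\<close> the denominator is also 0 and the quotient
    is 0 by convention.\<close>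
  moreover have "coeff_down n a b c = 0" if "\<not> gt_valid n (a + 1) b c"
  proof -
    have "c = a \<or> a = int n" using that v by (auto simp: gt_valid_def)
    then show ?thesis by (auto simp: coeff_down_def)
  qed
  moreover have "coeff_up n a b c = 0" if "\<not> gt_valid n a (b + 1) c"
  proof -
    have "b = 2 * int n" using that v by (auto simp: gt_valid_def)
    then show ?thesis by (simp add: coeff_up_def)
  qed
  ultimately show ?thesis using v by (auto simp: Ez_def)
qed

text \<open>Matrix elements of the adjoint are read off from those of \<open>lowU\<close>, since the
  vectors \<open>Ez\<close> are orthonormal and span.\<close>

lemma raiseU_Ez:
  assumes n: "n \<le> p" and v: "gt_valid n a b c"
  shows "comm (mat_adj lowU) (Ez n a b c) = complex_of_real (coeff_u a b (c - 1)) *\<^sub>C Ez n a b (c - 1)"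
proof (rule ext_Ez)
  fix m a' b' c' assume m: "m \<le> p" and v': "gt_valid m a' b' c'"
  show "cinner (Ez m a' b' c') (comm (mat_adj lowU) (Ez n a b c))
      = cinner (Ez m a' b' c') (complex_of_real (coeff_u a b (c - 1)) *\<^sub>C Ez n a b (c - 1))"
    unfolding cinner_comm_left[symmetric] lowU_Ez[OF m v'] cinner_cscale_left cinner_cscale_right
      cinner_Ez[OF m n]
    using v v' by auto
qed

lemma raiseT_Ez:
  assumes n: "n \<le> p" and v: "gt_valid n a b c"
  shows "comm (mat_adj lowT) (Ez n a b c) = complex_of_real (coeff_down n (a - 1) b c) *\<^sub>C Ez n (a - 1) b c
    + complex_of_real (coeff_up n a (b - 1) c) *\<^sub>C Ez n a (b - 1) c"
proof (rule ext_Ez)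
  fix m a' b' c' assume m: "m \<le> p" and v': "gt_valid m a' b' c'"
  show "cinner (Ez m a' b' c') (comm (mat_adj lowT) (Ez n a b c))
      = cinner (Ez m a' b' c') (complex_of_real (coeff_down n (a - 1) b c) *\<^sub>C Ez n (a - 1) b c
    + complex_of_real (coeff_up n a (b - 1) c) *\<^sub>C Ez n a (b - 1) c)"
    unfolding cinner_comm_left[symmetric] lowT_Ez[OF m v'] cinner_add_left cinner_add_right
      cinner_cscale_left cinner_cscale_right cinner_Ez[OF m n]
    using v v' by auto
qed

lemma weightH_Ez:
  assumes n: "n \<le> p"
  shows "comm weightH (Ez n a b c) = (of_int (3 * int n - (a + b) - c) / 2) *\<^sub>C Ez n a b c"
proof (cases "gt_valid n a b c")
  case True
  obtain \<nu> J where l: "gt_lab n a b c = (\<nu>, J)" by fastforce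
  have "(\<nu>, J) \<in> gt_labels (n, n)" using gt_lab_in[OF True] l by simp
  moreover have "\<forall>\<nu> J. (\<nu>, J) \<in> gt_labels (n, n) \<longrightarrow>
        T_three (op_rep \<rho>) (E n (\<nu>, J)) = (of_int (two_t \<nu>) / 2) *\<^sub>C E n (\<nu>, J)
      \<and> U_three (op_rep \<rho>) (E n (\<nu>, J)) = (of_int (two_u \<nu>) / 2) *\<^sub>C E n (\<nu>, J)"
    using gt_basis_E[OF n] by (simp only: gt_basis.simps) blast
  ultimately have TU: "T_three (op_rep \<rho>) (E n (\<nu>, J)) = (of_int (two_t \<nu>) / 2) *\<^sub>C E n (\<nu>, J)"
    "U_three (op_rep \<rho>) (E n (\<nu>, J)) = (of_int (two_u \<nu>) / 2) *\<^sub>C E n (\<nu>, J)" by blast+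
  have H: "comm weightH (E n (\<nu>, J)) = (of_int (two_t \<nu> + two_u \<nu>) / 2) *\<^sub>C E n (\<nu>, J)"
    unfolding T_U_three_eq[symmetric] TU by (simp add: cscale_add_left[symmetric] add_divide_distrib)
  have "two_t \<nu> + two_u \<nu> = 3 * int n - (a + b) - c" using weight_gt_lab[of n a b c] l by simp
  then show ?thesis using True H l unfolding Ez_def by (simp only: if_True)
qed (simp add: Ez_def)

text \<open>\<open>comm weightH\<close> is Hermitian. On \<open>(n, n)\<close> its eigenvalues lie
  between -n and n, and each of these two bounds is attained at exactly one label; the comparisons
  between summands rest on that.\<close>

lemma weight_orthogonal:
  assumes "n \<le> p" "comm weightH B = complex_of_real k *\<^sub>C B" "real_of_int (3 * int n - (a + b) - c) / 2 \<noteq> k"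
  shows "cinner (Ez n a b c) B = 0"
proof -
  have "cinner (comm weightH (Ez n a b c)) B = cinner (Ez n a b c) (comm weightH B)"
    by (simp add: cinner_comm_left mat_adj_weightH)
  then have "complex_of_real (real_of_int (3 * int n - (a + b) - c) / 2) * cinner (Ez n a b c) B
      = complex_of_real k * cinner (Ez n a b c) B"
    by (simp add: weightH_Ez assms(1,2) cinner_cscale_left cinner_cscale_right)
  then show ?thesis using assms(3) by (metis mult_cancel_right of_real_eq_iff)
qed

lemma highest_eq: "E n (gt_lab n 0 (int n) 0) = Ez n 0 (int n) 0"
  by (simp add: Ez_def gt_valid_def)

section \<open>Adjoints of the coupled basis\<close>

lemma proj_0_iff: "n \<le> p \<Longrightarrow> proj n A = 0 \<longleftrightarrow> (\<forall>a b c. gt_valid n a b c \<longrightarrow> cinner (Ez n a b c) A = 0)"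
proof
  assume n: "n \<le> p" and z: "proj n A = 0"
  show "\<forall>a b c. gt_valid n a b c \<longrightarrow> cinner (Ez n a b c) A = 0"
    using cinner_proj_right[OF n Ez_in_V[OF n], of _ _ _ A] z by simp
next
  assume n: "n \<le> p" and *: "\<forall>a b c. gt_valid n a b c \<longrightarrow> cinner (Ez n a b c) A = 0"
  show "proj n A = 0"
    unfolding proj_def
  proof (rule sum.neutral, rule ballI)
    fix l assume "l \<in> gt_labels (n, n)"
    then obtain a b c where "l = gt_lab n a b c" "gt_valid n a b c" by (rule gt_labels_cases)
    then show "cinner (E n l) A *\<^sub>C E n l = 0" using *[rule_format, of a b c] by (simp add: Ez_def)
  qed
qed

text \<open>The adjoint of the highest weight vector of \<open>(n, n)\<close> has weight -n, which
  is below every weight of \<open>(m, m)\<close> for \<open>m < n\<close>. Irreducibility extends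
  this to all of \<open>V n\<close>.\<close>

lemma proj_mat_adj_less:
  assumes "m < n" "n \<le> p" "A \<in> V n" shows "proj m (mat_adj A) = 0"
proof (rule irreducible_induct[OF assms(2) _ _ _ _ assms(3)])
  have m: "m \<le> p" using assms by simp
  show "proj m (mat_adj (E n (gt_lab n 0 (int n) 0))) = 0"
    unfolding proj_0_iff[OF m] highest_eq
  proof (intro allI impI)
    fix a b c assume v: "gt_valid m a b c"
    have "comm weightH (mat_adj (Ez n 0 (int n) 0))
        = - mat_adj (comm weightH (Ez n 0 (int n) 0))"
      by (simp add: mat_adj_comm mat_adj_weightH)
    also have "\<dots> = complex_of_real (- real n) *\<^sub>C mat_adj (Ez n 0 (int n) 0)"
      by (simp add: weightH_Ez assms(2) mat_adj_cscale cscale_minus_left)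
    finally show "cinner (Ez m a b c) (mat_adj (Ez n 0 (int n) 0)) = 0"
      by (rule weight_orthogonal[OF m]) (use v assms(1) in \<open>auto simp: gt_valid_def\<close>)
  qed
qed (use assms in \<open>auto simp: mat_adj_add proj_add mat_adj_cscale proj_cscale
      op_rep_mat_adj[symmetric] proj_op_rep\<close>)

text \<open>Components in smaller summands vanish by weights. For a larger summand m, moving the
  adjoint to the other side of the inner product gives the same situation with m and n
  exchanged.\<close>

lemma mat_adj_in_V: "n \<le> p \<Longrightarrow> A \<in> V n \<Longrightarrow> mat_adj A \<in> V n"
proof -
  assume n: "n \<le> p" and A: "A \<in> V n"
  have "proj m (mat_adj A) = 0" if m: "m \<le> p" "m \<noteq> n" for m
  proof (cases "m < n")
    case True
    then show ?thesis using proj_mat_adj_less n A by blast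
  next
    case False
    then have less: "n < m" using m by simp
    show ?thesis unfolding proj_0_iff[OF m(1)]
    proof (intro allI impI)
      fix a b c
      have "cinner (Ez m a b c) (mat_adj A) = cinner A (mat_adj (Ez m a b c))"
        using cinner_mat_adj[of "mat_adj (Ez m a b c)" A] by simp
      also have "\<dots> = cinner A (proj n (mat_adj (Ez m a b c)))"
        by (simp add: cinner_proj_right n A)
      finally show "cinner (Ez m a b c) (mat_adj A) = 0"
        by (simp add: proj_mat_adj_less[OF less m(1) Ez_in_V[OF m(1)]])
    qed
  qed
  then have "(\<Sum>m\<le>p. proj m (mat_adj A)) = (\<Sum>m\<le>p. if m = n then proj n (mat_adj A) else 0)"
    by (intro sum.cong) auto
  then have "mat_adj A = proj n (mat_adj A)" using n by (simp add: sum_proj)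
  then show ?thesis using proj_in_V[OF n] by metis
qed

lemma proj_mat_adj: "proj n (mat_adj A) = mat_adj (proj n A)" if "n \<le> p"
proof (rule proj_unique)
  show "mat_adj A = (\<Sum>n\<le>p. mat_adj (proj n A))" by (simp add: mat_adj_sum[symmetric] sum_proj)
qed (use that in \<open>auto intro: mat_adj_in_V proj_in_V\<close>)

text \<open>The lowering relations propagate from the highest weight entry: \<open>U\<^sub>-\<close> increases \<open>c\<close>; at \<open>c = a\<close> the first
  term of \<open>T\<^sub>-\<close> vanishes, which increases \<open>b\<close>; and once layer \<open>a\<close> is known, \<open>T\<^sub>-\<close> reaches layer \<open>a + 1\<close>.\<close>

lemma gt_recursion_zero:
  fixes D :: "int \<Rightarrow> int \<Rightarrow> int \<Rightarrow> complex^'d^'d"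
  assumes U: "\<And>a b c. gt_valid n a b c \<Longrightarrow>
      comm lowU (D a b c) = complex_of_real (coeff_u a b c) *\<^sub>C D a b (c + 1)"
    and T: "\<And>a b c. gt_valid n a b c \<Longrightarrow>
      comm lowT (D a b c) = complex_of_real (coeff_down n a b c) *\<^sub>C D (a + 1) b c
        + complex_of_real (coeff_up n a b c) *\<^sub>C D a (b + 1) c"
    and inv: "\<And>a b c. \<not> gt_valid n a b c \<Longrightarrow> D a b c = 0"
    and hw: "D 0 (int n) 0 = 0"
  shows "D a b c = 0"
proof -
  have stepU: "D a b c = 0" if "D a b a = 0" "gt_valid n a b c" for a b c
  proof -
    have "a \<le> c" using that(2) by (simp add: gt_valid_def)
    then show ?thesis using that(2)
    proof (induction c rule: int_ge_induct)
      case (step c)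
      then have v: "gt_valid n a b c" and lt: "c < b" "a \<le> c" by (auto simp: gt_valid_def)
      have "complex_of_real (coeff_u a b c) *\<^sub>C D a b (c + 1) = 0"
        using U[OF v] step.IH[OF v] by simp
      moreover have "coeff_u a b c \<noteq> 0" using lt by (simp add: coeff_u_def)
      ultimately show ?case by (simp add: cscale_eq_0_iff)
    qed (simp add: that(1))
  qed
  have stepb: "D a b a = 0" if "D a (int n) a = 0" "gt_valid n a b a" for a b
  proof -
    have "int n \<le> b" using that(2) by (simp add: gt_valid_def)
    then show ?thesis using that(2)
    proof (induction b rule: int_ge_induct)
      case (step b)
      then have v: "gt_valid n a b a" and lt: "a \<le> b" "int n \<le> b" "b < 2 * int n"
        by (auto simp: gt_valid_def)
      have "coeff_down n a b a = 0" by (simp add: coeff_down_def)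
      then have "complex_of_real (coeff_up n a b a) *\<^sub>C D a (b + 1) a = 0"
        using T[OF v] step.IH[OF v] by simp
      moreover have "coeff_up n a b a \<noteq> 0"
      proof -
        have "real_of_int (b - a + 1) \<noteq> 0" "real_of_int (2 * int n - b) \<noteq> 0"
          "real_of_int (b + 1 - int n) \<noteq> 0" "real_of_int (b + 2) \<noteq> 0" "real_of_int (b - a + 2) \<noteq> 0"
          using lt unfolding of_int_eq_0_iff by linarith+
        then show ?thesis unfolding coeff_up_def real_sqrt_eq_zero_cancel_iff divide_eq_0_iff mult_eq_0_iff
          by simp
      qed
      ultimately show ?case by (simp add: cscale_eq_0_iff)
    qed (simp add: that(1))
  qed
  have layer: "D a b c = 0" if "D a (int n) a = 0" for a b c
    using stepU[OF stepb[OF that]] inv by (cases "gt_valid n a b c") (auto simp: gt_valid_def)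
  have all: "D (int k) b c = 0" if "k \<le> n" for k b c
    using that
  proof (induction k arbitrary: b c)
    case 0
    show ?case using layer[of 0] hw by simp
  next
    case (Suc k)
    let ?a = "int k"
    \<comment> \<open>At \<open>c = a + 1\<close>, the least c for which the factor
      \<open>c - a\<close> does not vanish, the step lands on the corner of layer
      \<open>a + 1\<close> from which \<open>layer\<close> starts.\<close>
    have v: "gt_valid n ?a (int n) (?a + 1)" using Suc.prems by (auto simp: gt_valid_def)
    have z: "D ?a b c = 0" for b c using Suc by simp
    have "complex_of_real (coeff_down n ?a (int n) (?a + 1)) *\<^sub>C D (?a + 1) (int n) (?a + 1) = 0"
      using T[OF v] by (simp add: z)
    moreover have "coeff_down n ?a (int n) (?a + 1) \<noteq> 0"
    proof -
      have "real_of_int (?a + 1 - ?a) \<noteq> 0" "real_of_int (2 * int n - ?a + 1) \<noteq> 0"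
        "real_of_int (int n - ?a) \<noteq> 0" "real_of_int (?a + 1) \<noteq> 0" "real_of_int (int n - ?a + 1) \<noteq> 0"
        using Suc.prems unfolding of_int_eq_0_iff by linarith+
      then show ?thesis unfolding coeff_down_def real_sqrt_eq_zero_cancel_iff divide_eq_0_iff mult_eq_0_iff
        by simp
    qed
    ultimately have "D (?a + 1) (int n) (?a + 1) = 0" by (simp add: cscale_eq_0_iff)
    then show ?case using layer[of "?a + 1"] by (simp add: add.commute)
  qed
  show ?thesis
  proof (cases "gt_valid n a b c")
    case True
    then have "a = int (nat a)" "nat a \<le> n" by (auto simp: gt_valid_def)
    then show ?thesis using all by metis
  qed (rule inv)
qed

text \<open>The sign is forced: by \<open>adj_comm\<close> every lowering step on an adjoint costs a
  minus sign, and every such step raises \<open>a + b + c\<close> by one.\<close>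

lemma mat_adj_Ez:
  assumes n: "n \<le> p" and mid: "mat_adj (E n ((int n, int n, int n), 0)) = E n ((int n, int n, int n), 0)"
  shows "mat_adj (Ez n a b c) = ((- 1) powi (3 * int n - (a + b) - c))
    *\<^sub>C Ez n (2 * int n - b) (2 * int n - a) (2 * int n - c)"
proof -
  define s :: "int \<Rightarrow> int \<Rightarrow> int \<Rightarrow> complex" where "s a b c = (- 1) powi (3 * int n - (a + b) - c)" for a b c
  \<comment> \<open>The adjoints are indexed by the reflected label, so that raising an entry inside
    the adjoint becomes lowering in \<open>a\<close>, \<open>b\<close>, \<open>c\<close>.\<close>
  define F where "F a b c = s a b c *\<^sub>C mat_adj (Ez n (2 * int n - b) (2 * int n - a) (2 * int n - c))"
    for a b c
  have s_step: "s (a + 1) b c = - s a b c" "s a (b + 1) c = - s a b c" "s a b (c + 1) = - s a b c" for a b c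
  proof -
    have step: "(- 1 :: complex) powi (k - 1) = - ((- 1) powi k)" for k
      by (simp add: power_int_diff)
    have "3 * int n - (a + 1 + b) - c = 3 * int n - (a + b) - c - 1"
      "3 * int n - (a + (b + 1)) - c = 3 * int n - (a + b) - c - 1"
      "3 * int n - (a + b) - (c + 1) = 3 * int n - (a + b) - c - 1" by simp_all
    then show "s (a + 1) b c = - s a b c" "s a (b + 1) c = - s a b c" "s a b (c + 1) = - s a b c"
      unfolding s_def by (simp_all only: step)
  qed
  have adj_comm: "comm C (mat_adj A) = - mat_adj (comm (mat_adj C) A)" for C A :: "complex^'d^'d"
    by (simp add: mat_adj_comm)
  have F_U: "comm lowU (F a b c) = complex_of_real (coeff_u a b c) *\<^sub>C F a b (c + 1)"
    if v: "gt_valid n a b c" for a b c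
  proof -
    have e: "2 * int n - (c + 1) = 2 * int n - c - 1" by simp
    have "comm lowU (F a b c) = s a b c *\<^sub>C (- mat_adj (comm (mat_adj lowU)
        (Ez n (2 * int n - b) (2 * int n - a) (2 * int n - c))))"
      by (simp add: F_def comm_cscale_right adj_comm)
    also have "\<dots> = s a b c *\<^sub>C (- mat_adj (complex_of_real (coeff_u a b c)
        *\<^sub>C Ez n (2 * int n - b) (2 * int n - a) (2 * int n - c - 1)))"
      by (simp only: raiseU_Ez[OF n gt_valid_check[THEN iffD2, OF v]] coeff_u_check)
    also have "\<dots> = complex_of_real (coeff_u a b c) *\<^sub>C F a b (c + 1)"
      unfolding F_def s_step e
      by (simp add: mat_adj_cscale cscale_cscale cscale_minus_left cscale_minus_right mult.commute)
    finally show ?thesis .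
  qed
  have F_T: "comm lowT (F a b c) = complex_of_real (coeff_down n a b c) *\<^sub>C F (a + 1) b c
        + complex_of_real (coeff_up n a b c) *\<^sub>C F a (b + 1) c"
    if v: "gt_valid n a b c" for a b c
  proof -
    have e: "2 * int n - (a + 1) = 2 * int n - a - 1" "2 * int n - (b + 1) = 2 * int n - b - 1" by simp_all
    have "comm lowT (F a b c) = s a b c *\<^sub>C (- mat_adj (comm (mat_adj lowT)
        (Ez n (2 * int n - b) (2 * int n - a) (2 * int n - c))))"
      by (simp add: F_def comm_cscale_right adj_comm)
    also have "\<dots> = s a b c *\<^sub>C (- mat_adj (complex_of_real (coeff_up n a b c)
          *\<^sub>C Ez n (2 * int n - b - 1) (2 * int n - a) (2 * int n - c)
        + complex_of_real (coeff_down n a b c)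
          *\<^sub>C Ez n (2 * int n - b) (2 * int n - a - 1) (2 * int n - c)))"
      by (simp only: raiseT_Ez[OF n gt_valid_check[THEN iffD2, OF v]] coeff_down_check coeff_up_check)
    also have "\<dots> = complex_of_real (coeff_down n a b c) *\<^sub>C F (a + 1) b c
        + complex_of_real (coeff_up n a b c) *\<^sub>C F a (b + 1) c"
      unfolding F_def s_step e
      by (simp add: mat_adj_cscale mat_adj_add cscale_add_right cscale_cscale cscale_diff_right
          cscale_minus_left cscale_minus_right mult.commute)
    finally show ?thesis .
  qed
  have F_inv: "F a b c = 0" if "\<not> gt_valid n a b c" for a b c
    using that gt_valid_check[of n b a c] by (simp add: F_def Ez_def)
  have F_in: "F a b c \<in> V n" for a b c
    unfolding F_def by (intro csubspaceD[OF csubspace_V[OF n]] mat_adj_in_V[OF n] Ez_in_V[OF n])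
  define \<phi> where "\<phi> = cinner (Ez n 0 (int n) 0) (F 0 (int n) 0)"
  \<comment> \<open>The reflected label of the highest weight is the lowest one, of weight -n; its
    adjoint has weight n, which is simple in \<open>V n\<close>, so only the phase
    \<open>\<phi>\<close> is open.\<close>
  have F_hw: "F 0 (int n) 0 = \<phi> *\<^sub>C Ez n 0 (int n) 0"
  proof (rule ext_Ez)
    fix m a b c assume m: "m \<le> p" and v: "gt_valid m a b c"
    have H: "comm weightH (F 0 (int n) 0) = complex_of_real (real n) *\<^sub>C F 0 (int n) 0"
      by (simp add: F_def comm_cscale_right adj_comm mat_adj_weightH weightH_Ez[OF n] mat_adj_cscale
          cscale_cscale cscale_minus_left[symmetric] mult.commute)
    show "cinner (Ez m a b c) (F 0 (int n) 0) = cinner (Ez m a b c) (\<phi> *\<^sub>C Ez n 0 (int n) 0)"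
    proof (cases "m = n \<and> a = 0 \<and> b = int n \<and> c = 0")
      case True
      then show ?thesis using n by (simp add: \<phi>_def cinner_cscale_right cinner_Ez gt_valid_def)
    next
      case False
      have "cinner (Ez m a b c) (F 0 (int n) 0) = 0"
      proof (cases "m = n")
        case True
        show ?thesis
          by (rule weight_orthogonal[OF m H]) (use v False True in \<open>auto simp: gt_valid_def\<close>)
      next
        case False
        then show ?thesis using orthogonal[OF m n _ Ez_in_V[OF m] F_in] by blast
      qed
      then show ?thesis using False m n by (auto simp: cinner_cscale_right cinner_Ez)
    qed
  qed
  have "F a b c - \<phi> *\<^sub>C Ez n a b c = 0" for a b c
  proof (rule gt_recursion_zero[where D = "\<lambda>a b c. F a b c - \<phi> *\<^sub>C Ez n a b c" and n = n])
    show "comm lowU (F a b c - \<phi> *\<^sub>C Ez n a b c)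
        = complex_of_real (coeff_u a b c) *\<^sub>C (F a b (c + 1) - \<phi> *\<^sub>C Ez n a b (c + 1))"
      if "gt_valid n a b c" for a b c
      using that n by (simp add: comm_diff_right comm_cscale_right F_U lowU_Ez cscale_diff_right
          cscale_cscale mult.commute)
    show "comm lowT (F a b c - \<phi> *\<^sub>C Ez n a b c)
        = complex_of_real (coeff_down n a b c) *\<^sub>C (F (a + 1) b c - \<phi> *\<^sub>C Ez n (a + 1) b c)
        + complex_of_real (coeff_up n a b c) *\<^sub>C (F a (b + 1) c - \<phi> *\<^sub>C Ez n a (b + 1) c)"
      if "gt_valid n a b c" for a b c
      using that n by (simp add: comm_diff_right comm_cscale_right F_T lowT_Ez cscale_diff_right
          cscale_cscale cscale_add_right mult.commute)
  qed (simp_all add: F_inv F_hw Ez_def)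
  then have F_eq: "F a b c = \<phi> *\<^sub>C Ez n a b c" for a b c by simp
  \<comment> \<open>The middle label is its own reflection and its sign exponent is 0, so the
    assumed Hermiticity of this one vector determines \<open>\<phi>\<close>.\<close>
  have "Ez n (int n) (int n) (int n) = E n ((int n, int n, int n), 0)"
    by (simp add: Ez_def gt_valid_def gt_lab_middle)
  moreover have "F (int n) (int n) (int n) = mat_adj (Ez n (int n) (int n) (int n))"
    by (simp add: F_def s_def)
  ultimately have "Ez n (int n) (int n) (int n) = \<phi> *\<^sub>C Ez n (int n) (int n) (int n)"
    using F_eq mid by metis
  then have "cinner (Ez n (int n) (int n) (int n)) (Ez n (int n) (int n) (int n))
      = \<phi> * cinner (Ez n (int n) (int n) (int n)) (Ez n (int n) (int n) (int n))"
    by (metis cinner_cscale_right)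
  then have "\<phi> = 1" using n by (simp add: cinner_Ez gt_valid_def)
  have ss: "s (2 * int n - b) (2 * int n - a) (2 * int n - c) = s a b c" "s a b c * s a b c = 1"
  proof -
    have "3 * int n - (2 * int n - b + (2 * int n - a)) - (2 * int n - c) = - (3 * int n - (a + b) - c)"
      by simp
    then show "s (2 * int n - b) (2 * int n - a) (2 * int n - c) = s a b c"
      unfolding s_def by (metis power_int_minus_one_minus)
    show "s a b c * s a b c = 1"
      unfolding s_def by (simp add: power_int_mult_distrib[symmetric])
  qed
  have "s a b c *\<^sub>C mat_adj (Ez n a b c) = Ez n (2 * int n - b) (2 * int n - a) (2 * int n - c)"
    using F_eq[of "2 * int n - b" "2 * int n - a" "2 * int n - c"] \<open>\<phi> = 1\<close> ss(1) by (simp add: F_def)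
  then have "s a b c *\<^sub>C (s a b c *\<^sub>C mat_adj (Ez n a b c))
      = s a b c *\<^sub>C Ez n (2 * int n - b) (2 * int n - a) (2 * int n - c)" by simp
  then show ?thesis by (simp add: cscale_cscale ss(2) s_def)
qed

lemma mat_adj_E:
  assumes n: "n \<le> p" and mid: "mat_adj (E n ((int n, int n, int n), 0)) = E n ((int n, int n, int n), 0)"
    and l: "l \<in> gt_labels (n, n)"
  shows "mat_adj (E n l) = ((- 1) powi (two_t (fst l) + two_u (fst l))) *\<^sub>C E n (check_label (n, n) l)"
proof -
  from l obtain a b c where abc: "l = gt_lab n a b c" "gt_valid n a b c" by (rule gt_labels_cases)
  show ?thesis
    using mat_adj_Ez[OF n mid, of a b c] abc gt_valid_check[of n b a c]
    by (simp add: Ez_def abc(1) weight_gt_lab check_label_gt_lab)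
qed

section \<open>Schur's lemma for invariant sesquilinear forms\<close>

context
  fixes F assumes F: "invariant_form F"
begin

text \<open>The Riesz representative of the form. Invariance of F makes it an intertwiner, so that
  it commutes with \<open>comm weightH\<close>.\<close>

definition form_op :: "complex^'d^'d \<Rightarrow> complex^'d^'d" where
  "form_op B = (\<Sum>n\<le>p. \<Sum>l\<in>gt_labels (n, n). F (E n l) B *\<^sub>C E n l)"

lemma form_sum_left: "F (\<Sum>i\<in>I. f i) B = (\<Sum>i\<in>I. F (f i) B)"
proof -
  have "F 0 B = 0" using F cscale_zero_left[of 0] unfolding invariant_form_def by (metis complex_cnj_zero mult_zero_left)
  then show ?thesis
    using F by (induction I rule: infinite_finite_induct) (auto simp: invariant_form_def)
qed

lemma cinner_form_op: "cinner A (form_op B) = F A B"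
proof -
  have "F A B = F (\<Sum>n\<le>p. \<Sum>l\<in>gt_labels (n, n). cinner (E n l) A *\<^sub>C E n l) B"
    using expansion[of A] by simp
  also have "\<dots> = (\<Sum>n\<le>p. \<Sum>l\<in>gt_labels (n, n). cnj (cinner (E n l) A) * F (E n l) B)"
    using F by (simp add: form_sum_left invariant_form_def)
  also have "\<dots> = cinner A (form_op B)"
    by (simp add: form_op_def cinner_sum_right cinner_cscale_right cinner_commute[symmetric] mult.commute)
  finally show ?thesis by simp
qed

lemma form_op_linear: "form_op (A + B) = form_op A + form_op B" "form_op (a *\<^sub>C A) = a *\<^sub>C form_op A"
  using F by (simp_all add: form_op_def invariant_form_def cscale_add_left sum.distrib cscale_sum_right
      cscale_cscale)

lemma form_op_op_rep: "form_op (op_rep \<rho> g B) = op_rep \<rho> g (form_op B)" if g: "g \<in> SU3"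
proof (rule cinner_ext)
  fix A
  have "F A (op_rep \<rho> g B) = F (op_rep \<rho> g (op_rep \<rho> (mat_adj g) A)) (op_rep \<rho> g B)"
    by (simp add: op_rep_inverse[OF g])
  also have "\<dots> = F (op_rep \<rho> (mat_adj g) A) B" using F g by (simp add: invariant_form_def)
  finally show "cinner A (form_op (op_rep \<rho> g B)) = cinner A (op_rep \<rho> g (form_op B))"
    by (simp add: cinner_form_op cinner_op_rep[OF g])
qed

lemma weightH_form_op_highest:
  "n \<le> p \<Longrightarrow> comm weightH (form_op (Ez n 0 (int n) 0)) = complex_of_real (real n) *\<^sub>C form_op (Ez n 0 (int n) 0)"
  using intertwiner_comm_weightH[of form_op "Ez n 0 (int n) 0", OF form_op_linear form_op_op_rep]
  by (simp add: weightH_Ez form_op_linear)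

text \<open>\<open>form_op\<close> preserves the weight n of the highest vector of
  \<open>(n, n)\<close>, and weight n does not occur in \<open>(m, m)\<close> for
  \<open>m < n\<close>.\<close>

lemma form_less:
  assumes "m < n" "n \<le> p" "A \<in> V m" "B \<in> V n" shows "F A B = 0"
proof -
  have m: "m \<le> p" using assms by simp
  have "proj m (form_op B) = 0"
  proof (rule irreducible_induct[OF assms(2) _ _ _ _ assms(4)])
    show "proj m (form_op (E n (gt_lab n 0 (int n) 0))) = 0"
      unfolding proj_0_iff[OF m] highest_eq
      by (intro allI impI weight_orthogonal[OF m weightH_form_op_highest[OF assms(2)]])
         (use assms(1) in \<open>auto simp: gt_valid_def\<close>)
  qed (use m in \<open>auto simp: form_op_linear form_op_op_rep proj_add proj_cscale proj_op_rep\<close>)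
  then show ?thesis using cinner_proj_right[OF m assms(3), of "form_op B"] by (simp add: cinner_form_op)
qed

text \<open>Simplicity of the top weight replaces the usual choice of an eigenvalue: the compressed
  operator must scale the highest weight vector, and irreducibility spreads the same scalar over
  \<open>V n\<close>.\<close>

lemma form_scalar: "\<exists>c. \<forall>A\<in>V n. \<forall>B\<in>V n. F A B = c * cinner A B" if n: "n \<le> p"
proof -
  define c where "c = cinner (Ez n 0 (int n) 0) (form_op (Ez n 0 (int n) 0))"
  have "proj n (form_op B) = c *\<^sub>C B" if B: "B \<in> V n" for B
  proof (rule irreducible_induct[OF n _ _ _ _ B])
    show "proj n (form_op (E n (gt_lab n 0 (int n) 0))) = c *\<^sub>C E n (gt_lab n 0 (int n) 0)"
      unfolding highest_eq
    proof (rule ext_Ez)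
      fix m a b d assume m: "m \<le> p" and v: "gt_valid m a b d"
      show "cinner (Ez m a b d) (proj n (form_op (Ez n 0 (int n) 0)))
          = cinner (Ez m a b d) (c *\<^sub>C Ez n 0 (int n) 0)"
      proof (cases "m = n")
        case True
        show ?thesis
        proof (cases "a = 0 \<and> b = int n \<and> d = 0")
          case True
          then show ?thesis using n \<open>m = n\<close>
            by (simp add: c_def cinner_proj_right Ez_in_V cinner_cscale_right cinner_Ez gt_valid_def)
        next
          case False
          then have "cinner (Ez n a b d) (form_op (Ez n 0 (int n) 0)) = 0"
            by (intro weight_orthogonal[OF n weightH_form_op_highest[OF n]])
               (use v True in \<open>auto simp: gt_valid_def\<close>)
          then show ?thesis using False n True
            by (auto simp: cinner_proj_right Ez_in_V cinner_cscale_right cinner_Ez)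
        qed
      next
        case False
        then show ?thesis using m n orthogonal[OF m n False Ez_in_V[OF m] proj_in_V[OF n]]
          by (auto simp: cinner_cscale_right cinner_Ez)
      qed
    qed
  qed (use n in \<open>auto simp: form_op_linear form_op_op_rep proj_add proj_cscale proj_op_rep op_rep_cscale
         cscale_add_right cscale_cscale mult.commute\<close>)
  then have "F A B = c * cinner A B" if "A \<in> V n" "B \<in> V n" for A B
    using that cinner_proj_right[OF n, of A "form_op B"] by (simp add: cinner_form_op cinner_cscale_right)
  then show ?thesis by blast
qed

end

text \<open>Off-diagonal blocks vanish by \<open>form_less\<close>, applied to F or to its conjugate
  transpose. On a diagonal block the scalar equals the trace of the block divided by the dimension,
  which makes it accessible without knowing any single value of F.\<close>

lemma invariant_form_eq:
  assumes F: "invariant_form F"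
  shows "F A B = (\<Sum>n\<le>p. (\<Sum>l\<in>gt_labels (n, n). F (E n l) (E n l)) / of_nat ((n + 1) ^ 3)
    * cinner A (proj n B))"
proof -
  have orth: "F A B = 0" if "m \<le> p" "n \<le> p" "m \<noteq> n" "A \<in> V m" "B \<in> V n" for m n A B
  proof (cases "m < n")
    case True
    then show ?thesis using form_less[OF F] that by blast
  next
    case False
    then have "cnj (F A B) = 0" using form_less[OF invariant_form_swap[OF F], of n m B A] that by simp
    then show ?thesis by simp
  qed
  have "F A B = (\<Sum>n\<le>p. F (proj n A) B)"
    using form_sum_left[OF F, of "\<lambda>n. proj n A" "{..p}" B] by (simp add: sum_proj)
  also have "\<dots> = (\<Sum>n\<le>p. F (proj n A) (proj n B))"
  proof (intro sum.cong refl)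
    fix n assume "n \<in> {..p}" then have n: "n \<le> p" by simp
    have "cnj (F (proj n A) B) = (\<Sum>m\<le>p. cnj (F (proj n A) (proj m B)))"
      using form_sum_left[OF invariant_form_swap[OF F], where f = "\<lambda>n. proj n B" and I = "{..p}" and B = "proj n A"]
      by (simp add: sum_proj)
    also have "\<dots> = (\<Sum>m\<le>p. if m = n then cnj (F (proj n A) (proj n B)) else 0)"
      using n by (intro sum.cong refl) (auto simp: orth proj_in_V)
    finally show "F (proj n A) B = F (proj n A) (proj n B)" using n by simp
  qed
  also have "\<dots> = (\<Sum>n\<le>p. (\<Sum>l\<in>gt_labels (n, n). F (E n l) (E n l)) / of_nat ((n + 1) ^ 3)
    * cinner A (proj n B))"
  proof (intro sum.cong refl)
    fix n assume "n \<in> {..p}" then have n: "n \<le> p" by simp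
    obtain c where c: "\<And>A B. A \<in> V n \<Longrightarrow> B \<in> V n \<Longrightarrow> F A B = c * cinner A B"
      using form_scalar[OF F n] by blast
    have "(\<Sum>l\<in>gt_labels (n, n). F (E n l) (E n l)) = (\<Sum>l\<in>gt_labels (n, n). c)"
      using n by (intro sum.cong refl) (simp add: c E_in_V cinner_E)
    moreover have "of_nat ((n + 1) ^ 3) \<noteq> (0 :: complex)" unfolding of_nat_eq_0_iff by simp
    ultimately have "(\<Sum>l\<in>gt_labels (n, n). F (E n l) (E n l)) / of_nat ((n + 1) ^ 3) = c"
      unfolding sum_constant card_gt_labels by (metis nonzero_mult_div_cancel_left)
    moreover have "F (proj n A) (proj n B) = c * cinner A (proj n B)"
      using n by (simp add: c proj_in_V cinner_proj_swap proj_id)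
    ultimately show "F (proj n A) (proj n B)
        = (\<Sum>l\<in>gt_labels (n, n). F (E n l) (E n l)) / of_nat ((n + 1) ^ 3) * cinner A (proj n B)" by simp
  qed
  finally show ?thesis .
qed

section \<open>Operators fixed by the isotropy group\<close>

text \<open>A basis vector with \<open>c < b\<close> is a nonzero multiple of an image under the
  adjoint of \<open>lowU\<close>, and one with \<open>a < c\<close> of an image under
  \<open>lowU\<close>; both are orthogonal to K. What remains is \<open>a = b = c\<close>, and
  \<open>a \<le> n \<le> b\<close> makes the common value n.\<close>

lemma isotropy_fixed_proj:
  assumes K: "\<And>h. h \<in> isotropy \<Longrightarrow> op_rep \<rho> h K = K" and n: "n \<le> p"
  shows "proj n K = cinner (E n ((int n, int n, int n), 0)) K *\<^sub>C E n ((int n, int n, int n), 0)"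
proof -
  let ?l = "gt_lab n (int n) (int n) (int n)"
  have low: "comm lowU K = 0" "comm (mat_adj lowU) K = 0" using isotropy_fixed_lowU[OF K] by auto
  have zero: "cinner (E n l) K = 0" if l: "l \<in> gt_labels (n, n)" "l \<noteq> ?l" for l
  proof -
    from l(1) obtain a b c where abc: "l = gt_lab n a b c" and v: "gt_valid n a b c" by (rule gt_labels_cases)
    have "a < c \<or> c < b" using l(2) v abc by (auto simp: gt_valid_def gt_lab_eq_iff)
    then show ?thesis
    proof
      assume lt: "c < b"
      have v1: "gt_valid n a b (c + 1)" using lt v by (auto simp: gt_valid_def)
      have "0 = cinner (comm (mat_adj lowU) (Ez n a b (c + 1))) K"
        by (simp add: cinner_comm_left low)
      then have "complex_of_real (coeff_u a b c) * cinner (Ez n a b c) K = 0"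
        by (simp add: raiseU_Ez[OF n v1] cinner_cscale_left)
      moreover have "coeff_u a b c \<noteq> 0" using lt v by (simp add: coeff_u_def gt_valid_def)
      ultimately show ?thesis using v by (simp add: Ez_def abc)
    next
      assume lt: "a < c"
      have v1: "gt_valid n a b (c - 1)" using lt v by (auto simp: gt_valid_def)
      have "0 = cinner (comm lowU (Ez n a b (c - 1))) K"
        by (simp add: cinner_comm_left low)
      then have "complex_of_real (coeff_u a b (c - 1)) * cinner (Ez n a b c) K = 0"
        by (simp add: lowU_Ez[OF n v1] cinner_cscale_left)
      moreover have "coeff_u a b (c - 1) \<noteq> 0" using lt v by (simp add: coeff_u_def gt_valid_def)
      ultimately show ?thesis using v by (simp add: Ez_def abc)
    qed
  qed
  have "?l \<in> gt_labels (n, n)" by (rule gt_lab_in) (simp add: gt_valid_def)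
  then have "proj n K = (\<Sum>l\<in>gt_labels (n, n). if l = ?l then cinner (E n ?l) K *\<^sub>C E n ?l else 0)"
    unfolding proj_def by (intro sum.cong refl) (auto simp: zero)
  also have "\<dots> = cinner (E n ?l) K *\<^sub>C E n ?l"
    using \<open>?l \<in> _\<close> by (simp add: finite_gt_labels)
  finally show ?thesis by (simp add: gt_lab_middle)
qed

end

section \<open>Symbol correspondences and operator kernels\<close>

lemma trace_mult_hermitian: "trace (A ** B) = cinner B A" if "mat_adj B = B" for A B :: "complex^'d^'d"
  unfolding cinner_matrix that by (rule trace_mul_sym)

context unitary_matrix_rep
begin

lemma kernel_at_unitary:
  "mat_adj (kernel_at \<rho> K x) = kernel_at \<rho> (mat_adj K) x"
  "cinner (kernel_at \<rho> K x) (kernel_at \<rho> L x) = cinner K L"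
  by (simp_all add: kernel_at_def op_rep_mat_adj coset_rep cinner_op_rep_op_rep)

lemma kernel_at_inject: "kernel_at \<rho> K x = kernel_at \<rho> L x \<Longrightarrow> K = L"
  using op_rep_inverse(1)[OF coset_rep(1), of x] unfolding kernel_at_def by metis

lemma norm_kernel_at: "norm (kernel_at \<rho> K x) = norm K"
proof -
  have "complex_of_real ((norm (kernel_at \<rho> K x))\<^sup>2) = complex_of_real ((norm K)\<^sup>2)"
    using kernel_at_unitary(2)[of K x K] by (simp add: cinner_self)
  then have "(norm (kernel_at \<rho> K x))\<^sup>2 = (norm K)\<^sup>2" by (simp only: of_real_eq_iff)
  then show ?thesis by simp
qed

lemma operator_kernel_unique:
  assumes "is_operator_kernel \<rho> W K" "is_operator_kernel \<rho> W L" shows "K = L"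
proof (rule kernel_at_inject, rule trace_mult_ext)
  fix A show "trace (A ** kernel_at \<rho> K cp2_base) = trace (A ** kernel_at \<rho> L cp2_base)"
    using assms by (simp add: is_operator_kernel_def)
qed

lemma operator_kernel_eq: "is_operator_kernel \<rho> W K \<Longrightarrow> operator_kernel \<rho> W = K"
  unfolding operator_kernel_def by (blast intro: operator_kernel_unique)

context
  fixes a M W assumes sc: "symbol_correspondence a \<rho> M W"
begin

lemma symbol_add: "W (A + B) x = W A x + W B x"
  and symbol_cscale: "W (c *\<^sub>C A) x = c * W A x"
  and symbol_op_rep: "g \<in> SU3 \<Longrightarrow> W (op_rep \<rho> g A) x = W A (cp2_act (matrix_inv g) x)"
  and symbol_mat_adj: "W (mat_adj A) x = cnj (W A x)"
  and symbol_smooth: "cp2_smooth (W A)"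
  and symbol_inj: "inj W"
  and symbol_integral: "(LINT x|M. W A x) = trace A / of_nat (irrep_dim a)"
  using sc unfolding symbol_correspondence_def by blast+

lemma symbol_sum: "W (\<Sum>i\<in>I. f i) x = (\<Sum>i\<in>I. W (f i) x)"
proof -
  have "W 0 x = 0" using symbol_cscale[of 0 0] by simp
  then show ?thesis by (induction I rule: infinite_finite_induct) (auto simp: symbol_add)
qed

text \<open>Evaluation at the base point is a linear functional and hence a trace against some K.
  Equivariance transports this to every point, and for isotropy elements it says that K is
  fixed.\<close>

lemma exists_operator_kernel: "\<exists>K. is_operator_kernel \<rho> W K"
proof -
  define U where "U i j = ((\<chi> k l. if k = i \<and> l = j then 1 else 0) :: complex^'d^'d)" for i j
  \<comment> \<open>The indices are transposed because the trace of \<open>A ** K\<close> pairs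
    \<open>A $ i $ j\<close> with \<open>K $ j $ i\<close>.\<close>
  define K where "K = (\<chi> j i. W (U i j) cp2_base)"
  have base: "trace (A ** K) = W A cp2_base" for A
  proof -
    have "A = (\<Sum>i\<in>UNIV. \<Sum>j\<in>UNIV. (A $ i $ j) *\<^sub>C U i j)"
    proof -
      have "(\<Sum>i\<in>UNIV. \<Sum>j\<in>UNIV. (A $ i $ j) *\<^sub>C U i j) $ k $ l = A $ k $ l" for k l
      proof -
        have "(\<Sum>j\<in>UNIV. A $ i $ j * U i j $ k $ l) = (if i = k then A $ k $ l else 0)" for i
        proof -
          have "(\<Sum>j\<in>UNIV. A $ i $ j * U i j $ k $ l)
              = (\<Sum>j\<in>UNIV. if j = l then (if i = k then A $ k $ l else 0) else 0)"
            by (intro sum.cong) (auto simp: U_def)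
          then show ?thesis by simp
        qed
        then show ?thesis by simp
      qed
      then show ?thesis by (simp add: vec_eq_iff)
    qed
    then have "W A cp2_base = (\<Sum>i\<in>UNIV. \<Sum>j\<in>UNIV. A $ i $ j * W (U i j) cp2_base)"
      by (metis (no_types, lifting) sum.cong symbol_cscale symbol_sum)
    also have "\<dots> = trace (A ** K)" by (simp add: trace_def matrix_matrix_mult_def K_def)
    finally show ?thesis by simp
  qed
  have "op_rep \<rho> h K = K" if h: "h \<in> isotropy" for h
  proof (rule trace_mult_ext)
    fix A
    from h have h': "h \<in> SU3" "cp2_act h cp2_base = cp2_base" by (auto simp: isotropy_def)
    have "trace (A ** op_rep \<rho> h K) = W (op_rep \<rho> (mat_adj h) A) cp2_base"
      by (simp add: trace_mult_op_rep[OF h'(1)] base)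
    also have "\<dots> = W A cp2_base"
      using h' SU3_D(3)[OF SU3_mat_adj[OF h'(1)]] by (simp add: symbol_op_rep SU3_mat_adj)
    finally show "trace (A ** op_rep \<rho> h K) = trace (A ** K)" by (simp add: base)
  qed
  moreover have "W A x = trace (A ** kernel_at \<rho> K x)" for A x
  proof -
    let ?g = "coset_rep x"
    have "trace (A ** kernel_at \<rho> K x) = W (op_rep \<rho> (mat_adj ?g) A) cp2_base"
      by (simp add: kernel_at_def trace_mult_op_rep coset_rep base)
    also have "\<dots> = W A x"
      using SU3_D(3)[OF SU3_mat_adj[OF coset_rep(1)[of x]]]
      by (simp add: symbol_op_rep SU3_mat_adj coset_rep)
    finally show ?thesis by simp
  qed
  ultimately show ?thesis unfolding is_operator_kernel_def by blast
qed

context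
  fixes K assumes K: "is_operator_kernel \<rho> W K"
begin

text \<open>The reality condition on W, read through the nondegenerate trace pairing.\<close>

lemma mat_adj_operator_kernel: "mat_adj K = K"
proof (rule kernel_at_inject[of _ cp2_base], rule trace_mult_ext)
  fix A
  let ?K = "kernel_at \<rho> K cp2_base"
  have "trace (A ** mat_adj ?K) = cnj (trace (mat_adj A ** ?K))"
    by (metis mat_adj_adj mat_adj_mult trace_mat_adj trace_mul_sym)
  also have "\<dots> = trace (A ** ?K)"
    using symbol_mat_adj[of "mat_adj A" cp2_base] K by (simp add: is_operator_kernel_def)
  finally show "trace (A ** kernel_at \<rho> (mat_adj K) cp2_base) = trace (A ** ?K)"
    by (simp add: kernel_at_unitary)
qed

lemma symbol_eq_cinner: "W A x = cinner (kernel_at \<rho> K x) A"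
  using K trace_mult_hermitian[of "kernel_at \<rho> K x" A]
  by (simp add: is_operator_kernel_def kernel_at_unitary mat_adj_operator_kernel)

end

text \<open>All \<open>kernel_at \<rho> K x\<close> have the norm of K, by unitarity. Together with
  measurability this gives integrability of products of symbols on a probability space.\<close>

lemma symbol_bounded: "\<exists>C. \<forall>x. norm (W A x) \<le> C"
proof -
  obtain K where K: "is_operator_kernel \<rho> W K" using exists_operator_kernel by blast
  have "linear (\<lambda>B. cinner B A)"
    by (rule linearI) (simp_all add: cinner_add_left cscale_of_real[symmetric] cinner_cscale_left
        cscale_complex_def)
  then have "bounded_linear (\<lambda>B. cinner B A)" by (simp add: linear_conv_bounded_linear)
  then obtain C where "\<And>B. norm (cinner B A) \<le> norm B * C"
    using bounded_linear.bounded by blast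
  then have "norm (W A x) \<le> norm K * C" for x
    using symbol_eq_cinner[OF K] norm_kernel_at by metis
  then show ?thesis by blast
qed

end

lemma symbol_product_integrable:
  assumes W: "symbol_correspondence a \<rho> M W" and W': "symbol_correspondence a \<rho> M W'"
    and M: "invariant_prob M"
  shows "integrable M (\<lambda>x. cnj (W' A x) * W B x)"
proof -
  interpret prob_space M using M by (simp add: invariant_prob_def)
  have sets: "sets M = sets borel" using M by (simp add: invariant_prob_def)
  have meas: "S A \<in> borel_measurable M" if "symbol_correspondence a \<rho> M S" for S A
    using borel_measurable_continuous_onI[OF cp2_smooth_imp_continuous[OF symbol_smooth[OF that]]] sets
    by (simp cong: measurable_cong_sets)
  obtain C C' where C: "\<And>x. norm (W B x) \<le> C" "\<And>x. norm (W' A x) \<le> C'"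
    using symbol_bounded[OF W, of B] symbol_bounded[OF W', of A] by blast
  show ?thesis
  proof (rule integrable_const_bound)
    show "AE x in M. norm (cnj (W' A x) * W B x) \<le> C' * C"
    proof (rule AE_I2)
      fix x
      have "0 \<le> C'" using C(2)[of x] norm_ge_zero[of "W' A x"] by linarith
      then show "norm (cnj (W' A x) * W B x) \<le> C' * C"
        using mult_mono[OF C(2)[of x] C(1)[of x]] by (simp add: norm_mult)
    qed
    show "(\<lambda>x. cnj (W' A x) * W B x) \<in> borel_measurable M"
      unfolding symbol_mat_adj[OF W', symmetric] by (intro borel_measurable_times meas[OF W] meas[OF W'])
  qed
qed

text \<open>Equivariance moves the group element into the argument of the symbols, and the
  invariance of M removes it; integrability is what makes the form additive.\<close>

lemma invariant_form_integral:
  assumes W: "symbol_correspondence a \<rho> M W" and W': "symbol_correspondence a \<rho> M W'"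
    and M: "invariant_prob M"
  shows "invariant_form (\<lambda>A B. LINT x|M. cnj (W' A x) * W B x)"
proof -
  have sets: "sets M = sets borel" using M by (simp add: invariant_prob_def)
  note int = symbol_product_integrable[OF W W' M]
  have inv: "(LINT x|M. cnj (W' (op_rep \<rho> g A) x) * W (op_rep \<rho> g B) x) = (LINT x|M. cnj (W' A x) * W B x)"
    if g: "g \<in> SU3" for g A B
  proof -
    let ?g = "matrix_inv g"
    have g': "?g \<in> SU3" using SU3_D(3)[OF g] SU3_mat_adj[OF g] by simp
    have "(LINT x|M. cnj (W' (op_rep \<rho> g A) x) * W (op_rep \<rho> g B) x)
        = (LINT x|M. (\<lambda>x. cnj (W' A x) * W B x) (cp2_act ?g x))"
      by (simp add: symbol_op_rep[OF W g] symbol_op_rep[OF W' g])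
    also have "\<dots> = (LINT x|distr M M (cp2_act ?g). cnj (W' A x) * W B x)"
      by (rule integral_distr[symmetric])
         (use measurable_cp2_act[OF sets g'] int in \<open>auto dest: borel_measurable_integrable\<close>)
    also have "distr M M (cp2_act ?g) = M" using M g' by (simp add: invariant_prob_def)
    finally show ?thesis .
  qed
  show ?thesis
    unfolding invariant_form_def
    by (intro conjI allI ballI inv)
       (simp_all add: symbol_add[OF W] symbol_add[OF W'] symbol_cscale[OF W] symbol_cscale[OF W']
         distrib_left distrib_right int mult.assoc mult.left_commute)
qed

text \<open>In this shape, setting \<open>A = B\<close> and summing over an orthonormal basis
  collapses the right-hand side to one inner product of kernels.\<close>

lemma symbol_form_trace:
  assumes W: "symbol_correspondence a \<rho> M W" "is_operator_kernel \<rho> W K"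
    and W': "symbol_correspondence a \<rho> M W'" "is_operator_kernel \<rho> W' K'"
  shows "cnj (W' A x) * W B x = cinner A (kernel_at \<rho> K' x) * cinner (kernel_at \<rho> K x) B"
  using symbol_eq_cinner[OF W] symbol_eq_cinner[OF W'] cinner_commute by metis

end

context coupled
begin

lemma kernel_at_proj: "n \<le> p \<Longrightarrow> proj n (kernel_at \<rho> K x) = kernel_at \<rho> (proj n K) x"
  by (simp add: kernel_at_def proj_op_rep coset_rep)

text \<open>By unitarity the sum over an orthonormal basis of \<open>V n\<close> is constant in \<open>x\<close>.\<close>

lemma sum_symbol_form:
  assumes W: "symbol_correspondence a \<rho> M W" "is_operator_kernel \<rho> W K"
    and W': "symbol_correspondence a \<rho> M W'" "is_operator_kernel \<rho> W' K'"
    and M: "invariant_prob M" and n: "n \<le> p"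
  shows "(\<Sum>l\<in>gt_labels (n, n). LINT x|M. cnj (W' (E n l) x) * W (E n l) x) = cinner K (proj n K')"
proof -
  interpret prob_space M using M by (simp add: invariant_prob_def)
  have "(\<Sum>l\<in>gt_labels (n, n). LINT x|M. cnj (W' (E n l) x) * W (E n l) x)
      = (LINT x|M. (\<Sum>l\<in>gt_labels (n, n). cnj (W' (E n l) x) * W (E n l) x))"
    by (rule Bochner_Integration.integral_sum[symmetric])
       (rule symbol_product_integrable[OF W(1) W'(1) M])
  also have "\<dots> = (LINT x|M. cinner (kernel_at \<rho> K x) (proj n (kernel_at \<rho> K' x)))"
    by (simp add: symbol_form_trace[OF W W'] proj_def cinner_sum_right cinner_cscale_right)
  also have "\<dots> = (LINT x|M. cinner K (proj n K'))"
    by (simp add: kernel_at_proj n kernel_at_unitary)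
  finally show ?thesis by (simp add: prob_space)
qed

end

section \<open>Construction and uniqueness of the dual correspondence\<close>

locale quantized = coupled \<rho> p E V
  for \<rho> :: "complex^3^3 \<Rightarrow> complex^'d^'d" and p E V +
  fixes a :: "nat \<times> nat" and M :: "cp2 measure" and W :: "complex^'d^'d \<Rightarrow> cp2 \<Rightarrow> complex"
    and K :: "complex^'d^'d" and c :: "nat \<Rightarrow> real"
  assumes abs_a: "abs_label a = p" and dim_pos: "irrep_dim a > 0"
    and identity: "E 0 ((0, 0, 0), 0) = complex_of_real (1 / sqrt (real (irrep_dim a))) *\<^sub>C mat 1"
    and M: "invariant_prob M" and W: "symbol_correspondence a \<rho> M W"
    and K: "is_operator_kernel \<rho> W K" and char: "characteristic_numbers a E K c"
begin

definition scale :: "nat \<Rightarrow> real" where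
  "scale n = sqrt ((real n + 1) ^ 3 / real (irrep_dim a))"

definition mid :: "nat \<Rightarrow> complex^'d^'d" where
  "mid n = E n ((int n, int n, int n), 0)"

lemma scale_pos: "scale n > 0" and scale_square: "scale n * scale n = (real n + 1) ^ 3 / real (irrep_dim a)"
  using dim_pos by (auto simp: scale_def)

lemma middle_in: "((int n, int n, int n), 0) \<in> gt_labels (n, n)"
  unfolding gt_lab_middle by (rule gt_lab_in) (simp add: gt_valid_def)

lemma mid_in_V: "n \<le> p \<Longrightarrow> mid n \<in> V n"
  unfolding mid_def by (intro E_in_V middle_in)

lemma cinner_mid: "n \<le> p \<Longrightarrow> cinner (mid n) (mid n) = 1"
  unfolding mid_def using middle_in by (simp add: cinner_E)

lemma c_0: "c 0 = 1" and c_nonzero: "n \<le> p \<Longrightarrow> c n \<noteq> 0"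
  and K_eq: "K = (\<Sum>n\<le>p. complex_of_real (c n * scale n) *\<^sub>C mid n)"
  using char by (auto simp: characteristic_numbers_def abs_a scale_def mid_def)

lemma proj_sum_mid: "n \<le> p \<Longrightarrow> proj n (\<Sum>n\<le>p. k n *\<^sub>C mid n) = k n *\<^sub>C mid n"
  by (rule proj_unique) (auto intro: csubspaceD csubspace_V mid_in_V)

text \<open>K is Hermitian, its component in each summand is a nonzero real multiple of
  \<open>mid n\<close>, and the projections commute with adjoints. This fixes the phase of
  \<open>mid n\<close> up to sign.\<close>

lemma mat_adj_mid: "mat_adj (mid n) = mid n" if n: "n \<le> p"
proof -
  have P: "proj n K = complex_of_real (c n * scale n) *\<^sub>C mid n"
    unfolding K_eq by (rule proj_sum_mid[OF n])
  have "mat_adj (proj n K) = proj n K"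
    using proj_mat_adj[OF n, of K] mat_adj_operator_kernel[OF W K] by simp
  then have "complex_of_real (c n * scale n) *\<^sub>C (mat_adj (mid n) - mid n) = 0"
    by (simp add: P mat_adj_cscale cscale_diff_right)
  moreover have "c n * scale n \<noteq> 0" using c_nonzero[OF n] scale_pos[of n] by simp
  ultimately show ?thesis by (simp only: cscale_eq_0_iff of_real_eq_0_iff right_minus_eq) blast
qed

text \<open>Being self-adjoint, \<open>dualize\<close> can be moved from the argument of W onto the
  kernel; the exponent -2 is the one that turns a component with factor \<open>c n\<close> into one
  with \<open>1 / c n\<close>.\<close>

definition dualize :: "complex^'d^'d \<Rightarrow> complex^'d^'d" where
  "dualize A = (\<Sum>n\<le>p. complex_of_real (1 / (c n)\<^sup>2) *\<^sub>C proj n A)"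

definition K_dual :: "complex^'d^'d" where
  "K_dual = (\<Sum>n\<le>p. complex_of_real (1 / c n * scale n) *\<^sub>C mid n)"

definition W_dual :: "complex^'d^'d \<Rightarrow> cp2 \<Rightarrow> complex" where
  "W_dual A x = W (dualize A) x"

lemma proj_dualize: "n \<le> p \<Longrightarrow> proj n (dualize A) = complex_of_real (1 / (c n)\<^sup>2) *\<^sub>C proj n A"
  unfolding dualize_def by (rule proj_unique) (auto intro: csubspaceD csubspace_V proj_in_V)

lemma dualize_add: "dualize (A + B) = dualize A + dualize B"
  by (simp add: dualize_def proj_add cscale_add_right sum.distrib)

lemma dualize_cscale: "dualize (k *\<^sub>C A) = k *\<^sub>C dualize A"
  by (simp add: dualize_def proj_cscale cscale_cscale cscale_sum_right mult.commute)

lemma dualize_op_rep: "g \<in> SU3 \<Longrightarrow> dualize (op_rep \<rho> g A) = op_rep \<rho> g (dualize A)"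
  by (simp add: dualize_def proj_op_rep op_rep_sum op_rep_cscale)

lemma dualize_mat_adj: "dualize (mat_adj A) = mat_adj (dualize A)"
  by (simp add: dualize_def proj_mat_adj mat_adj_sum mat_adj_cscale)

lemma cinner_dualize: "cinner (dualize A) B = cinner A (dualize B)"
  by (simp add: dualize_def cinner_sum_left cinner_sum_right cinner_cscale_left cinner_cscale_right
      cinner_proj_swap)

lemma inj_dualize: "inj dualize"
proof (rule injI)
  fix A B assume "dualize A = dualize B"
  then have "proj n A = proj n B" if "n \<le> p" for n
    using proj_dualize[OF that, of A] proj_dualize[OF that, of B] c_nonzero[OF that]
    by (metis (no_types, opaque_lifting) cscale_diff_right cscale_eq_0_iff divide_eq_0_iff of_real_eq_0_iff
        power_not_zero right_minus_eq zero_neq_one)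
  then have "(\<Sum>n\<le>p. proj n A) = (\<Sum>n\<le>p. proj n B)" by simp
  then show "A = B" by (simp only: sum_proj)
qed

lemma dualize_K: "dualize K = K_dual"
  unfolding K_dual_def dualize_def
proof (intro sum.cong refl)
  fix n assume "n \<in> {..p}" then have n: "n \<le> p" by simp
  have "1 / (c n)\<^sup>2 * (c n * scale n) = 1 / c n * scale n"
    using c_nonzero[OF n] by (simp add: power2_eq_square field_simps)
  then show "complex_of_real (1 / (c n)\<^sup>2) *\<^sub>C proj n K = complex_of_real (1 / c n * scale n) *\<^sub>C mid n"
    unfolding K_eq proj_sum_mid[OF n] cscale_cscale of_real_mult[symmetric] by simp
qed

text \<open>The trace is the inner product with the identity, which lies in \<open>V 0\<close>;
  since \<open>c 0 = 1\<close>, \<open>dualize\<close> leaves it unchanged.\<close>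

lemma trace_dualize: "trace (dualize A) = trace A"
proof -
  have lab: "(((0, 0, 0), 0) :: gt_label) = ((int 0, int 0, int 0), 0)" by simp
  have "mid 0 = complex_of_real (1 / sqrt (real (irrep_dim a))) *\<^sub>C mat 1"
    using identity by (simp add: mid_def)
  then have "complex_of_real (sqrt (real (irrep_dim a))) *\<^sub>C mid 0 = mat 1"
    using dim_pos by (simp add: cscale_cscale)
  then have one: "mat 1 \<in> V 0" using csubspaceD(3)[OF csubspace_V[OF le0] mid_in_V[OF le0]] by metis
  have "dualize (mat 1) = (\<Sum>n\<le>p. if n = 0 then mat 1 else 0)"
    unfolding dualize_def using proj_other[OF le0 _ _ one] proj_id[OF le0 one] c_0
    by (intro sum.cong refl) auto
  then have "dualize (mat 1) = mat 1" by simp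
  moreover have "trace B = cinner (mat 1) B" for B :: "complex^'d^'d" by (simp add: cinner_matrix)
  ultimately show ?thesis using cinner_dualize[of "mat 1" A] by simp
qed

lemma kernel_W_dual: "is_operator_kernel \<rho> W_dual K_dual"
  unfolding is_operator_kernel_def
proof (intro conjI ballI allI)
  fix h assume h: "h \<in> isotropy"
  then have "h \<in> SU3" by (simp add: isotropy_def)
  then show "op_rep \<rho> h K_dual = K_dual"
    using K h by (simp add: dualize_K[symmetric] dualize_op_rep[symmetric] is_operator_kernel_def)
next
  fix A x
  have "W_dual A x = cinner (kernel_at \<rho> K x) (dualize A)"
    by (simp add: W_dual_def symbol_eq_cinner[OF W K])
  also have "\<dots> = cinner (kernel_at \<rho> K_dual x) A"
    by (simp add: cinner_dualize[symmetric] kernel_at_def dualize_op_rep[symmetric] coset_rep dualize_K[symmetric])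
  also have "\<dots> = trace (A ** kernel_at \<rho> K_dual x)"
    using mat_adj_operator_kernel[OF W K]
    by (intro trace_mult_hermitian[symmetric])
       (simp add: kernel_at_unitary dualize_K[symmetric] dualize_mat_adj[symmetric])
  finally show "W_dual A x = trace (A ** kernel_at \<rho> K_dual x)" .
qed

lemma symbol_W_dual: "symbol_correspondence a \<rho> M W_dual"
proof -
  have "W_dual = W \<circ> dualize" by (simp add: W_dual_def fun_eq_iff)
  then have "inj W_dual" using symbol_inj[OF W] inj_dualize by (simp add: inj_compose)
  then show ?thesis
    unfolding symbol_correspondence_def W_dual_def
    using symbol_smooth[OF W] symbol_op_rep[OF W] symbol_integral[OF W]
    by (auto simp: W_dual_def[abs_def] dualize_add dualize_cscale dualize_op_rep dualize_mat_adj
        symbol_add[OF W] symbol_cscale[OF W] symbol_mat_adj[OF W] trace_dualize)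
qed

text \<open>On each summand the basis sum is the inner product of the components of K and
  \<open>K_dual\<close>. There \<open>c n\<close> cancels and
  \<open>(scale n)\<^sup>2 = (n + 1) ^ 3 / dim\<close> remains, so division by the dimension of the
  summand gives \<open>1 / dim\<close>, the same for all n.\<close>

lemma dual_W_dual: "is_dual_correspondence a \<rho> M W W_dual"
  unfolding is_dual_correspondence_def
proof (intro conjI allI symbol_W_dual)
  fix A B
  let ?d = "of_nat (irrep_dim a) :: complex"
  have coeff: "(\<Sum>l\<in>gt_labels (n, n). LINT x|M. cnj (W_dual (E n l) x) * W (E n l) x) / of_nat ((n + 1) ^ 3)
      = 1 / ?d" if n: "n \<le> p" for n
  proof -
    have "cinner K (proj n K_dual) = cinner (proj n K) K_dual" by (simp add: cinner_proj_swap n)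
    also have "\<dots> = complex_of_real (c n * scale n) * cinner (mid n) (proj n K_dual)"
      unfolding K_eq proj_sum_mid[OF n]
      by (simp add: cinner_cscale_left cinner_proj_right n mid_in_V)
    also have "\<dots> = complex_of_real ((c n * scale n) * (1 / c n * scale n))"
      unfolding K_dual_def proj_sum_mid[OF n] cinner_cscale_right cinner_mid[OF n] of_real_mult by simp
    also have "(c n * scale n) * (1 / c n * scale n) = (real n + 1) ^ 3 / real (irrep_dim a)"
      using c_nonzero[OF n] scale_square[of n] by simp
    also have "complex_of_real \<dots> = of_nat ((n + 1) ^ 3) / ?d" by (simp add: add.commute)
    finally have "(\<Sum>l\<in>gt_labels (n, n). LINT x|M. cnj (W_dual (E n l) x) * W (E n l) x)
        = of_nat ((n + 1) ^ 3) / ?d"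
      by (simp only: sum_symbol_form[OF W K symbol_W_dual kernel_W_dual M n])
    moreover have "of_nat ((n + 1) ^ 3) \<noteq> (0 :: complex)" unfolding of_nat_eq_0_iff by simp
    moreover have "y / ?d / y = 1 / ?d" if "y \<noteq> 0" for y using that by simp
    ultimately show ?thesis by metis
  qed
  have "(LINT x|M. cnj (W_dual A x) * W B x) = (\<Sum>n\<le>p. 1 / ?d * cinner A (proj n B))"
    unfolding invariant_form_eq[OF invariant_form_integral[OF W symbol_W_dual M], of A B]
  proof (intro sum.cong refl)
    fix n assume "n \<in> {..p}"
    then show "(\<Sum>l\<in>gt_labels (n, n). LINT x|M. cnj (W_dual (E n l) x) * W (E n l) x) / of_nat ((n + 1) ^ 3)
        * cinner A (proj n B) = 1 / ?d * cinner A (proj n B)"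
      by (simp only: coeff atMost_iff)
  qed
  also have "\<dots> = 1 / ?d * trace (mat_adj A ** B)"
    unfolding sum_distrib_left[symmetric] cinner_sum_right[symmetric] sum_proj by (simp only: cinner_matrix)
  finally show "(LINT x|M. cnj (W_dual A x) * W B x) = 1 / ?d * trace (mat_adj A ** B)" .
qed

text \<open>Nothing is presupposed about the form of \<open>K'\<close>. Being fixed by the isotropy
  group it has one unknown coefficient per summand, and the duality condition summed over a basis of
  \<open>V n\<close> is a linear equation for it with nonzero factor
  \<open>c n * scale n\<close>.\<close>

lemma dual_unique:
  assumes "is_dual_correspondence a \<rho> M W W'" shows "W' = W_dual"
proof -
  have W': "symbol_correspondence a \<rho> M W'" using assms by (simp add: is_dual_correspondence_def)
  obtain K' where K': "is_operator_kernel \<rho> W' K'" using exists_operator_kernel[OF W'] by blast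
  let ?d = "of_nat (irrep_dim a) :: complex"
  have "proj n K' = complex_of_real (1 / c n * scale n) *\<^sub>C mid n" if n: "n \<le> p" for n
  proof -
    have "(\<Sum>l\<in>gt_labels (n, n). LINT x|M. cnj (W' (E n l) x) * W (E n l) x)
        = (\<Sum>l\<in>gt_labels (n, n). 1 / ?d)"
      using assms n by (intro sum.cong refl)
        (simp add: is_dual_correspondence_def cinner_matrix[symmetric] cinner_E)
    then have "cinner K (proj n K') = of_nat ((n + 1) ^ 3) / ?d"
      unfolding sum_symbol_form[OF W K W' K' M n] by (simp add: card_gt_labels)
    moreover have "cinner K (proj n K') = complex_of_real (c n * scale n) * cinner (mid n) K'"
      unfolding cinner_proj_swap[OF n, symmetric] K_eq proj_sum_mid[OF n] by (simp add: cinner_cscale_left)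
    moreover have "of_nat ((n + 1) ^ 3) / ?d = complex_of_real (scale n * scale n)"
      unfolding scale_square by (simp add: add.commute)
    ultimately have "complex_of_real (c n * scale n) * cinner (mid n) K' = complex_of_real (scale n * scale n)"
      by simp
    then have "cinner (mid n) K' = complex_of_real (1 / c n * scale n)"
      using c_nonzero[OF n] scale_pos[of n] by (simp add: field_simps)
    then show ?thesis
      using isotropy_fixed_proj[OF _ n, of K'] K' by (simp add: is_operator_kernel_def mid_def)
  qed
  then have "K' = K_dual" using sum_proj[of K'] by (simp add: K_dual_def)
  then show ?thesis
    using K' kernel_W_dual by (intro ext) (simp add: is_operator_kernel_def)
qed

lemma dual_correspondence_eq: "dual_correspondence a \<rho> M W = W_dual"
  unfolding dual_correspondence_def by (rule the_equality) (auto intro: dual_W_dual dual_unique)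

lemma dual_kernel_eq: "dual_kernel a \<rho> M W = K_dual"
  unfolding dual_kernel_def dual_correspondence_eq by (rule operator_kernel_eq[OF kernel_W_dual])

lemma characteristic_numbers_dual: "characteristic_numbers a E K_dual (\<lambda>n. 1 / c n)"
  using c_0 c_nonzero by (simp add: characteristic_numbers_def abs_a K_dual_def scale_def mid_def)

section \<open>The trikernel and the reproducing kernel\<close>

lemma trikernel_eq: "integral_trikernel a \<rho> M W x1 x2 x3 = (of_nat (irrep_dim a))\<^sup>2
    * trace (kernel_at \<rho> K_dual x1 ** kernel_at \<rho> K_dual x2 ** kernel_at \<rho> K x3)"
  unfolding integral_trikernel_def dual_kernel_eq operator_kernel_eq[OF K] ..

text \<open>The coordinates of the rotated \<open>mid n\<close> are Wigner functions, hence
  conjugated harmonics up to the factor \<open>(n + 1) powr (3/2)\<close>, which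
  \<open>scale n\<close> contains. General coefficients k let one computation serve both K and
  \<open>K_dual\<close>.\<close>

lemma kernel_at_harmonic:
  "kernel_at \<rho> (\<Sum>n\<le>p. complex_of_real (k n * scale n) *\<^sub>C mid n) x
    = (\<Sum>n\<le>p. \<Sum>l\<in>gt_labels (n, n).
        (complex_of_real (k n / sqrt (real (irrep_dim a))) * cnj (harmonic \<rho> E n l x)) *\<^sub>C E n l)"
proof -
  have sc: "scale n = (real (n + 1) powr (3/2)) / sqrt (real (irrep_dim a))" for n
  proof -
    let ?y = "real n + 1"
    have "?y ^ 3 = ?y powr 3" using powr_realpow[of ?y 3] by simp
    then have "sqrt (?y ^ 3) = (?y powr 3) powr (1/2)" using powr_half_sqrt[of "?y powr 3"] by simp
    also have "\<dots> = real (n + 1) powr (3/2)" unfolding powr_powr by (simp add: add.commute)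
    finally have "sqrt (?y ^ 3) = real (n + 1) powr (3/2)" .
    then show ?thesis unfolding scale_def real_sqrt_divide by simp
  qed
  have "op_rep \<rho> (coset_rep x) (mid n)
      = (\<Sum>l\<in>gt_labels (n, n). cinner (E n l) (op_rep \<rho> (coset_rep x) (mid n)) *\<^sub>C E n l)" if "n \<le> p" for n
    using proj_id[OF that op_rep_V[OF that coset_rep(1) mid_in_V[OF that]]] by (simp add: proj_def)
  then have "complex_of_real (k n * scale n) *\<^sub>C op_rep \<rho> (coset_rep x) (mid n) = (\<Sum>l\<in>gt_labels (n, n).
        (complex_of_real (k n * scale n) * cinner (E n l) (op_rep \<rho> (coset_rep x) (mid n))) *\<^sub>C E n l)"
    if "n \<le> p" for n
    using that by (metis (no_types, lifting) cscale_cscale cscale_sum_right sum.cong)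
  moreover have "complex_of_real (k n * scale n) * cinner (E n l) (op_rep \<rho> (coset_rep x) (mid n))
      = complex_of_real (k n / sqrt (real (irrep_dim a))) * cnj (harmonic \<rho> E n l x)" for n l
    by (simp add: harmonic_def wigner_D_def mid_def sc)
  ultimately have "complex_of_real (k n * scale n) *\<^sub>C op_rep \<rho> (coset_rep x) (mid n) = (\<Sum>l\<in>gt_labels (n, n).
        (complex_of_real (k n / sqrt (real (irrep_dim a))) * cnj (harmonic \<rho> E n l x)) *\<^sub>C E n l)"
    if "n \<le> p" for n
    using that by (simp only:)
  then show ?thesis by (simp add: kernel_at_def op_rep_sum op_rep_cscale)
qed

lemma kernel_at_K: "kernel_at \<rho> K x = (\<Sum>n\<le>p. \<Sum>l\<in>gt_labels (n, n).
    (complex_of_real (c n / sqrt (real (irrep_dim a))) * cnj (harmonic \<rho> E n l x)) *\<^sub>C E n l)"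
  unfolding K_eq by (rule kernel_at_harmonic)

lemma kernel_at_K_dual: "kernel_at \<rho> K_dual x = (\<Sum>n\<le>p. \<Sum>l\<in>gt_labels (n, n).
    (complex_of_real (1 / c n / sqrt (real (irrep_dim a))) * cnj (harmonic \<rho> E n l x)) *\<^sub>C E n l)"
  unfolding K_dual_def by (rule kernel_at_harmonic)

lemma integral_kernel_dual:
  "(LINT x|M. trace (A ** kernel_at \<rho> K_dual x)) = trace A / of_nat (irrep_dim a)"
  using symbol_integral[OF symbol_W_dual, of A] kernel_W_dual by (simp add: is_operator_kernel_def)

text \<open>Cyclicity moves the integrated kernel to the end, where the trace normalisation of
  \<open>W_dual\<close> replaces it by \<open>1 / dim\<close>. Integrating out the first or the
  second argument leaves the same trace.\<close>

lemma reproducing_kernel_trace: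
  "reproducing_kernel a \<rho> M W x1 x2
    = of_nat (irrep_dim a) * trace (kernel_at \<rho> K_dual x1 ** kernel_at \<rho> K x2)"
  "(LINT x|M. integral_trikernel a \<rho> M W x1 x x2)
    = of_nat (irrep_dim a) * trace (kernel_at \<rho> K_dual x1 ** kernel_at \<rho> K x2)"
proof -
  let ?d = "of_nat (irrep_dim a) :: complex"
  let ?A = "kernel_at \<rho> K_dual x1" and ?B = "kernel_at \<rho> K x2"
  have d: "?d\<^sup>2 * t / ?d = ?d * t" for t
    using dim_pos by (simp add: power2_eq_square)
  have "trace (kernel_at \<rho> K_dual x ** ?A ** ?B) = trace ((?A ** ?B) ** kernel_at \<rho> K_dual x)" for x
    by (metis matrix_mul_assoc trace_mul_sym)
  then show "reproducing_kernel a \<rho> M W x1 x2 = ?d * trace (?A ** ?B)"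
    by (simp add: reproducing_kernel_def trikernel_eq integral_kernel_dual d del: power_eq_0_iff)
  have "trace (?A ** kernel_at \<rho> K_dual x ** ?B) = trace ((?B ** ?A) ** kernel_at \<rho> K_dual x)" for x
    by (metis matrix_mul_assoc trace_mul_sym)
  moreover have "trace (?B ** ?A) = trace (?A ** ?B)" by (rule trace_mul_sym)
  ultimately show "(LINT x|M. integral_trikernel a \<rho> M W x1 x x2) = ?d * trace (?A ** ?B)"
    by (simp add: trikernel_eq integral_kernel_dual d del: power_eq_0_iff)
qed

lemma reproducing_kernel_harmonic:
  "reproducing_kernel a \<rho> M W x1 x2
    = (\<Sum>n\<le>p. \<Sum>l\<in>gt_labels (n, n). cnj (harmonic \<rho> E n l x1) * harmonic \<rho> E n l x2)"
proof -
  let ?d = "of_nat (irrep_dim a) :: complex" and ?r = "complex_of_real (sqrt (real (irrep_dim a)))"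
  have rr: "?r * ?r = ?d" by (simp add: of_real_mult[symmetric] del: of_real_mult)
  have r0: "?r \<noteq> 0" using dim_pos by simp
  have coef: "cinner (kernel_at \<rho> K x2) (E n l) = complex_of_real (c n) / ?r * harmonic \<rho> E n l x2"
    if n: "n \<le> p" "l \<in> gt_labels (n, n)" for n l
  proof -
    have "cinner (kernel_at \<rho> K x2) (E n l) = (\<Sum>m\<le>p. \<Sum>l'\<in>gt_labels (m, m).
        if m = n \<and> l' = l then complex_of_real (c n) / ?r * harmonic \<rho> E n l x2 else 0)"
      unfolding kernel_at_K cinner_sum_left cinner_cscale_left
      using n by (intro sum.cong refl) (auto simp: cinner_E)
    also have "\<dots> = (\<Sum>m\<le>p. if m = n then complex_of_real (c n) / ?r * harmonic \<rho> E n l x2 else 0)"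
    proof (intro sum.cong refl)
      fix m show "(\<Sum>l'\<in>gt_labels (m, m). if m = n \<and> l' = l then complex_of_real (c n) / ?r * harmonic \<rho> E n l x2 else 0)
          = (if m = n then complex_of_real (c n) / ?r * harmonic \<rho> E n l x2 else 0)"
        using n(2) by (cases "m = n") (simp_all add: finite_gt_labels)
    qed
    finally show ?thesis using n(1) by simp
  qed
  have "trace (kernel_at \<rho> K_dual x1 ** kernel_at \<rho> K x2) = cinner (kernel_at \<rho> K x2) (kernel_at \<rho> K_dual x1)"
    using mat_adj_operator_kernel[OF W K] by (intro trace_mult_hermitian) (simp add: kernel_at_unitary)
  also have "\<dots> = (\<Sum>n\<le>p. \<Sum>l\<in>gt_labels (n, n). 
      (cnj (harmonic \<rho> E n l x1) * harmonic \<rho> E n l x2) / ?d)"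
    unfolding kernel_at_K_dual cinner_sum_right cinner_cscale_right
    using c_nonzero r0 by (intro sum.cong refl) (simp add: coef rr[symmetric] field_simps)
  also have "\<dots> = (\<Sum>n\<le>p. \<Sum>l\<in>gt_labels (n, n). cnj (harmonic \<rho> E n l x1) * harmonic \<rho> E n l x2) / ?d"
    by (simp add: sum_divide_distrib)
  finally show ?thesis unfolding reproducing_kernel_trace using dim_pos by simp
qed

text \<open>The harmonic expansion only shows that exchanging the arguments conjugates the value.
  The value is real because it is a trace of a product of two Hermitian kernels, where conjugation
  reverses the factors and cyclicity restores them.\<close>

lemma reproducing_kernel_commute: "reproducing_kernel a \<rho> M W x1 x2 = reproducing_kernel a \<rho> M W x2 x1"
proof -
  let ?A = "\<lambda>x. kernel_at \<rho> K_dual x" and ?B = "\<lambda>x. kernel_at \<rho> K x"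
  have adj: "mat_adj (?A x) = ?A x" "mat_adj (?B x) = ?B x" for x
    using mat_adj_operator_kernel[OF W K] mat_adj_operator_kernel[OF symbol_W_dual kernel_W_dual]
    by (simp_all add: kernel_at_unitary)
  have "reproducing_kernel a \<rho> M W x1 x2 = cnj (reproducing_kernel a \<rho> M W x2 x1)"
    unfolding reproducing_kernel_harmonic by (simp add: mult.commute)
  also have "\<dots> = of_nat (irrep_dim a) * trace (mat_adj (?A x2 ** ?B x1))"
    by (simp add: reproducing_kernel_trace trace_mat_adj)
  also have "\<dots> = reproducing_kernel a \<rho> M W x2 x1"
    unfolding reproducing_kernel_trace mat_adj_mult adj trace_mul_sym[of "?B x1"] ..
  finally show ?thesis .
qed

end

section \<open>Wigner product symbols as traces\<close>

text \<open>Expanding the standard basis vectors gives the completeness relation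
  \<open>delta\<close>, which is then inserted into the trace.\<close>

lemma orthonormal_trace:
  fixes e :: "'i \<Rightarrow> complex^'d"
  assumes "\<And>v. v = (\<Sum>m\<in>L. cinner (e m) v *\<^sub>C e m)"
  shows "trace A = (\<Sum>m\<in>L. cinner (e m) (A *v e m))"
proof -
  have delta: "(\<Sum>m\<in>L. cnj (e m $ j) * e m $ i) = (if i = j then 1 else 0)" for i j
  proof -
    have "cinner v (axis j 1) = cnj (v $ j)" for v :: "complex^'d"
      by (simp add: cinner_vec_def cinner_complex_def axis_def if_distrib[of "\<lambda>x. _ * x"] cong: if_cong)
    then have "(\<Sum>m\<in>L. cnj (e m $ j) * e m $ i) = (\<Sum>m\<in>L. cinner (e m) (axis j 1) *\<^sub>C e m) $ i"
      by simp
    also have "\<dots> = axis j 1 $ i" by (simp only: assms[of "axis j 1", symmetric])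
    finally show ?thesis by (simp add: axis_def)
  qed
  have "(\<Sum>m\<in>L. cinner (e m) (A *v e m)) = (\<Sum>m\<in>L. \<Sum>i\<in>UNIV. \<Sum>k\<in>UNIV. A $ i $ k * (cnj (e m $ i) * e m $ k))"
    by (simp add: cinner_vec_def cinner_complex_def matrix_vector_mult_def sum_distrib_left mult_ac)
  also have "\<dots> = (\<Sum>i\<in>UNIV. \<Sum>m\<in>L. \<Sum>k\<in>UNIV. A $ i $ k * (cnj (e m $ i) * e m $ k))"
    by (rule sum.swap)
  also have "\<dots> = (\<Sum>i\<in>UNIV. \<Sum>k\<in>UNIV. \<Sum>m\<in>L. A $ i $ k * (cnj (e m $ i) * e m $ k))"
    by (intro sum.cong refl sum.swap)
  also have "\<dots> = (\<Sum>i\<in>UNIV. \<Sum>k\<in>UNIV. A $ i $ k * (if k = i then 1 else 0))"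
    by (simp only: sum_distrib_left[symmetric] delta)
  also have "\<dots> = trace A" by (simp add: trace_def if_distrib[of "\<lambda>x. _ * x"] cong: if_cong)
  finally show ?thesis by simp
qed

lemma orthonormal_mult:
  fixes e :: "'i \<Rightarrow> complex^'d"
  assumes "\<And>v. v = (\<Sum>m\<in>L. cinner (e m) v *\<^sub>C e m)"
  shows "cinner x ((A ** B) *v y) = (\<Sum>k\<in>L. cinner x (A *v e k) * cinner (e k) (B *v y))"
proof -
  have sum: "A *v (\<Sum>k\<in>L. f k) = (\<Sum>k\<in>L. A *v f k)" for f
    by (induction L rule: infinite_finite_induct) (simp_all add: matrix_vector_right_distrib)
  have "(A ** B) *v y = A *v (\<Sum>k\<in>L. cinner (e k) (B *v y) *\<^sub>C e k)"
    by (simp only: matrix_vector_mul_assoc[symmetric] assms[of "B *v y", symmetric])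
  then show ?thesis
    by (simp add: sum matrix_vector_mult_cscale cinner_sum_right cinner_cscale_right mult.commute)
qed

lemma check_label_check_label: "check_label a (check_label a l) = l"
proof -
  obtain n1 n2 n3 J where "l = ((n1, n2, n3), J)" by (metis surj_pair)
  then show ?thesis by (simp add: check_label.simps Let_def)
qed

lemma check_label_dual_label: "check_label (dual_label a) = check_label a"
proof
  fix l :: gt_label
  obtain n1 n2 n3 J where "l = ((n1, n2, n3), J)" by (metis surj_pair)
  then show "check_label (dual_label a) l = check_label a l"
    by (cases a) (simp add: check_label.simps add.commute)
qed

lemma check_label_gt_labels:
  assumes "l \<in> gt_labels a" shows "check_label a l \<in> gt_labels (dual_label a)"
proof (cases a)
  case (Pair p q)
  then obtain rm rp n3 where l: "l = ((int p + 2 * int q - (rp + rm), rp + rm - n3, n3), real_of_int (rp - rm) / 2)"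
    and "0 \<le> rm" "rm \<le> int q" "int q \<le> rp" "rp \<le> int p + int q" "rm \<le> n3" "n3 \<le> rp"
    using assms by (auto simp: gt_labels.simps)
  then have "\<exists>rm' rp' n3'. check_label a l = ((int q + 2 * int p - (rp' + rm'), rp' + rm' - n3', n3'),
      real_of_int (rp' - rm') / 2) \<and> 0 \<le> rm' \<and> rm' \<le> int p \<and> int p \<le> rp' \<and> rp' \<le> int q + int p
      \<and> rm' \<le> n3' \<and> n3' \<le> rp'"
    by (rule_tac exI[of _ "int p + int q - rp"], rule_tac exI[of _ "int p + int q - rm"],
        rule_tac exI[of _ "int p + int q - n3"]) (auto simp: Pair check_label.simps Let_def)
  then show ?thesis by (simp add: Pair gt_labels.simps)
qed

lemma dual_label_dual_label [simp]: "dual_label (dual_label a) = a"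
  by (cases a) simp

lemma bij_betw_check_label: "bij_betw (check_label a) (gt_labels (dual_label a)) (gt_labels a)"
  using check_label_gt_labels[of _ a] check_label_gt_labels[of _ "dual_label a"]
  by (intro bij_betw_byWitness[where f' = "check_label a"])
     (auto simp: check_label_check_label check_label_dual_label)

lemma two_weight_check_label:
  "two_t (fst (check_label a l)) + two_u (fst (check_label a l)) = - (two_t (fst l) + two_u (fst l))"
proof -
  obtain n1 n2 n3 J where "l = ((n1, n2, n3), J)" by (metis surj_pair)
  then show ?thesis by (simp add: check_label.simps Let_def)
qed

text \<open>The sign in the induced dual basis. It is invariant under \<open>check_label\<close>,
  which negates the exponent.\<close>

definition parity :: "gt_label \<Rightarrow> complex" where
  "parity l = (- 1) powi (two_t (fst l) + two_u (fst l))"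

lemma parity_check_label [simp]: "parity (check_label a l) = parity l"
  unfolding parity_def two_weight_check_label by (rule power_int_minus_one_minus)

lemma parity_square [simp]: "parity l * parity l = 1" "parity l * (parity l * z) = z"
proof -
  show "parity l * parity l = 1"
    unfolding parity_def by (simp add: power_int_mult_distrib[symmetric])
  then show "parity l * (parity l * z) = z" by (simp add: mult.assoc[symmetric])
qed

lemma cnj_parity [simp]: "cnj (parity l) = parity l"
  by (simp add: parity_def power_int_def)

text \<open>The coupled pair is a rank one operator, so its inner product with \<open>E n l\<close>
  is a conjugated matrix element of \<open>E n l\<close>; the parity comes from the dual
  basis.\<close>

lemma clebsch_gordan_eq:
  "clebsch_gordan a e E l1 l2 n l
    = parity l2 * cnj (cinner (e l1) (E n l *v e (check_label a l2)))"
proof -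
  let ?w = "e (check_label a l2)"
  have ax: "cinner w (axis j 1) = cnj (w $ j)" for w :: "complex^'d" and j
    by (simp add: cinner_vec_def cinner_complex_def axis_def if_distrib[of "\<lambda>x. _ * x"] cong: if_cong)
  have entry: "tensor_op (e l1) (dual_gt_basis a e l2) $ i $ j = parity l2 * (e l1 $ i * cnj (?w $ j))" for i j
    using parity_check_label[of a l2]
    by (simp add: tensor_op_def matrix_def dual_gt_basis_def Let_def ax parity_def[symmetric] mult_ac)
  show ?thesis
    unfolding clebsch_gordan_def cinner_vec_def[of "E n l"] cinner_vec_def[of "E n l $ _"] cinner_complex_def entry
    by (simp add: cinner_vec_def cinner_complex_def matrix_vector_mult_def sum_distrib_left mult_ac)
qed

context coupled
begin

text \<open>By reality each Clebsch-Gordan coefficient is a parity times a matrix element, and the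
  triple sum becomes a trace by inserting the basis twice. The parities of m2, m3 and l3 each occur
  twice and cancel, one copy for m2 and for l3 being the explicit sign of the symbol.\<close>

lemma wigner_product_symbol_eq_trace:
  fixes e :: "gt_label \<Rightarrow> complex^'d"
  assumes basis: "\<And>v. v = (\<Sum>l\<in>gt_labels a. cinner (e l) v *\<^sub>C e l)" and abs_a: "abs_label a = p"
    and real: "\<And>n l1 l2 l. \<lbrakk>n \<le> p; l1 \<in> gt_labels a; l2 \<in> gt_labels (dual_label a); l \<in> gt_labels (n, n)\<rbrakk>
        \<Longrightarrow> clebsch_gordan a e E l1 l2 n l \<in> \<real>"
    and herm: "\<And>n. n \<le> p \<Longrightarrow> mat_adj (E n ((int n, int n, int n), 0)) = E n ((int n, int n, int n), 0)"
    and n: "n1 \<le> p" "n2 \<le> p" "n3 \<le> p"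
    and l: "l1 \<in> gt_labels (n1, n1)" "l2 \<in> gt_labels (n2, n2)" "l3 \<in> gt_labels (n3, n3)"
  shows "trace (E n1 l1 ** E n2 l2 ** E n3 l3) = (- 1) ^ p * wigner_product_symbol a e E n1 l1 n2 l2 n3 l3"
proof -
  let ?ck = "check_label a" and ?L = "gt_labels a" and ?D = "gt_labels (dual_label a)"
  define q where "q m k n l = cinner (e m) (E n l *v e k)" for m k n l
  have ck: "?ck m \<in> ?L" if "m \<in> ?D" for m
    using that check_label_gt_labels[of m "dual_label a"] by (simp add: check_label_dual_label)
  have q_real: "cnj (q m (?ck k) n l) = q m (?ck k) n l"
    if "n \<le> p" "m \<in> ?L" "k \<in> ?D" "l \<in> gt_labels (n, n)" for m k n l
  proof -
    have "cnj (parity k * cnj (q m (?ck k) n l)) = parity k * cnj (q m (?ck k) n l)"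
      using real[OF that] by (simp add: clebsch_gordan_eq q_def Reals_cnj_iff)
    moreover have "parity k \<noteq> 0" by (metis mult_zero_left parity_square(1) zero_neq_one)
    ultimately show ?thesis by simp
  qed
  have cg: "clebsch_gordan a e E m k n l = parity k * q m (?ck k) n l"
    if "n \<le> p" "m \<in> ?L" "k \<in> ?D" "l \<in> gt_labels (n, n)" for m k n l
    using q_real[OF that] by (simp add: clebsch_gordan_eq q_def)
  have check_l3: "check_label (n3, n3) l3 \<in> gt_labels (n3, n3)"
    using check_label_gt_labels[OF l(3)] by simp
  \<comment> \<open>The symbol takes the third operator at the checked label and from the wrong
    side. The adjoint relation of the coupled basis undoes both at the price of
    \<open>parity l3\<close>.\<close>
  have adj: "q m (?ck k) n3 (check_label (n3, n3) l3) = parity l3 * q (?ck k) m n3 l3"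
    if "m \<in> ?L" "k \<in> ?D" for m k
  proof -
    have "mat_adj (E n3 (check_label (n3, n3) l3)) = parity l3 *\<^sub>C E n3 l3"
      using mat_adj_E[OF n(3) herm[OF n(3)] check_l3] parity_check_label[of "(n3, n3)" l3]
      by (simp add: parity_def[symmetric] check_label_check_label)
    moreover have "cnj (cinner x (B *v y)) = cinner y (mat_adj B *v x)" for x y :: "complex^'d" and B
      unfolding cinner_vec_def cinner_complex_def matrix_vector_mult_def
      by (simp add: sum_distrib_left mult_ac) (rule sum.swap)
    moreover have "(k *\<^sub>C B) *v x = k *\<^sub>C (B *v x)" for k x and B :: "complex^'d^'d"
      by (simp add: vec_eq_iff matrix_vector_mult_def sum_distrib_left mult_ac)
    ultimately have "cnj (q m (?ck k) n3 (check_label (n3, n3) l3)) = parity l3 * q (?ck k) m n3 l3"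
      by (simp add: q_def cinner_cscale_right)
    then show ?thesis using q_real[OF n(3) that check_l3] by simp
  qed
  have "wigner_product_symbol a e E n1 l1 n2 l2 n3 l3
      = (\<Sum>m1\<in>?L. \<Sum>m2\<in>?D. \<Sum>m3\<in>?D. (- 1) ^ p *
          (q m1 (?ck m2) n1 l1 * q (?ck m2) (?ck m3) n2 l2 * q (?ck m3) m1 n3 l3))"
    unfolding wigner_product_symbol_def
  proof (intro sum.cong refl)
    fix m1 m2 m3 assume m: "m1 \<in> ?L" "m2 \<in> ?D" "m3 \<in> ?D"
    have sign: "(- 1) powi (int (abs_label a) + (two_t (fst l3) + two_t (fst m2) + two_u (fst l3) + two_u (fst m2)))
        = (- 1) ^ p * (parity l3 * parity m2)"
    proof -
      have "int (abs_label a) + (two_t (fst l3) + two_t (fst m2) + two_u (fst l3) + two_u (fst m2))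
          = int p + ((two_t (fst l3) + two_u (fst l3)) + (two_t (fst m2) + two_u (fst m2)))"
        by (simp add: abs_a)
      then show ?thesis by (simp add: power_int_add parity_def)
    qed
    show "(- 1) powi (int (abs_label a) + (two_t (fst l3) + two_t (fst m2) + two_u (fst l3) + two_u (fst m2)))
        * clebsch_gordan a e E m1 m2 n1 l1
        * clebsch_gordan a e E (check_label (dual_label a) m2) m3 n2 l2
        * clebsch_gordan a e E m1 m3 n3 (check_label (n3, n3) l3)
      = (- 1) ^ p * (q m1 (?ck m2) n1 l1 * q (?ck m2) (?ck m3) n2 l2 * q (?ck m3) m1 n3 l3)"
      unfolding sign check_label_dual_label cg[OF n(1) m(1,2) l(1)] cg[OF n(2) ck[OF m(2)] m(3) l(2)]
        cg[OF n(3) m(1,3) check_l3] adj[OF m(1,3)]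
      by (simp add: mult_ac)
  qed
  \<comment> \<open>Dual labels are replaced by their checks, so that all three sums run over labels
    of \<open>a\<close>.\<close>
  also have "\<dots> = (- 1) ^ p * (\<Sum>m1\<in>?L. \<Sum>k2\<in>?L. \<Sum>k3\<in>?L.
      q m1 k2 n1 l1 * q k2 k3 n2 l2 * q k3 m1 n3 l3)"
    by (simp only: sum_distrib_left[symmetric] sum.reindex_bij_betw[OF bij_betw_check_label,
          where g = "\<lambda>k3. q _ _ n1 l1 * q _ k3 n2 l2 * q k3 _ n3 l3"]
        sum.reindex_bij_betw[OF bij_betw_check_label,
          where g = "\<lambda>k2. \<Sum>k3\<in>?L. q _ k2 n1 l1 * q k2 k3 n2 l2 * q k3 _ n3 l3"])
  also have "(\<Sum>m1\<in>?L. \<Sum>k2\<in>?L. \<Sum>k3\<in>?L. q m1 k2 n1 l1 * q k2 k3 n2 l2 * q k3 m1 n3 l3)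
      = trace (E n1 l1 ** E n2 l2 ** E n3 l3)"
    unfolding orthonormal_trace[OF basis] matrix_mul_assoc[symmetric] orthonormal_mult[OF basis] q_def
    by (simp add: sum_distrib_left mult.assoc)
  finally show ?thesis by (simp add: mult.assoc[symmetric] power_mult_distrib[symmetric])
qed

end

section \<open>Assembly of the trikernel formula\<close>

lemma trace_triple_sum:
  fixes F G H :: "'i \<Rightarrow> complex^'d^'d"
  shows "trace ((\<Sum>i\<in>I. f i *\<^sub>C F i) ** (\<Sum>j\<in>J. g j *\<^sub>C G j) ** (\<Sum>k\<in>K. h k *\<^sub>C H k))
    = (\<Sum>i\<in>I. \<Sum>j\<in>J. \<Sum>k\<in>K. f i * g j * h k * trace (F i ** G j ** H k))"
proof -
  have 1: "(\<Sum>i\<in>I. f i *\<^sub>C F i) ** Y ** Z = (\<Sum>i\<in>I. f i *\<^sub>C (F i ** Y ** Z))" for Y Z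
    by (simp only: matrix_mult_sum_left matrix_mult_cscale_left)
  have 2: "X ** (\<Sum>j\<in>J. g j *\<^sub>C G j) ** Z = (\<Sum>j\<in>J. g j *\<^sub>C (X ** G j ** Z))" for X Z
    by (simp only: matrix_mult_sum_left matrix_mult_sum_right matrix_mult_cscale_left matrix_mult_cscale_right)
  have 3: "X ** (\<Sum>k\<in>K. h k *\<^sub>C H k) = (\<Sum>k\<in>K. h k *\<^sub>C (X ** H k))" for X
    by (simp only: matrix_mult_sum_right matrix_mult_cscale_right)
  let ?G = "\<Sum>j\<in>J. g j *\<^sub>C G j" and ?H = "\<Sum>k\<in>K. h k *\<^sub>C H k"
  have "trace ((\<Sum>i\<in>I. f i *\<^sub>C F i) ** ?G ** ?H) = (\<Sum>i\<in>I. f i * trace (F i ** ?G ** ?H))"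
    unfolding 1 trace_sum trace_cscale ..
  also have "\<dots> = (\<Sum>i\<in>I. \<Sum>j\<in>J. f i * g j * trace (F i ** G j ** ?H))"
    unfolding 2 trace_sum trace_cscale sum_distrib_left mult.assoc ..
  also have "\<dots> = (\<Sum>i\<in>I. \<Sum>j\<in>J. \<Sum>k\<in>K. f i * g j * h k * trace (F i ** G j ** H k))"
    unfolding 3 trace_sum trace_cscale sum_distrib_left mult.assoc ..
  finally show ?thesis .
qed

lemma gt_basis_expansion:
  assumes "gt_basis a V R e" "v \<in> V" shows "v = (\<Sum>l\<in>gt_labels a. cinner (e l) v *\<^sub>C e l)"
proof (cases a)
  case (Pair p q)
  have "\<forall>v\<in>V. v = (\<Sum>l\<in>gt_labels a. cinner (e l) v *\<^sub>C e l)"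
    using assms(1) unfolding Pair gt_basis.simps by (elim conjE)
  then show ?thesis using assms(2) by (rule bspec)
qed

theorem corollary4p26:
  fixes p :: nat and a :: "nat \<times> nat"
    and \<rho> :: "complex^3^3 \<Rightarrow> complex^'d^'d"
    and e :: "gt_label \<Rightarrow> complex^'d"
    and E :: "nat \<Rightarrow> gt_label \<Rightarrow> complex^'d^'d"
    and M :: "cp2 measure"
    and W :: "complex^'d^'d \<Rightarrow> cp2 \<Rightarrow> complex"
    and K :: "complex^'d^'d"
    and c :: "nat \<Rightarrow> real"
  assumes "p \<ge> 1" and "a = (p, 0) \<or> a = (0, p)"
    and "irrep a UNIV (vec_rep \<rho>)"
    and "gt_basis a UNIV (vec_rep \<rho>) e"
    and "coupled_basis a \<rho> e E"
    and "invariant_prob M"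
    and "symbol_correspondence a \<rho> M W"
    and "is_operator_kernel \<rho> W K"
    and "characteristic_numbers a E K c"
  shows
    "is_dual_correspondence a \<rho> M W (dual_correspondence a \<rho> M W)
     \<and> is_operator_kernel \<rho> (dual_correspondence a \<rho> M W) (dual_kernel a \<rho> M W)
     \<and> characteristic_numbers a E (dual_kernel a \<rho> M W) (\<lambda>n. 1 / c n)
     \<and> (\<forall>x1 x2 x3.
          integral_trikernel a \<rho> M W x1 x2 x3
            = (of_nat (irrep_dim a))\<^sup>2
              * trace (kernel_at \<rho> (dual_kernel a \<rho> M W) x1 ** kernel_at \<rho> (dual_kernel a \<rho> M W) x2
                       ** kernel_at \<rho> K x3)
        \<and> integral_trikernel a \<rho> M W x1 x2 x3
            = (- 1) ^ p * complex_of_real (sqrt (real (irrep_dim a)))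
              * (\<Sum>n1=0..p. \<Sum>n2=0..p. \<Sum>n3=0..p.
                 \<Sum>l1\<in>gt_labels (n1, n1). \<Sum>l2\<in>gt_labels (n2, n2). \<Sum>l3\<in>gt_labels (n3, n3).
                   wigner_product_symbol a e E n1 l1 n2 l2 n3 l3
                   * complex_of_real (c n3 / (c n1 * c n2))
                   * cnj (harmonic \<rho> E n1 l1 x1) * cnj (harmonic \<rho> E n2 l2 x2)
                   * cnj (harmonic \<rho> E n3 l3 x3)))
     \<and> (\<forall>x1 x2.
          reproducing_kernel a \<rho> M W x1 x2 = (LINT x|M. integral_trikernel a \<rho> M W x1 x x2)
        \<and> reproducing_kernel a \<rho> M W x1 x2
            = (\<Sum>n=0..p. \<Sum>l\<in>gt_labels (n, n). cnj (harmonic \<rho> E n l x1) * harmonic \<rho> E n l x2)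
        \<and> reproducing_kernel a \<rho> M W x1 x2 = reproducing_kernel a \<rho> M W x2 x1)"
proof -
  have abs_a: "abs_label a = p" and dim: "irrep_dim a > 0"
    using assms(2) by (auto simp: div_greater_zero_iff)
  obtain V where V: "\<forall>n\<le>p. irrep (n, n) (V n) (op_rep \<rho>) \<and> gt_basis (n, n) (V n) (op_rep \<rho>) (E n)"
    "\<forall>m\<le>p. \<forall>n\<le>p. m \<noteq> n \<longrightarrow> (\<forall>A\<in>V m. \<forall>B\<in>V n. cinner A B = 0)"
    "\<forall>A. \<exists>B. (\<forall>n\<le>p. B n \<in> V n) \<and> A = (\<Sum>n\<le>p. B n)"
    using assms(5) unfolding coupled_basis_def abs_a by blast
  have cg: "\<forall>n\<le>p. \<forall>l1\<in>gt_labels a. \<forall>l2\<in>gt_labels (dual_label a). \<forall>l\<in>gt_labels (n, n).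
        clebsch_gordan a e E l1 l2 n l \<in> \<real>"
    and one: "E 0 ((0, 0, 0), 0) = complex_of_real (1 / sqrt (real (irrep_dim a))) *\<^sub>C mat 1"
    using assms(5) unfolding coupled_basis_def abs_a by blast+
  \<comment> \<open>The hypotheses of the theorem, with the decomposition V just obtained, are
    exactly the data of this locale.\<close>
  interpret quantized \<rho> p E V a M W K c
  proof unfold_locales
    show "unitary_rep UNIV (vec_rep \<rho>)" using assms(3) by (simp add: irrep_def)
  qed (use V abs_a dim one assms in \<open>auto simp: irrep_def\<close>)
  have basis: "v = (\<Sum>l\<in>gt_labels a. cinner (e l) v *\<^sub>C e l)" for v
    by (rule gt_basis_expansion[OF assms(4)]) simp
  \<comment> \<open>Pairing the degree with its label gives one index per kernel, as
    \<open>trace_triple_sum\<close> expects; the sums are separated and reordered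
    afterwards.\<close>
  let ?S = "Sigma {..p} (\<lambda>n. gt_labels (n, n))"
  let ?r = "complex_of_real (sqrt (real (irrep_dim a)))"
  have rr: "?r * ?r = of_nat (irrep_dim a)" by (simp add: of_real_mult[symmetric] del: of_real_mult)
  have r0: "?r \<noteq> 0" using dim by simp
  have wigner: "integral_trikernel a \<rho> M W x1 x2 x3
      = (- 1) ^ p * ?r
        * (\<Sum>n1\<le>p. \<Sum>n2\<le>p. \<Sum>n3\<le>p.
           \<Sum>l1\<in>gt_labels (n1, n1). \<Sum>l2\<in>gt_labels (n2, n2). \<Sum>l3\<in>gt_labels (n3, n3).
             wigner_product_symbol a e E n1 l1 n2 l2 n3 l3
             * complex_of_real (c n3 / (c n1 * c n2))
             * cnj (harmonic \<rho> E n1 l1 x1) * cnj (harmonic \<rho> E n2 l2 x2)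
             * cnj (harmonic \<rho> E n3 l3 x3))" for x1 x2 x3
  proof -
    have fin: "finite (gt_labels (n, n))" for n by (rule finite_gt_labels)
    let ?t = "\<lambda>n1 l1 n2 l2 n3 l3. wigner_product_symbol a e E n1 l1 n2 l2 n3 l3
             * complex_of_real (c n3 / (c n1 * c n2))
             * cnj (harmonic \<rho> E n1 l1 x1) * cnj (harmonic \<rho> E n2 l2 x2)
             * cnj (harmonic \<rho> E n3 l3 x3)"
    have "integral_trikernel a \<rho> M W x1 x2 x3 = (of_nat (irrep_dim a))\<^sup>2 *
       (\<Sum>(n1, l1)\<in>?S. \<Sum>(n2, l2)\<in>?S. \<Sum>(n3, l3)\<in>?S.
          (complex_of_real (1 / c n1 / sqrt (real (irrep_dim a))) * cnj (harmonic \<rho> E n1 l1 x1))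
        * (complex_of_real (1 / c n2 / sqrt (real (irrep_dim a))) * cnj (harmonic \<rho> E n2 l2 x2))
        * (complex_of_real (c n3 / sqrt (real (irrep_dim a))) * cnj (harmonic \<rho> E n3 l3 x3))
        * trace (E n1 l1 ** E n2 l2 ** E n3 l3))"
      unfolding trikernel_eq kernel_at_K kernel_at_K_dual
      by (simp only: sum.Sigma[OF finite_atMost ballI[OF fin]] split_def trace_triple_sum)
    also have "\<dots> = (of_nat (irrep_dim a))\<^sup>2 *
       (\<Sum>(n1, l1)\<in>?S. \<Sum>(n2, l2)\<in>?S. \<Sum>(n3, l3)\<in>?S. (- 1) ^ p / ?r ^ 3 * ?t n1 l1 n2 l2 n3 l3)"
    proof -
      have eq: "(complex_of_real (1 / c n1 / sqrt (real (irrep_dim a))) * cnj (harmonic \<rho> E n1 l1 x1))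
        * (complex_of_real (1 / c n2 / sqrt (real (irrep_dim a))) * cnj (harmonic \<rho> E n2 l2 x2))
        * (complex_of_real (c n3 / sqrt (real (irrep_dim a))) * cnj (harmonic \<rho> E n3 l3 x3))
        * trace (E n1 l1 ** E n2 l2 ** E n3 l3) = (- 1) ^ p / ?r ^ 3 * ?t n1 l1 n2 l2 n3 l3"
        if "(n1, l1) \<in> ?S" "(n2, l2) \<in> ?S" "(n3, l3) \<in> ?S" for n1 l1 n2 l2 n3 l3
      proof -
        have "trace (E n1 l1 ** E n2 l2 ** E n3 l3)
            = (- 1) ^ p * wigner_product_symbol a e E n1 l1 n2 l2 n3 l3"
          by (rule wigner_product_symbol_eq_trace[OF basis abs_a])
             (use cg mat_adj_mid that in \<open>auto simp: mid_def\<close>)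
        then show ?thesis by (simp add: power3_eq_cube mult_ac)
      qed
      show ?thesis
        unfolding split_def
        by (intro arg_cong[where f = "\<lambda>z. _ * z"] sum.cong refl eq) simp_all
    qed
    also have "\<dots> = (- 1) ^ p * ?r * (\<Sum>(n1, l1)\<in>?S. \<Sum>(n2, l2)\<in>?S. \<Sum>(n3, l3)\<in>?S. ?t n1 l1 n2 l2 n3 l3)"
    proof -
      \<comment> \<open>With \<open>r = sqrt dim\<close>, the three kernels contribute
        \<open>1 / r ^ 3\<close> against the prefactor \<open>r ^ 4\<close>, which leaves a single
        r.\<close>
      have "(of_nat (irrep_dim a))\<^sup>2 * ((- 1) ^ p / ?r ^ 3) = (- 1) ^ p * ?r"
        using r0 unfolding rr[symmetric] by (simp add: power2_eq_square power3_eq_cube)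
      then have "(of_nat (irrep_dim a))\<^sup>2 * ((- 1) ^ p / ?r ^ 3 * z) = (- 1) ^ p * ?r * z" for z
        by (metis mult.assoc)
      then show ?thesis unfolding split_def sum_distrib_left[symmetric] .
    qed
    also have "(\<Sum>(n1, l1)\<in>?S. \<Sum>(n2, l2)\<in>?S. \<Sum>(n3, l3)\<in>?S. ?t n1 l1 n2 l2 n3 l3)
       = (\<Sum>n1\<le>p. \<Sum>l1\<in>gt_labels (n1, n1). \<Sum>n2\<le>p. \<Sum>l2\<in>gt_labels (n2, n2). \<Sum>n3\<le>p. \<Sum>l3\<in>gt_labels (n3, n3).
           ?t n1 l1 n2 l2 n3 l3)"
      by (simp only: sum.Sigma[OF finite_atMost ballI[OF fin], symmetric])
    also have "\<dots> = (\<Sum>n1\<le>p. \<Sum>n2\<le>p. \<Sum>l1\<in>gt_labels (n1, n1). \<Sum>l2\<in>gt_labels (n2, n2). \<Sum>n3\<le>p. \<Sum>l3\<in>gt_labels (n3, n3).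
           ?t n1 l1 n2 l2 n3 l3)"
      by (rule sum.cong[OF refl], rule sum.swap)
    also have "\<dots> = (\<Sum>n1\<le>p. \<Sum>n2\<le>p. \<Sum>l1\<in>gt_labels (n1, n1). \<Sum>n3\<le>p. \<Sum>l2\<in>gt_labels (n2, n2). \<Sum>l3\<in>gt_labels (n3, n3).
           ?t n1 l1 n2 l2 n3 l3)"
      by (rule sum.cong[OF refl], rule sum.cong[OF refl], rule sum.cong[OF refl], rule sum.swap)
    also have "\<dots> = (\<Sum>n1\<le>p. \<Sum>n2\<le>p. \<Sum>n3\<le>p. \<Sum>l1\<in>gt_labels (n1, n1). \<Sum>l2\<in>gt_labels (n2, n2). \<Sum>l3\<in>gt_labels (n3, n3).
           ?t n1 l1 n2 l2 n3 l3)"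
      by (rule sum.cong[OF refl], rule sum.cong[OF refl], rule sum.swap)
    finally show ?thesis .
  qed
  show ?thesis
    unfolding dual_kernel_eq dual_correspondence_eq atLeast0AtMost
    using dual_W_dual kernel_W_dual characteristic_numbers_dual trikernel_eq wigner
      reproducing_kernel_trace reproducing_kernel_harmonic reproducing_kernel_commute
    by (intro conjI allI) (simp_all only:)
qed

end
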